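(* Let $A$ be a unital C*-algebra such that, for every $m\ge 2$, the map $GL_{m-1}(A)\to GL_m(A)$, $a\mapsto \begin{pmatrix} a & 0\\ 0& 1\end{pmatrix}$, is a weak homotopy equivalence. Let $X$ be a (nonempty) compact Hausdorff space. Then $$gsr(C(X)\otimes A) = gsr(A),$$ and $csr(C(X)\otimes A) = csr(A)$ if $csr(A)\geq 2$, while $csr(C(X)\otimes A)\in\{1,2\}$ if $csr(A)=1$.
   Context: For a unital C*-algebra $A$ and $n\ge 1$, $Lg_n(A)$ is the set of left unimodular vectors, i.e. $(a_1,\dots,a_n)\in A^n$ with $Aa_1+\dots+Aa_n=A$, topologized as a subspace of $A^n$. $GL_n(A)$ is the group of invertible elements of $M_n(A)$, acting on $Lg_n(A)$ by left multiplication; $GL_n^0(A)$ is the connected component of the identity. The general stable rank $gsr(A)$ is the least $n\ge 1$ such that $GL_m(A)$ acts transitively on $Lg_m(A)$ for all $m\ge n$ (equivalently: for all $m\ge n$, every projective right $A$-module $P$ with $P\oplus A\cong A^m$ satisfies $P\cong A^{m-1}$). The connected stable rank $csr(A)$ is the least $n\ge 1$ such that $GL_m^0(A)$ acts transitively on $Lg_m(A)$ for all $m\ge n$ (equivalently, $Lg_m(A)$ is connected for all $m\ge n$). Each is $+\infty$ if no such $n$ exists. *)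

theory Defs
  imports "HOL-Analysis.Analysis" "HOL-Library.Extended_Nat"
begin

section \<open>Unital C*-algebras\<close>

class scaleC =
  fixes scaleC :: "complex \<Rightarrow> 'a \<Rightarrow> 'a"  (infixr \<open>*\<^sub>C\<close> 75)

class star =
  fixes star :: "'a \<Rightarrow> 'a"  (\<open>(_\<^sup>\<star>)\<close> [1000] 999)

text \<open>
  Completeness is part of \<^class>\<open>banach\<close>, submultiplicativity of the norm part of
  \<^class>\<open>real_normed_algebra\<close>.  Using \<^class>\<open>monoid_mult\<close> rather than
  \<^class>\<open>real_normed_algebra_1\<close> admits the zero algebra.
\<close>

class unital_cstar_algebra = banach + real_normed_algebra + monoid_mult + scaleC + star +
  assumes scaleC_of_real: "of_real r *\<^sub>C x = r *\<^sub>R x"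
    and scaleC_add_right: "c *\<^sub>C (x + y) = c *\<^sub>C x + c *\<^sub>C y"
    and scaleC_add_left: "(c + d) *\<^sub>C x = c *\<^sub>C x + d *\<^sub>C x"
    and scaleC_scaleC: "c *\<^sub>C d *\<^sub>C x = (c * d) *\<^sub>C x"
    and mult_scaleC_left: "(c *\<^sub>C x) * y = c *\<^sub>C (x * y)"
    and mult_scaleC_right: "x * (c *\<^sub>C y) = c *\<^sub>C (x * y)"
    and norm_scaleC: "norm (c *\<^sub>C x) = cmod c * norm x"
    and star_star: "(x\<^sup>\<star>)\<^sup>\<star> = x"
    and star_add: "(x + y)\<^sup>\<star> = x\<^sup>\<star> + y\<^sup>\<star>"
    and star_scaleC: "(c *\<^sub>C x)\<^sup>\<star> = cnj c *\<^sub>C x\<^sup>\<star>"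
    and star_mult: "(x * y)\<^sup>\<star> = y\<^sup>\<star> * x\<^sup>\<star>"
    and cstar_identity: "norm (x\<^sup>\<star> * x) = (norm x)\<^sup>2"

lemma norm_star: "norm (x\<^sup>\<star>) = norm x" for x :: "'a::unital_cstar_algebra"
proof -
  have le: "norm y \<le> norm (y\<^sup>\<star>)" for y :: 'a
  proof (cases "y = 0")
    case False
    have "(norm y)\<^sup>2 \<le> norm (y\<^sup>\<star>) * norm y"
      using norm_mult_ineq[of "y\<^sup>\<star>" y] by (simp add: cstar_identity)
    then show ?thesis
      using False by (simp add: power2_eq_square)
  qed simp
  show ?thesis
    using le[of x] le[of "x\<^sup>\<star>"] by (simp add: star_star)
qed

lemma bounded_linear_scaleC:
  "bounded_linear (\<lambda>x :: 'a::unital_cstar_algebra. c *\<^sub>C x)"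
proof (rule bounded_linear_intro[where K = "cmod c"])
  fix r and x :: 'a
  show "c *\<^sub>C (r *\<^sub>R x) = r *\<^sub>R (c *\<^sub>C x)"
    by (metis mult.commute scaleC_of_real scaleC_scaleC)
qed (simp_all add: scaleC_add_right norm_scaleC mult.commute)

lemma bounded_linear_star:
  "bounded_linear (\<lambda>x :: 'a::unital_cstar_algebra. x\<^sup>\<star>)"
proof (rule bounded_linear_intro[where K = 1])
  fix r and x :: 'a
  show "(r *\<^sub>R x)\<^sup>\<star> = r *\<^sub>R (x\<^sup>\<star>)"
    by (metis complex_cnj_complex_of_real scaleC_of_real star_scaleC)
qed (simp_all add: star_add norm_star)


section \<open>The C*-algebra of continuous functions\<close>

text \<open>
  For a compact space \<open>'x\<close> every continuous function is bounded, so \<open>'x \<Rightarrow>\<^sub>C 'a\<close> is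
  \<open>C(X, A)\<close> with pointwise operations and the supremum norm.
\<close>

lemma compact_bcontfun:
  fixes f :: "'x::topological_space \<Rightarrow> 'a::metric_space"
  assumes "compact (UNIV :: 'x set)" "continuous_on UNIV f"
  shows "f \<in> bcontfun"
  using assms by (auto simp: bcontfun_def intro: compact_imp_bounded compact_continuous_image)

instance bcontfun :: (topological_space, complete_space) complete_space
proof
  fix f :: "nat \<Rightarrow> ('a, 'b) bcontfun"
  assume "Cauchy f"
  then obtain g where "uniform_limit UNIV f g sequentially"
    using uniformly_convergent_eq_cauchy[of "\<lambda>_. True" f]
    unfolding Cauchy_def uniform_limit_sequentially_iff
    by (metis dist_fun_lt_imp_dist_val_lt)
  from uniform_limit_bcontfunE[OF this sequentially_bot]
  obtain l' where "g = apply_bcontfun l'" "(f \<longlonglongrightarrow> l')" by metis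
  then show "convergent f"
    by (intro convergentI)
qed

instance bcontfun :: (topological_space, banach) banach ..

instantiation bcontfun :: (topological_space, unital_cstar_algebra) unital_cstar_algebra
begin

definition times_bcontfun_def: "f * g = Bcontfun (\<lambda>x. apply_bcontfun f x * apply_bcontfun g x)"
definition one_bcontfun_def: "1 = const_bcontfun 1"
definition scaleC_bcontfun_def: "c *\<^sub>C f = Bcontfun (\<lambda>x. c *\<^sub>C apply_bcontfun f x)"
definition star_bcontfun_def: "f\<^sup>\<star> = Bcontfun (\<lambda>x. (apply_bcontfun f x)\<^sup>\<star>)"

lemma apply_times_bcontfun: "apply_bcontfun (f * g) x = f x * g x"
  for f g :: "'a \<Rightarrow>\<^sub>C 'b"
proof -
  have "(\<lambda>x. f x * g x) \<in> bcontfun"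
  proof (rule bcontfun_normI)
    show "continuous_on UNIV (\<lambda>x. f x * g x)"
      by (intro continuous_intros) auto
    show "norm (f x * g x) \<le> norm f * norm g" for x
      by (intro order.trans[OF norm_mult_ineq] mult_mono norm_bounded norm_ge_zero)
  qed
  then show ?thesis
    by (simp add: times_bcontfun_def Bcontfun_inverse)
qed

lemma apply_one_bcontfun: "apply_bcontfun (1 :: 'a \<Rightarrow>\<^sub>C 'b) x = 1"
  by (simp add: one_bcontfun_def)

lemma apply_scaleC_bcontfun: "apply_bcontfun (c *\<^sub>C f) x = c *\<^sub>C f x"
  for f :: "'a \<Rightarrow>\<^sub>C 'b"
proof -
  have "(\<lambda>x. c *\<^sub>C f x) \<in> bcontfun"
  proof (rule bcontfun_normI)
    show "continuous_on UNIV (\<lambda>x. c *\<^sub>C f x)"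
      by (intro bounded_linear.continuous_on[OF bounded_linear_scaleC]) auto
    show "norm (c *\<^sub>C f x) \<le> cmod c * norm f" for x
      by (simp add: norm_scaleC mult_left_mono norm_bounded)
  qed
  then show ?thesis
    by (simp add: scaleC_bcontfun_def Bcontfun_inverse)
qed

lemma apply_star_bcontfun: "apply_bcontfun (f\<^sup>\<star>) x = (f x)\<^sup>\<star>"
  for f :: "'a \<Rightarrow>\<^sub>C 'b"
proof -
  have "(\<lambda>x. (f x)\<^sup>\<star>) \<in> bcontfun"
  proof (rule bcontfun_normI)
    show "continuous_on UNIV (\<lambda>x. (f x)\<^sup>\<star>)"
      by (intro bounded_linear.continuous_on[OF bounded_linear_star]) auto
    show "norm ((f x)\<^sup>\<star>) \<le> norm f" for x
      by (simp add: norm_star norm_bounded)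
  qed
  then show ?thesis
    by (simp add: star_bcontfun_def Bcontfun_inverse)
qed

instance
proof
  fix f g h :: "'a \<Rightarrow>\<^sub>C 'b" and c d :: complex and r :: real
  note app = apply_times_bcontfun apply_one_bcontfun apply_scaleC_bcontfun apply_star_bcontfun
  show "f * g * h = f * (g * h)" "(f + g) * h = f * h + g * h" "f * (g + h) = f * g + f * h"
    "1 * f = f" "f * 1 = f" "(r *\<^sub>R f) * g = r *\<^sub>R (f * g)" "f * (r *\<^sub>R g) = r *\<^sub>R (f * g)"
    by (auto intro!: bcontfun_eqI simp: app algebra_simps)
  show norm_mult: "norm (f * g) \<le> norm f * norm g" for f g :: "'a \<Rightarrow>\<^sub>C 'b"
    by (intro norm_bound, unfold app)
      (intro order.trans[OF norm_mult_ineq] mult_mono norm_bounded norm_ge_zero)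
  show "of_real r *\<^sub>C f = r *\<^sub>R f" "c *\<^sub>C (f + g) = c *\<^sub>C f + c *\<^sub>C g"
    "(c + d) *\<^sub>C f = c *\<^sub>C f + d *\<^sub>C f" "c *\<^sub>C d *\<^sub>C f = (c * d) *\<^sub>C f"
    "(c *\<^sub>C f) * g = c *\<^sub>C (f * g)" "f * (c *\<^sub>C g) = c *\<^sub>C (f * g)"
    "(f\<^sup>\<star>)\<^sup>\<star> = f" "(f + g)\<^sup>\<star> = f\<^sup>\<star> + g\<^sup>\<star>" "(c *\<^sub>C f)\<^sup>\<star> = cnj c *\<^sub>C f\<^sup>\<star>" "(f * g)\<^sup>\<star> = g\<^sup>\<star> * f\<^sup>\<star>"
    by (auto intro!: bcontfun_eqI simp: app scaleC_of_real scaleC_add_right scaleC_add_left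
        scaleC_scaleC mult_scaleC_left mult_scaleC_right star_star star_add star_scaleC star_mult)
  have le: "norm (c *\<^sub>C f) \<le> cmod c * norm f" for c and f :: "'a \<Rightarrow>\<^sub>C 'b"
    by (rule norm_bound) (simp add: app norm_scaleC mult_left_mono norm_bounded)
  show "norm (c *\<^sub>C f) = cmod c * norm f"
  proof (cases "c = 0")
    case True
    then show ?thesis using le[of c f] by simp
  next
    case False
    have "inverse c *\<^sub>C c *\<^sub>C f = f"
      using False scaleC_of_real[where ?'a = 'b and r = 1]
      by (auto intro!: bcontfun_eqI simp: app scaleC_scaleC)
    then have "norm f \<le> norm (c *\<^sub>C f) / cmod c"
      using le[of "inverse c" "c *\<^sub>C f"] by (simp add: norm_inverse divide_inverse mult.commute)
    then show ?thesis
      using le[of c f] False by (simp add: field_simps)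
  qed
  have norm_star: "norm (f\<^sup>\<star>) \<le> norm f" for f :: "'a \<Rightarrow>\<^sub>C 'b"
    by (rule norm_bound) (simp add: app norm_star norm_bounded)
  show "norm (f\<^sup>\<star> * f) = (norm f)\<^sup>2"
  proof (rule antisym)
    show "norm (f\<^sup>\<star> * f) \<le> (norm f)\<^sup>2"
      using order.trans[OF norm_mult mult_right_mono[OF norm_star norm_ge_zero]]
      by (simp add: power2_eq_square)
    have "norm (f x) \<le> sqrt (norm (f\<^sup>\<star> * f))" for x
      using norm_bounded[of "f\<^sup>\<star> * f" x] by (intro real_le_rsqrt) (simp add: app cstar_identity)
    then have "norm f \<le> sqrt (norm (f\<^sup>\<star> * f))"
      by (rule norm_bound)
    then have "(norm f)\<^sup>2 \<le> (sqrt (norm (f\<^sup>\<star> * f)))\<^sup>2"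
      by (intro power_mono) auto
    then show "(norm f)\<^sup>2 \<le> norm (f\<^sup>\<star> * f)"
      by simp
  qed
qed

end

text \<open>
  For compact Hausdorff \<open>X\<close>, the tensor product \<open>C(X) \<otimes> A\<close> (unambiguous, as \<open>C(X)\<close> is nuclear)
  is \<open>C(X, A)\<close>: \<open>f \<otimes> a\<close> is the function \<open>x \<mapsto> f(x) a\<close>, and the norm of
  \<open>\<Sum>\<^sub>k f\<^sub>k \<otimes> a\<^sub>k\<close> is \<open>sup\<^sub>x \<parallel>\<Sum>\<^sub>k f\<^sub>k(x) a\<^sub>k\<parallel>\<close>.  The following lemma shows that the
  algebraic tensor product is dense.
\<close>

abbreviation elementary_tensor ::
    "('x::topological_space \<Rightarrow>\<^sub>C complex) \<Rightarrow> 'a \<Rightarrow> 'x \<Rightarrow>\<^sub>C 'a::unital_cstar_algebra" where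
  "elementary_tensor f a \<equiv> Bcontfun (\<lambda>x. f x *\<^sub>C a)"

lemma closure_span_elementary_tensor:
  assumes compact: "compact (UNIV :: 'x::t2_space set)"
  shows "closure (span {elementary_tensor f a | f a. True}) =
    (UNIV :: ('x \<Rightarrow>\<^sub>C 'a::unital_cstar_algebra) set)"
proof (intro equalityI subset_UNIV subsetI)
  fix F :: "'x \<Rightarrow>\<^sub>C 'a"
  show "F \<in> closure (span {elementary_tensor f a | f a. True})"
    unfolding closure_approachable
  proof (intro allI impI)
    fix e :: real assume e: "e > 0"
    have "compact (range F)"
      by (intro compact_continuous_image compact) auto
    moreover have "open (ball a (e/2))" if "a \<in> UNIV" for a :: 'a
      by simp
    moreover have "range F \<subseteq> (\<Union>a\<in>UNIV. ball a (e/2))"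
    proof
      show "y \<in> (\<Union>a\<in>UNIV. ball a (e/2))" for y
        using e by (intro UN_I[of y]) auto
    qed
    ultimately obtain K where K: "finite K" "range F \<subseteq> (\<Union>a\<in>K. ball a (e/2))"
      by (rule compactE_image)
    define g where "g a x = max 0 (e/2 - dist (F x) a)" for a x
    define s where "s x = (\<Sum>a\<in>K. g a x)" for x
    have g_nonneg: "g a x \<ge> 0" for a x
      by (simp add: g_def)
    have s_pos: "s x > 0" for x
    proof -
      obtain a where "a \<in> K" "dist a (F x) < e/2"
        using K(2) by (auto simp: subset_iff)
      then show ?thesis
        unfolding s_def using K(1) g_nonneg
        by (intro sum_pos2[of K a]) (auto simp: g_def dist_commute)
    qed
    have cont_g: "continuous_on UNIV (g a)" for a
      unfolding g_def by (intro continuous_intros) auto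
    have cont_s: "continuous_on UNIV s"
      unfolding s_def by (intro continuous_intros cont_g)
    define p where "p a = Bcontfun (\<lambda>x. of_real (g a x / s x) :: complex)" for a
    have p: "apply_bcontfun (p a) x = of_real (g a x / s x)" for a x
    proof -
      have "s x \<noteq> 0" for x
        using s_pos[of x] by simp
      then have "(\<lambda>x. of_real (g a x / s x) :: complex) \<in> bcontfun"
        by (intro compact_bcontfun compact continuous_intros cont_g cont_s) auto
      then show ?thesis
        by (simp add: p_def Bcontfun_inverse)
    qed
    define G where "G = (\<Sum>a\<in>K. elementary_tensor (p a) a)"
    have tensor: "apply_bcontfun (elementary_tensor (p a) a) x = (g a x / s x) *\<^sub>R a" for a x
    proof -
      have "(\<lambda>x. p a x *\<^sub>C a) = (\<lambda>x. Re (p a x) *\<^sub>R a)"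
        by (simp add: fun_eq_iff p scaleC_of_real del: of_real_divide)
      moreover have "(\<lambda>x. Re (p a x) *\<^sub>R a) \<in> bcontfun"
        by (intro compact_bcontfun compact continuous_intros) auto
      ultimately show ?thesis
        by (simp add: Bcontfun_inverse p del: of_real_divide)
    qed
    have sum_app: "apply_bcontfun (\<Sum>a\<in>L. h a) x = (\<Sum>a\<in>L. apply_bcontfun (h a) x)"
      for L and h :: "'a \<Rightarrow> 'x \<Rightarrow>\<^sub>C 'a" and x
      by (induction L rule: infinite_finite_induct) auto
    have "dist (G x) (F x) \<le> e/2" for x
    proof -
      have one: "(\<Sum>a\<in>K. g a x / s x) = 1"
        using s_pos[of x] by (simp only: sum_divide_distrib[symmetric] s_def[symmetric]) simp
      have "G x - F x = (\<Sum>a\<in>K. (g a x / s x) *\<^sub>R a) - (\<Sum>a\<in>K. g a x / s x) *\<^sub>R F x"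
        by (simp only: G_def sum_app tensor one scaleR_one)
      also have "\<dots> = (\<Sum>a\<in>K. (g a x / s x) *\<^sub>R (a - F x))"
        by (simp only: scaleR_sum_left scaleR_diff_right sum_subtractf)
      also have "norm \<dots> \<le> (\<Sum>a\<in>K. (g a x / s x) * (e/2))"
      proof (rule order.trans[OF norm_sum sum_mono])
        fix a
        have "g a x * norm (a - F x) \<le> g a x * (e/2)"
        proof (cases "norm (a - F x) \<le> e/2")
          case True
          then show ?thesis
            by (intro mult_left_mono g_nonneg)
        next
          case False
          then show ?thesis
            by (simp add: g_def dist_norm norm_minus_commute)
        qed
        then have "g a x / s x * norm (a - F x) \<le> g a x / s x * (e/2)"
          using s_pos[of x] by (simp add: field_simps)
        then show "norm ((g a x / s x) *\<^sub>R (a - F x)) \<le> g a x / s x * (e/2)"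
          using s_pos[of x] g_nonneg[of a x] by simp
      qed
      also have "\<dots> = e/2"
        by (simp only: sum_distrib_right[symmetric] one mult_1)
      finally show ?thesis
        by (simp add: dist_norm)
    qed
    then have "dist G F \<le> e/2"
      by (rule dist_bound)
    moreover have "G \<in> span {elementary_tensor f a | f a. True}"
      unfolding G_def by (intro span_sum span_base) blast
    ultimately show "\<exists>G\<in>span {elementary_tensor f a | f a. True}. dist G F < e"
      using e by (intro bexI[of _ G]) auto
  qed
qed


section \<open>Vectors and matrices over an algebra\<close>

text \<open>
  Since the size varies, \<open>A\<^sup>n\<close> and \<open>M\<^sub>n(A)\<close> are represented by functions on \<^typ>\<open>nat\<close> that vanish
  at all indices \<open>\<ge> n\<close>.  Their topology is induced by the product topology on the function types
  \<open>nat \<Rightarrow> 'a\<close> and \<open>nat \<Rightarrow> nat \<Rightarrow> 'a\<close>, and so it is that of \<open>A\<^sup>n\<close> and of \<open>A\<^bsup>n\<times>n\<^esup>\<close>, which is also the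
  norm topology of \<open>M\<^sub>n(A)\<close>.
\<close>

definition vecs :: "nat \<Rightarrow> (nat \<Rightarrow> 'a::unital_cstar_algebra) set" where
  "vecs n = {v. \<forall>i. \<not> i < n \<longrightarrow> v i = 0}"

definition mats :: "nat \<Rightarrow> (nat \<Rightarrow> nat \<Rightarrow> 'a::unital_cstar_algebra) set" where
  "mats n = {a. \<forall>i j. \<not> (i < n \<and> j < n) \<longrightarrow> a i j = 0}"

definition mat_id :: "nat \<Rightarrow> nat \<Rightarrow> nat \<Rightarrow> 'a::unital_cstar_algebra" where
  "mat_id n i j = (if i < n \<and> i = j then 1 else 0)"

definition mat_mult ::
    "nat \<Rightarrow> (nat \<Rightarrow> nat \<Rightarrow> 'a) \<Rightarrow> (nat \<Rightarrow> nat \<Rightarrow> 'a) \<Rightarrow> nat \<Rightarrow> nat \<Rightarrow> 'a::unital_cstar_algebra" where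
  "mat_mult n a b i j = (\<Sum>k<n. a i k * b k j)"

definition mat_vec ::
    "nat \<Rightarrow> (nat \<Rightarrow> nat \<Rightarrow> 'a) \<Rightarrow> (nat \<Rightarrow> 'a) \<Rightarrow> nat \<Rightarrow> 'a::unital_cstar_algebra" where
  "mat_vec n a v i = (\<Sum>j<n. a i j * v j)"

definition GL :: "nat \<Rightarrow> (nat \<Rightarrow> nat \<Rightarrow> 'a::unital_cstar_algebra) set" where
  "GL n = {a \<in> mats n. \<exists>b \<in> mats n. mat_mult n a b = mat_id n \<and> mat_mult n b a = mat_id n}"

definition GL0 :: "nat \<Rightarrow> (nat \<Rightarrow> nat \<Rightarrow> 'a::unital_cstar_algebra) set" where
  "GL0 n = connected_component_set (GL n) (mat_id n)"

definition Lg :: "nat \<Rightarrow> (nat \<Rightarrow> 'a::unital_cstar_algebra) set" where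
  "Lg n = {v \<in> vecs n. {\<Sum>i<n. b i * v i | b. True} = UNIV}"

text \<open>The block matrix \<open>diag(a, 1)\<close>, of size \<open>n + 1\<close> for \<open>a\<close> of size \<open>n\<close>.\<close>

definition diag_one ::
    "nat \<Rightarrow> (nat \<Rightarrow> nat \<Rightarrow> 'a) \<Rightarrow> nat \<Rightarrow> nat \<Rightarrow> 'a::unital_cstar_algebra" where
  "diag_one n a i j =
    (if i < n \<and> j < n then a i j else if i = n \<and> j = n then 1 else 0)"


section \<open>General and connected stable rank\<close>

definition acts_transitively ::
    "nat \<Rightarrow> (nat \<Rightarrow> nat \<Rightarrow> 'a) set \<Rightarrow> (nat \<Rightarrow> 'a::unital_cstar_algebra) set \<Rightarrow> bool" where
  "acts_transitively n G V \<longleftrightarrow> (\<forall>v\<in>V. \<forall>w\<in>V. \<exists>g\<in>G. mat_vec n g v = w)"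

text \<open>In \<^typ>\<open>enat\<close>, the infimum of the empty set is \<open>\<infinity>\<close>.\<close>

definition gsr :: "'a::unital_cstar_algebra itself \<Rightarrow> enat" where
  "gsr _ = (INF n \<in> {n. 1 \<le> n \<and>
    (\<forall>m\<ge>n. acts_transitively m (GL m) (Lg m :: (nat \<Rightarrow> 'a) set))}. enat n)"

definition csr :: "'a::unital_cstar_algebra itself \<Rightarrow> enat" where
  "csr _ = (INF n \<in> {n. 1 \<le> n \<and>
    (\<forall>m\<ge>n. acts_transitively m (GL0 m) (Lg m :: (nat \<Rightarrow> 'a) set))}. enat n)"


section \<open>Weak homotopy equivalences\<close>

definition cube :: "nat \<Rightarrow> (nat \<Rightarrow> real) topology" where
  "cube n = product_topology (\<lambda>_. top_of_set {0..1}) {..<n}"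

definition cube_boundary :: "nat \<Rightarrow> (nat \<Rightarrow> real) set" where
  "cube_boundary n = {s \<in> topspace (cube n). \<exists>i<n. s i = 0 \<or> s i = 1}"

definition based_maps :: "nat \<Rightarrow> 'a topology \<Rightarrow> 'a \<Rightarrow> ((nat \<Rightarrow> real) \<Rightarrow> 'a) set" where
  "based_maps n X x = {u. continuous_map (cube n) X u \<and> (\<forall>s \<in> cube_boundary n. u s = x)}"

definition based_homotopy ::
    "nat \<Rightarrow> 'a topology \<Rightarrow> 'a \<Rightarrow> (((nat \<Rightarrow> real) \<Rightarrow> 'a) \<times> ((nat \<Rightarrow> real) \<Rightarrow> 'a)) set" where
  "based_homotopy n X x = {(u, v).
    homotopic_with (\<lambda>w. \<forall>s \<in> cube_boundary n. w s = x) (cube n) X u v}"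

text \<open>The underlying set of \<open>\<pi>\<^sub>n(X, x)\<close> for \<open>n \<ge> 1\<close>.\<close>

definition homotopy_classes :: "nat \<Rightarrow> 'a topology \<Rightarrow> 'a \<Rightarrow> ((nat \<Rightarrow> real) \<Rightarrow> 'a) set set" where
  "homotopy_classes n X x = based_maps n X x // based_homotopy n X x"

definition induced_map ::
    "nat \<Rightarrow> 'b topology \<Rightarrow> ('a \<Rightarrow> 'b) \<Rightarrow> 'a \<Rightarrow>
      ((nat \<Rightarrow> real) \<Rightarrow> 'a) set \<Rightarrow> ((nat \<Rightarrow> real) \<Rightarrow> 'b) set" where
  "induced_map n Y f x c = based_homotopy n Y (f x) `` ((\<lambda>u. f \<circ> u) ` c)"

text \<open>
  The first two clauses say that \<open>f\<close> induces a bijection on path components (injectivity and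
  surjectivity).  The induced maps on \<open>\<pi>\<^sub>n\<close>, \<open>n \<ge> 1\<close>, are group homomorphisms, so they
  are isomorphisms iff they are bijective.
\<close>

definition weak_homotopy_equivalence :: "'a topology \<Rightarrow> 'b topology \<Rightarrow> ('a \<Rightarrow> 'b) \<Rightarrow> bool" where
  "weak_homotopy_equivalence X Y f \<longleftrightarrow> continuous_map X Y f \<and>
    (\<forall>x \<in> topspace X. \<forall>x' \<in> topspace X.
      path_component_of Y (f x) (f x') \<longrightarrow> path_component_of X x x') \<and>
    (\<forall>y \<in> topspace Y. \<exists>x \<in> topspace X. path_component_of Y (f x) y) \<and>
    (\<forall>n\<ge>1. \<forall>x \<in> topspace X.
      bij_betw (induced_map n Y f x) (homotopy_classes n X x) (homotopy_classes n Y (f x)))"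

end

theory Submission
  imports Defs
begin

text \<open>
  For \<open>m \<ge> 2\<close>, suppose that \<open>GL\<^sub>m(A)\<close> acts transitively on \<open>Lg\<^sub>m(A)\<close>.  The orbit map
  \<open>g \<mapsto> g e\<^sub>m\<close> then behaves like a fibration of \<open>GL\<^sub>m(A)\<close> over \<open>Lg\<^sub>m(A)\<close> whose fibre, the stabiliser
  of \<open>e\<^sub>m\<close>, retracts onto \<open>GL\<^sub>m\<^sub>-\<^sub>1(A)\<close>; as the inclusion of \<open>GL\<^sub>m\<^sub>-\<^sub>1(A)\<close> is a weak equivalence, every map
  from the boundary of a cube to \<open>Lg\<^sub>m(A)\<close> extends to the cube.  Since \<open>Lg\<^sub>m(A)\<close> is open in \<open>A\<^sup>m\<close>,
  a map from the compact space \<open>X\<close> to it factors up to homotopy through the nerve of a finite cover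
  and is therefore null-homotopic.  Homotopies in \<open>Lg\<^sub>m(A)\<close> lift to paths in \<open>GL\<^sub>m(C(X, A))\<close>
  starting at the identity, so already \<open>GL\<^sub>m\<^sup>0(C(X, A))\<close> acts transitively on \<open>Lg\<^sub>m(C(X, A))\<close>.
  Conversely, evaluation at a point carries transitivity from \<open>C(X, A)\<close> to \<open>A\<close>.  For \<open>m = 1\<close>
  transitivity of \<open>GL\<^sub>1\<close> says that left invertible elements are invertible, which can be checked
  pointwise.
\<close>

text \<open>Local sections of the orbit map come from one formula: if b v = 1 (row times column) and
  w is close to v, then the matrix 1 + (w - v) b is invertible and sends v to w. Over a compact
  parameter space b can be chosen continuously, so homotopies of left unimodular vectors lift as
  finite products of such matrices. The space X need not have the homotopy type of a cell complex,
  so killing spheres says nothing directly about maps from X; this forces the passage through a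
  finite nerve, over which a cone is built from cubes. The central implication starts from the weak
  condition, transitivity of \<open>GL m\<close> over A, and ends with the strong one, transitivity
  of \<open>GL0 m\<close> over C(X, A). For m \<ge> 2 all four conditions (either group, either
  algebra) are therefore equivalent. For m = 1 only the two conditions on \<open>GL 1\<close> are
  shown to be equivalent, which settles \<open>gsr\<close> but leaves open whether
  \<open>csr\<close> moves from 1 to 2.\<close>

lemma norm_less_one_invertible:
  fixes x :: "'a::unital_cstar_algebra"
  assumes "norm x < 1"
  shows "\<exists>y. (1 + x) * y = 1 \<and> y * (1 + x) = 1"
proof -
  \<comment> \<open>A fixed point of the contraction y \<mapsto> 1 - x y replaces the Neumann series
    and is a right inverse of 1 + x. The mirror image gives a left inverse, and associativity
    identifies the two.\<close>
  have "\<exists>!y. 1 - x * y = y"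
  proof (rule banach_fix_type[where c = "norm x"])
    have "1 - x * y - (1 - x * z) = x * (z - y)" for y z :: 'a
      by (simp add: algebra_simps)
    then show "\<forall>y z. dist (1 - x * y) (1 - x * z) \<le> norm x * dist y z"
      by (metis dist_norm norm_minus_commute norm_mult_ineq)
  qed (use assms in auto)
  then obtain y where y: "1 - x * y = y" by blast
  have "\<exists>!y. 1 - y * x = y"
  proof (rule banach_fix_type[where c = "norm x"])
    have "1 - y * x - (1 - z * x) = (z - y) * x" for y z :: 'a
      by (simp add: algebra_simps)
    then show "\<forall>y z. dist (1 - y * x) (1 - z * x) \<le> norm x * dist y z"
      by (metis dist_norm mult.commute norm_minus_commute norm_mult_ineq)
  qed (use assms in auto)
  then obtain z where z: "1 - z * x = z" by blast
  have 1: "(1 + x) * y = 1"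
    using y by (simp add: algebra_simps)
  have 2: "z * (1 + x) = 1"
    using z by (simp add: algebra_simps)
  have "z = z * ((1 + x) * y)"
    by (simp add: 1)
  also have "\<dots> = y"
    by (simp add: 2 flip: mult.assoc)
  finally show ?thesis
    using 1 2 by auto
qed

section \<open>Matrices\<close>

lemma mat_mult_assoc: "mat_mult n (mat_mult n a b) c = mat_mult n a (mat_mult n b c)"
proof (intro ext)
  fix i j
  have "mat_mult n (mat_mult n a b) c i j = (\<Sum>k<n. \<Sum>l<n. a i l * b l k * c k j)"
    by (simp add: mat_mult_def sum_distrib_right)
  also have "\<dots> = (\<Sum>l<n. \<Sum>k<n. a i l * b l k * c k j)"
    by (rule sum.swap)
  also have "\<dots> = mat_mult n a (mat_mult n b c) i j"
    by (simp add: mat_mult_def sum_distrib_left mult.assoc)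
  finally show "mat_mult n (mat_mult n a b) c i j = mat_mult n a (mat_mult n b c) i j" .
qed

lemma mat_vec_mult: "mat_vec n (mat_mult n a b) v = mat_vec n a (mat_vec n b v)"
proof (intro ext)
  fix i
  have "mat_vec n (mat_mult n a b) v i = (\<Sum>k<n. \<Sum>l<n. a i l * b l k * v k)"
    by (simp add: mat_mult_def mat_vec_def sum_distrib_right)
  also have "\<dots> = (\<Sum>l<n. \<Sum>k<n. a i l * b l k * v k)"
    by (rule sum.swap)
  also have "\<dots> = mat_vec n a (mat_vec n b v) i"
    by (simp add: mat_vec_def sum_distrib_left mult.assoc)
  finally show "mat_vec n (mat_mult n a b) v i = mat_vec n a (mat_vec n b v) i" .
qed

lemma sum_delta_mult:
  fixes f :: "nat \<Rightarrow> 'a::unital_cstar_algebra"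
  shows "(\<Sum>k<n. (if i = k then 1 else 0) * f k) = (if i < n then f i else 0)"
    and "(\<Sum>k<n. f k * (if k = i then 1 else 0)) = (if i < n then f i else 0)"
proof -
  have "(\<Sum>k<n. (if i = k then 1 else 0) * f k) = (\<Sum>k<n. if i = k then f k else 0)"
    by (rule sum.cong) auto
  also have "\<dots> = (if i < n then f i else 0)"
    by (subst sum.delta') auto
  finally show "(\<Sum>k<n. (if i = k then 1 else 0) * f k) = (if i < n then f i else 0)" .
  have "(\<Sum>k<n. f k * (if k = i then 1 else 0)) = (\<Sum>k<n. if k = i then f k else 0)"
    by (rule sum.cong) auto
  also have "\<dots> = (if i < n then f i else 0)"
    by (subst sum.delta) auto
  finally show "(\<Sum>k<n. f k * (if k = i then 1 else 0)) = (if i < n then f i else 0)" .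
qed

lemma mat_id_mats [simp]: "mat_id n \<in> mats n"
  by (auto simp: mat_id_def mats_def)

lemma mat_mult_mats [simp]: "a \<in> mats n \<Longrightarrow> b \<in> mats n \<Longrightarrow> mat_mult n a b \<in> mats n"
  by (auto simp: mat_mult_def mats_def intro!: sum.neutral)

lemma mat_vec_vecs [simp]: "a \<in> mats n \<Longrightarrow> mat_vec n a v \<in> vecs n"
  by (auto simp: mat_vec_def mats_def vecs_def intro!: sum.neutral)

lemma mat_mult_id [simp]:
  assumes "a \<in> mats n"
  shows "mat_mult n (mat_id n) a = a" "mat_mult n a (mat_id n) = a"
proof -
  show "mat_mult n (mat_id n) a = a"
  proof (intro ext)
    fix i j
    show "mat_mult n (mat_id n) a i j = a i j"
    proof (cases "i < n")
      case True
      then show ?thesis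
        using sum_delta_mult(1)[where f = "\<lambda>k. a k j" and i = i and n = n]
        by (simp add: mat_mult_def mat_id_def)
    next
      case False
      then show ?thesis
        using assms by (simp add: mat_mult_def mat_id_def mats_def)
    qed
  qed
  show "mat_mult n a (mat_id n) = a"
  proof (intro ext)
    fix i j
    have "mat_mult n a (mat_id n) i j = (\<Sum>k<n. a i k * (if k = j then 1 else 0))"
      unfolding mat_mult_def mat_id_def by (intro sum.cong) auto
    then show "mat_mult n a (mat_id n) i j = a i j"
      using assms by (auto simp: sum_delta_mult mats_def)
  qed
qed

lemma mat_vec_id [simp]: "v \<in> vecs n \<Longrightarrow> mat_vec n (mat_id n) v = v"
proof
  fix i
  assume "v \<in> vecs n"
  then show "mat_vec n (mat_id n) v i = v i"
    by (cases "i < n") (auto simp: mat_vec_def mat_id_def vecs_def sum_delta_mult)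
qed

lemma GL_mats: "g \<in> GL n \<Longrightarrow> g \<in> mats n"
  by (simp add: GL_def)

lemma mat_id_GL [simp]: "mat_id n \<in> GL n"
  by (auto simp: GL_def intro!: bexI[of _ "mat_id n"])

definition minv :: "nat \<Rightarrow> (nat \<Rightarrow> nat \<Rightarrow> 'a) \<Rightarrow> nat \<Rightarrow> nat \<Rightarrow> 'a::unital_cstar_algebra" where
  "minv n g = (SOME h. h \<in> mats n \<and> mat_mult n g h = mat_id n \<and> mat_mult n h g = mat_id n)"

lemma minv:
  assumes "g \<in> GL n"
  shows "minv n g \<in> mats n" "mat_mult n g (minv n g) = mat_id n" "mat_mult n (minv n g) g = mat_id n"
  using someI_ex[of "\<lambda>h. h \<in> mats n \<and> mat_mult n g h = mat_id n \<and> mat_mult n h g = mat_id n"] assms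
  unfolding minv_def GL_def by blast+

lemma minv_unique:
  assumes "g \<in> GL n" "h \<in> mats n" "mat_mult n g h = mat_id n"
  shows "minv n g = h"
proof -
  have "minv n g = mat_mult n (minv n g) (mat_mult n g h)"
    using assms minv(1)[OF assms(1)] by simp
  also have "\<dots> = h"
    by (simp only: mat_mult_assoc[symmetric] minv(3)[OF assms(1)] mat_mult_id[OF assms(2)])
  finally show ?thesis .
qed

lemma minv_GL [simp]: "g \<in> GL n \<Longrightarrow> minv n g \<in> GL n"
  using minv[of g n] by (auto simp: GL_def)

lemma minv_id [simp]: "minv n (mat_id n) = mat_id n"
  by (rule minv_unique) auto

lemma mat_mult_GL [simp]:
  assumes "g \<in> GL n" "h \<in> GL n"
  shows "mat_mult n g h \<in> GL n"
proof -
  let ?h = "mat_mult n (minv n h) (minv n g)"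
  have "mat_mult n (mat_mult n g h) ?h = mat_mult n g (mat_mult n (mat_mult n h (minv n h)) (minv n g))"
    "mat_mult n ?h (mat_mult n g h) = mat_mult n (minv n h) (mat_mult n (mat_mult n (minv n g) g) h)"
    by (simp_all only: mat_mult_assoc)
  then have "mat_mult n (mat_mult n g h) ?h = mat_id n" "mat_mult n ?h (mat_mult n g h) = mat_id n"
    using assms by (simp_all add: minv GL_mats)
  moreover have "mat_mult n g h \<in> mats n" "?h \<in> mats n"
    using assms by (simp_all add: minv GL_mats)
  ultimately show ?thesis
    unfolding GL_def by blast
qed

lemma mat_vec_minv:
  assumes "g \<in> GL n" "v \<in> vecs n"
  shows "mat_vec n (minv n g) (mat_vec n g v) = v" "mat_vec n g (mat_vec n (minv n g) v) = v"
  using assms by (simp_all add: minv flip: mat_vec_mult)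

text \<open>A left ideal is everything once it contains 1, so a single equation with a witness
  \<open>b\<close> suffices.\<close>

lemma Lg_iff: "v \<in> Lg n \<longleftrightarrow> v \<in> vecs n \<and> (\<exists>b. (\<Sum>i<n. b i * v i) = 1)"
proof
  assume "v \<in> Lg n"
  then show "v \<in> vecs n \<and> (\<exists>b. (\<Sum>i<n. b i * v i) = 1)"
    unfolding Lg_def by (auto simp: set_eq_iff) metis
next
  assume r: "v \<in> vecs n \<and> (\<exists>b. (\<Sum>i<n. b i * v i) = 1)"
  then obtain b where b: "(\<Sum>i<n. b i * v i) = 1" by blast
  have "\<exists>c. x = (\<Sum>i<n. c i * v i)" for x
    by (rule exI[of _ "\<lambda>i. x * b i"]) (simp add: mult.assoc b flip: sum_distrib_left)
  then show "v \<in> Lg n"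
    using r unfolding Lg_def by blast
qed

lemma Lg_vecs: "v \<in> Lg n \<Longrightarrow> v \<in> vecs n"
  by (simp add: Lg_def)

lemma mat_vec_Lg:
  assumes "g \<in> GL n" "v \<in> Lg n"
  shows "mat_vec n g v \<in> Lg n"
proof -
  obtain b where b: "(\<Sum>i<n. b i * v i) = 1"
    using assms by (auto simp: Lg_iff)
  define w where "w = mat_vec n g v"
  have "v = mat_vec n (minv n g) w"
    unfolding w_def using mat_vec_minv(1)[OF assms(1) Lg_vecs[OF assms(2)]] by simp
  then have "1 = (\<Sum>i<n. \<Sum>j<n. b i * minv n g i j * w j)"
    using b by (simp add: mat_vec_def sum_distrib_left mult.assoc)
  also have "\<dots> = (\<Sum>j<n. (\<Sum>i<n. b i * minv n g i j) * w j)"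
    by (subst sum.swap) (simp add: sum_distrib_right)
  finally show ?thesis
    using mat_vec_vecs[OF GL_mats[OF assms(1)], of v]
    unfolding Lg_iff w_def[symmetric] by (intro conjI exI[of _ "\<lambda>j. \<Sum>i<n. b i * minv n g i j"]) auto
qed

section \<open>Rank one perturbations 1 + u b of the identity matrix\<close>

definition rank1 ::
    "nat \<Rightarrow> (nat \<Rightarrow> 'a) \<Rightarrow> (nat \<Rightarrow> 'a) \<Rightarrow> nat \<Rightarrow> nat \<Rightarrow> 'a::unital_cstar_algebra" where
  "rank1 n u b i j = (if i < n \<and> j < n then (if i = j then 1 else 0) + u i * b j else 0)"

lemma rank1_mats [simp]: "rank1 n u b \<in> mats n"
  by (auto simp: rank1_def mats_def)

lemma mat_mult_rank1:
  assumes "i < n" "j < n"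
  shows "mat_mult n (rank1 n u b) (rank1 n u' b') i j =
    (if i = j then 1 else 0) + u i * b j + u' i * b' j + u i * (\<Sum>k<n. b k * u' k) * b' j"
proof -
  have "mat_mult n (rank1 n u b) (rank1 n u' b') i j =
      (\<Sum>k<n. ((if i = k then 1 else 0) + u i * b k) * ((if k = j then 1 else 0) + u' k * b' j))"
    unfolding mat_mult_def rank1_def using assms by (intro sum.cong) auto
  also have "\<dots> = (\<Sum>k<n. (if i = k then 1 else 0) * ((if k = j then 1 else 0) + u' k * b' j))
      + (\<Sum>k<n. (u i * b k) * (if k = j then 1 else 0)) + (\<Sum>k<n. (u i * b k) * (u' k * b' j))"
    by (simp add: distrib_left distrib_right sum.distrib add_ac)
  also have "\<dots> = (if i = j then 1 else 0) + u' i * b' j + u i * b j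
      + u i * (\<Sum>k<n. b k * u' k) * b' j"
    using assms by (simp only: sum_delta_mult if_True)
      (simp add: sum_distrib_left sum_distrib_right mult.assoc)
  finally show ?thesis
    by (simp add: algebra_simps)
qed

text \<open>Sherman-Morrison: if c inverts the element 1 + b u of A, then 1 - u c b inverts the
  matrix 1 + u b.\<close>

lemma rank1_GL:
  assumes "(1 + (\<Sum>k<n. b k * u k)) * c = 1" "c * (1 + (\<Sum>k<n. b k * u k)) = 1"
  shows "rank1 n u b \<in> GL n"
proof -
  define \<beta> where "\<beta> = (\<Sum>k<n. b k * u k)"
  have c: "c + \<beta> * c = 1" "c + c * \<beta> = 1"
    using assms by (auto simp: \<beta>_def distrib_left distrib_right)
  let ?h = "rank1 n (\<lambda>i. - (u i * c)) b"
  have \<beta>c: "(\<Sum>k<n. b k * - (u k * c)) = - (\<beta> * c)"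
    by (simp add: \<beta>_def sum_negf sum_distrib_right mult.assoc)
  then have \<beta>c': "(\<Sum>k<n. - (b k * (u k * c))) = - (\<beta> * c)"
    by simp
  have "mat_mult n (rank1 n u b) ?h i j = mat_id n i j" for i j
  proof (cases "i < n \<and> j < n")
    case True
    have "u i * b j + - (u i * c) * b j + u i * - (\<beta> * c) * b j = u i * (1 - (c + \<beta> * c)) * b j"
      by (simp add: algebra_simps)
    then show ?thesis
      using True by (simp add: mat_mult_rank1 \<beta>c' mat_id_def c add.assoc)
  next
    case False
    then show ?thesis
      using mat_mult_mats[OF rank1_mats rank1_mats, of n u b "\<lambda>i. - (u i * c)" b]
      by (auto simp: mats_def mat_id_def)
  qed
  moreover have "mat_mult n ?h (rank1 n u b) i j = mat_id n i j" for i j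
  proof (cases "i < n \<and> j < n")
    case True
    have "- (u i * c) * b j + u i * b j + - (u i * c) * \<beta> * b j = u i * (1 - (c + c * \<beta>)) * b j"
      by (simp add: algebra_simps)
    then show ?thesis
      using True by (simp add: mat_mult_rank1 mat_id_def c add.assoc flip: \<beta>_def)
  next
    case False
    then show ?thesis
      using mat_mult_mats[OF rank1_mats rank1_mats, of n "\<lambda>i. - (u i * c)" b u b]
      by (auto simp: mats_def mat_id_def)
  qed
  ultimately have "mat_mult n (rank1 n u b) ?h = mat_id n" "mat_mult n ?h (rank1 n u b) = mat_id n"
    by blast+
  then show ?thesis
    unfolding GL_def by (blast intro: rank1_mats)
qed

lemma mat_vec_rank1:
  assumes "v \<in> vecs n"
  shows "mat_vec n (rank1 n u b) v = (\<lambda>i. if i < n then v i + u i * (\<Sum>j<n. b j * v j) else 0)"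
proof
  fix i
  show "mat_vec n (rank1 n u b) v i = (if i < n then v i + u i * (\<Sum>j<n. b j * v j) else 0)"
  proof (cases "i < n")
    case True
    then have "mat_vec n (rank1 n u b) v i =
        (\<Sum>j<n. (if i = j then 1 else 0) * v j + u i * b j * v j)"
      unfolding mat_vec_def rank1_def by (intro sum.cong) (auto simp: distrib_right)
    then show ?thesis
      using True by (simp only: sum.distrib sum_delta_mult) (simp add: sum_distrib_left mult.assoc)
  qed (simp add: mat_vec_def rank1_def)
qed

subsection \<open>Continuity of the matrix operations\<close>

lemma continuous_on_entry:
  "continuous_on S F \<Longrightarrow> continuous_on S (\<lambda>x. F x i j)"
  by (rule continuous_on_product_then_coordinatewise[OF continuous_on_product_then_coordinatewise])

lemma continuous_on_mat_mult:
  assumes "continuous_on S F" "continuous_on S G"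
  shows "continuous_on S (\<lambda>x. mat_mult n (F x) (G x))"
  unfolding mat_mult_def
  by (intro continuous_on_coordinatewise_then_product continuous_on_sum continuous_on_mult
      continuous_on_entry[OF assms(1)] continuous_on_entry[OF assms(2)])

lemma continuous_on_mat_vec:
  assumes "continuous_on S F" "continuous_on S f"
  shows "continuous_on S (\<lambda>x. mat_vec n (F x) (f x))"
  unfolding mat_vec_def
  by (intro continuous_on_coordinatewise_then_product continuous_on_sum continuous_on_mult
      continuous_on_entry[OF assms(1)] continuous_on_product_then_coordinatewise[OF assms(2)])

text \<open>The entrywise sum norm: submultiplicative, and continuous in the entries, which is all
  that the estimates for inversion require.\<close>

definition mnorm :: "nat \<Rightarrow> (nat \<Rightarrow> nat \<Rightarrow> 'a::unital_cstar_algebra) \<Rightarrow> real" where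
  "mnorm n a = (\<Sum>i<n. \<Sum>j<n. norm (a i j))"

lemma mnorm_nonneg: "mnorm n a \<ge> 0"
  by (simp add: mnorm_def sum_nonneg)

lemma norm_le_mnorm:
  assumes "i < n" "j < n"
  shows "norm (a i j) \<le> mnorm n a"
proof -
  have "norm (a i j) \<le> (\<Sum>j<n. norm (a i j))"
    using assms by (intro member_le_sum) auto
  also have "\<dots> \<le> mnorm n a"
    unfolding mnorm_def using assms
    by (intro member_le_sum[of i _ "\<lambda>i. \<Sum>j<n. norm (a i j)"]) (auto intro: sum_nonneg)
  finally show ?thesis .
qed

lemma mnorm_mult: "mnorm n (mat_mult n a b) \<le> mnorm n a * mnorm n b"
proof -
  have "norm (mat_mult n a b i j) \<le> (\<Sum>k<n. norm (a i k) * norm (b k j))" for i j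
    unfolding mat_mult_def by (intro sum_norm_le norm_mult_ineq)
  then have "mnorm n (mat_mult n a b) \<le> (\<Sum>i<n. \<Sum>j<n. \<Sum>k<n. norm (a i k) * norm (b k j))"
    unfolding mnorm_def by (intro sum_mono)
  also have "\<dots> = (\<Sum>i<n. \<Sum>k<n. norm (a i k) * (\<Sum>j<n. norm (b k j)))"
    by (rule sum.cong[OF refl], subst sum.swap) (simp add: sum_distrib_left)
  also have "\<dots> \<le> (\<Sum>i<n. \<Sum>k<n. norm (a i k) * mnorm n b)"
  proof (intro sum_mono mult_left_mono)
    show "(\<Sum>j<n. norm (b k j)) \<le> mnorm n b" if "k \<in> {..<n}" for k
      unfolding mnorm_def using that
      by (intro member_le_sum[of k _ "\<lambda>i. \<Sum>j<n. norm (b i j)"]) (auto intro: sum_nonneg)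
  qed auto
  also have "\<dots> = mnorm n a * mnorm n b"
    by (simp add: mnorm_def sum_distrib_right)
  finally show ?thesis .
qed

lemma mnorm_triangle: "mnorm n (\<lambda>i j. a i j + b i j) \<le> mnorm n a + mnorm n b"
  unfolding mnorm_def sum.distrib[symmetric] by (intro sum_mono norm_triangle_ineq)

text \<open>The resolvent identity, obtained by cancelling on both sides of h - g.\<close>

lemma minv_diff:
  assumes "g \<in> GL n" "h \<in> GL n"
  shows "minv n g i j - minv n h i j =
    mat_mult n (minv n h) (mat_mult n (\<lambda>i j. h i j - g i j) (minv n g)) i j"
proof -
  have "mat_mult n (\<lambda>i j. h i j - g i j) (minv n g) =
      (\<lambda>i j. mat_mult n h (minv n g) i j - mat_id n i j)"
    unfolding minv(2)[OF assms(1), symmetric]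
    by (intro ext) (simp add: mat_mult_def left_diff_distrib sum_subtractf)
  then have "mat_mult n (minv n h) (mat_mult n (\<lambda>i j. h i j - g i j) (minv n g)) i j =
      mat_mult n (minv n h) (mat_mult n h (minv n g)) i j - mat_mult n (minv n h) (mat_id n) i j"
    by (simp add: mat_mult_def right_diff_distrib sum_subtractf)
  also have "\<dots> = minv n g i j - minv n h i j"
    using assms by (simp add: minv flip: mat_mult_assoc)
  finally show ?thesis ..
qed

text \<open>Near \<open>a\<close> the norm K of the inverse is not bounded beforehand. The resolvent
  identity gives K \<le> M \<delta> K + M, hence K \<le> 2 M as soon as M \<delta> < 1/2; inserting
  this bound into the identity once more shows that the difference of the inverses is at most 2 M M
  \<delta>, which tends to 0.\<close>

lemma continuous_on_minv:
  assumes F: "continuous_on S F" "\<And>x. x \<in> S \<Longrightarrow> F x \<in> GL n"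
  shows "continuous_on S (\<lambda>x. minv n (F x))"
proof (intro continuous_on_coordinatewise_then_product)
  fix i j
  show "continuous_on S (\<lambda>x. minv n (F x) i j)"
  proof (cases "i < n \<and> j < n")
    case False
    have "minv n (F x) i j = 0" if "x \<in> S" for x
      using minv(1)[OF F(2)[OF that]] False unfolding mats_def by blast
    then show ?thesis
      by (subst continuous_on_cong[OF refl, where g = "\<lambda>_. 0"]) auto
  next
    case True
    show ?thesis
      unfolding continuous_on_def
    proof
      fix a assume a: "a \<in> S"
      define M where "M = mnorm n (minv n (F a))"
      define \<delta> where "\<delta> x = mnorm n (\<lambda>i j. F a i j - F x i j)" for x
      have "continuous_on S \<delta>"
        unfolding \<delta>_def mnorm_def
        by (intro continuous_on_sum continuous_on_norm continuous_on_diff continuous_on_const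
            continuous_on_entry[OF F(1)])
      then have lim: "(\<delta> \<longlongrightarrow> 0) (at a within S)"
        using a by (auto simp: continuous_on_def \<delta>_def[of a] mnorm_def)
      have M: "M \<ge> 0" and \<delta>: "\<delta> x \<ge> 0" for x
        by (simp_all add: M_def \<delta>_def mnorm_nonneg)
      have "((\<lambda>x. M * \<delta> x) \<longlongrightarrow> 0) (at a within S)"
        by (rule tendsto_eq_intros lim refl | simp)+
      then have ev: "\<forall>\<^sub>F x in at a within S. M * \<delta> x < 1/2"
        by (rule order_tendstoD) simp
      have bound: "norm (minv n (F x) i j - minv n (F a) i j) \<le> 2 * M * M * \<delta> x"
        if x: "x \<in> S" "M * \<delta> x < 1/2" for x
      proof -
        define K where "K = mnorm n (minv n (F x))"
        let ?d = "\<lambda>i j. minv n (F x) i j - minv n (F a) i j"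
        have d: "mnorm n ?d \<le> M * (\<delta> x * K)"
          unfolding minv_diff[OF F(2)[OF x(1)] F(2)[OF a]] M_def \<delta>_def K_def
          by (intro order.trans[OF mnorm_mult] mult_left_mono mnorm_mult mnorm_nonneg)
        have "K = mnorm n (\<lambda>i j. ?d i j + minv n (F a) i j)"
          by (simp add: K_def)
        also have "\<dots> \<le> M * (\<delta> x * K) + M"
          using mnorm_triangle[of n ?d "minv n (F a)"] d by (simp add: M_def)
        also have "\<dots> \<le> 1/2 * K + M"
        proof -
          have "M * \<delta> x * K \<le> 1/2 * K"
            using x(2) by (intro mult_right_mono) (auto simp: K_def mnorm_nonneg)
          then show ?thesis by (simp add: mult.assoc)
        qed
        finally have K: "K \<le> 2 * M" by simp
        have "norm (?d i j) \<le> M * (\<delta> x * K)"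
          using norm_le_mnorm[of i n j ?d] True d by simp
        also have "\<dots> \<le> M * (\<delta> x * (2 * M))"
          by (intro mult_left_mono K M \<delta>)
        finally show ?thesis by (simp add: algebra_simps)
      qed
      have "((\<lambda>x. minv n (F x) i j - minv n (F a) i j) \<longlongrightarrow> 0) (at a within S)"
      proof (rule Lim_null_comparison)
        show "\<forall>\<^sub>F x in at a within S.
            norm (minv n (F x) i j - minv n (F a) i j) \<le> 2 * M * M * \<delta> x"
        proof -
          have "\<forall>\<^sub>F x in at a within S. x \<in> S"
            by (simp add: eventually_at_filter)
          with ev show ?thesis
            by eventually_elim (rule bound)
        qed
        show "((\<lambda>x. 2 * M * M * \<delta> x) \<longlongrightarrow> 0) (at a within S)"
          by (rule tendsto_eq_intros lim refl | simp)+
      qed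
      then show "((\<lambda>x. minv n (F x) i j) \<longlongrightarrow> minv n (F a) i j) (at a within S)"
        by (simp add: LIM_zero_iff)
    qed
  qed
qed

section \<open>Lifting homotopies of left unimodular vectors\<close>

text \<open>A left inverse chosen at one point is nearly a left inverse in a neighbourhood. Finitely
  many choices suffice by compactness, and averaging them with a partition of unity keeps the
  product with v within distance less than 1 of 1, since balls are convex. That product is then
  invertible, and multiplying by its inverse on the left corrects the average.\<close>

lemma continuous_left_inverse:
  fixes Z :: "'z::topological_space set" and v :: "'z \<Rightarrow> nat \<Rightarrow> 'a::unital_cstar_algebra"
  assumes Z: "compact Z" and v: "continuous_on Z v" "\<And>z. z \<in> Z \<Longrightarrow> v z \<in> Lg n"
  shows "\<exists>b. continuous_on Z b \<and> (\<forall>z\<in>Z. (\<Sum>i<n. b z i * v z i) = 1)"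
proof -
  have "\<forall>y\<in>Z. \<exists>b. (\<Sum>i<n. b i * v y i) = 1"
    using v by (simp add: Lg_iff)
  then obtain b0 where b0: "\<And>y. y \<in> Z \<Longrightarrow> (\<Sum>i<n. b0 y i * v y i) = 1"
    by metis
  note v' = continuous_on_product_then_coordinatewise[OF v(1)]
  define c where "c y z = (\<Sum>i<n. b0 y i * v z i)" for y z
  have cont_c: "continuous_on Z (c y)" for y
    unfolding c_def by (intro continuous_on_sum continuous_on_mult continuous_on_const v')
  have "\<exists>T. open T \<and> y \<in> T \<and> (\<forall>z\<in>T \<inter> Z. norm (c y z - 1) < 1/2)" if "y \<in> Z" for y
  proof -
    have "open (ball (1::'a) (1/2))" by simp
    then obtain T where T: "open T" "T \<inter> Z = c y -` ball 1 (1/2) \<inter> Z"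
      using cont_c[of y] unfolding continuous_on_open_invariant by blast
    moreover have "c y y = 1"
      using b0 that by (simp add: c_def)
    ultimately have "y \<in> T" using that by auto
    moreover have "norm (c y z - 1) < 1/2" if "z \<in> T \<inter> Z" for z
      using T(2) that by (auto simp: dist_norm norm_minus_commute)
    ultimately show ?thesis using T(1) by blast
  qed
  then obtain T where T: "\<And>y. y \<in> Z \<Longrightarrow> open (T y)" "\<And>y. y \<in> Z \<Longrightarrow> y \<in> T y"
      "\<And>y z. y \<in> Z \<Longrightarrow> z \<in> T y \<inter> Z \<Longrightarrow> norm (c y z - 1) < 1/2"
    by metis
  have "Z \<subseteq> (\<Union>y\<in>Z. T y)"
    using T(2) by blast
  then obtain K where K: "K \<subseteq> Z" "finite K" "Z \<subseteq> (\<Union>y\<in>K. T y)"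
    using compactE_image[OF Z, of Z T] T(1) by blast
  \<comment> \<open>The bump functions are made from the errors \<open>c y z - 1\<close> themselves,
    so no separation property of the space is used.\<close>
  define g where "g y z = max 0 (1/2 - norm (c y z - 1))" for y z
  define s where "s z = (\<Sum>y\<in>K. g y z)" for z
  have g_nonneg: "g y z \<ge> 0" for y z
    by (simp add: g_def)
  have s_pos: "s z > 0" if "z \<in> Z" for z
  proof -
    have "z \<in> (\<Union>y\<in>K. T y)"
      using K(3) that by (rule subsetD)
    then obtain y where y: "y \<in> K" "z \<in> T y"
      by blast
    then have "norm (c y z - 1) < 1/2"
      using T(3)[of y z] K that by blast
    then show ?thesis
      unfolding s_def using y K(2) g_nonneg by (intro sum_pos2[of K y]) (auto simp: g_def)
  qed
  have cont_g: "continuous_on Z (g y)" for y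
    unfolding g_def
    by (intro continuous_on_max continuous_on_diff continuous_on_norm continuous_on_const cont_c)
  have cont_s: "continuous_on Z s"
    unfolding s_def by (intro continuous_on_sum cont_g)
  define b' where "b' z i = (\<Sum>y\<in>K. (g y z / s z) *\<^sub>R b0 y i)" for z i
  have cont_b': "continuous_on Z (\<lambda>z. b' z i)" for i
    unfolding b'_def using s_pos
    by (intro continuous_on_sum continuous_on_scaleR continuous_on_divide cont_g cont_s
        continuous_on_const) force
  define d where "d z = (\<Sum>i<n. b' z i * v z i)" for z
  have cont_d: "continuous_on Z d"
    unfolding d_def by (intro continuous_on_sum continuous_on_mult cont_b' v')
  have d1: "norm (d z - 1) < 1" if z: "z \<in> Z" for z
  proof -
    have "d z = (\<Sum>i<n. \<Sum>y\<in>K. (g y z / s z) *\<^sub>R (b0 y i * v z i))"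
      by (simp add: d_def b'_def sum_distrib_right)
    also have "\<dots> = (\<Sum>y\<in>K. (g y z / s z) *\<^sub>R c y z)"
      by (subst sum.swap) (simp add: c_def scaleR_sum_right)
    finally have d: "d z = (\<Sum>y\<in>K. (g y z / s z) *\<^sub>R c y z)" .
    have one: "(\<Sum>y\<in>K. g y z / s z) = 1"
      using s_pos[OF z] by (simp only: sum_divide_distrib[symmetric] s_def[symmetric]) simp
    have "d z - 1 = (\<Sum>y\<in>K. (g y z / s z) *\<^sub>R c y z) - (\<Sum>y\<in>K. g y z / s z) *\<^sub>R 1"
      by (simp only: one d scaleR_one)
    also have "\<dots> = (\<Sum>y\<in>K. (g y z / s z) *\<^sub>R (c y z - 1))"
      by (simp only: scaleR_sum_left scaleR_diff_right sum_subtractf)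
    also have "norm \<dots> \<le> (\<Sum>y\<in>K. (g y z / s z) * (1/2))"
    proof (rule order.trans[OF norm_sum sum_mono])
      fix y
      have "g y z * norm (c y z - 1) \<le> g y z * (1/2)"
      proof (cases "norm (c y z - 1) \<le> 1/2")
        case True
        then show ?thesis
          by (rule mult_left_mono[OF _ g_nonneg])
      qed (simp add: g_def)
      then have "g y z / s z * norm (c y z - 1) \<le> g y z / s z * (1/2)"
        using s_pos[OF z] by (simp add: field_simps)
      then show "norm ((g y z / s z) *\<^sub>R (c y z - 1)) \<le> g y z / s z * (1/2)"
        using s_pos[OF z] g_nonneg[of y z] by simp
    qed
    also have "\<dots> < 1"
      by (simp only: sum_distrib_right[symmetric] one)
    finally show ?thesis .
  qed
  \<comment> \<open>The scalar \<open>d z\<close> is read as a matrix of size 1, so that continuity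
    of its inverse is a case of \<open>continuous_on_minv\<close>.\<close>
  define D where "D z i j = (if i = 0 \<and> j = 0 then d z else 0)" for z :: 'z and i j :: nat
  have D_GL: "D z \<in> GL 1" if z: "z \<in> Z" for z
  proof -
    obtain y where y: "d z * y = 1" "y * d z = 1"
      using norm_less_one_invertible[OF d1[OF z]] by auto
    let ?Y = "\<lambda>i j :: nat. if i = 0 \<and> j = 0 then y else 0"
    have "mat_mult 1 (D z) ?Y = mat_id 1" "mat_mult 1 ?Y (D z) = mat_id 1"
      by (auto simp: mat_mult_def mat_id_def D_def y fun_eq_iff)
    moreover have "D z \<in> mats 1" "?Y \<in> mats 1"
      by (auto simp: mats_def D_def)
    ultimately show ?thesis unfolding GL_def by blast
  qed
  define y where "y z = minv 1 (D z) 0 0" for z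
  have "continuous_on Z D"
    unfolding D_def
  proof (intro continuous_on_coordinatewise_then_product)
    show "continuous_on Z (\<lambda>z. if i = 0 \<and> j = 0 then d z else 0)" for i j :: nat
      by (cases "i = 0 \<and> j = 0")
        (simp_all only: cont_d if_True if_False continuous_on_const simp_thms)
  qed
  then have cont_y: "continuous_on Z y"
    unfolding y_def by (rule continuous_on_entry[OF continuous_on_minv[OF _ D_GL]])
  have "y z * d z = 1" if "z \<in> Z" for z
    using fun_cong[OF fun_cong[OF minv(3)[OF D_GL[OF that]]], of 0 0]
    by (simp add: mat_mult_def mat_id_def D_def y_def)
  then have "(\<Sum>i<n. (y z * b' z i) * v z i) = 1" if "z \<in> Z" for z
    using that by (simp add: d_def sum_distrib_left mult.assoc)
  moreover have "continuous_on Z (\<lambda>z i. y z * b' z i)"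
    by (intro continuous_on_coordinatewise_then_product continuous_on_mult cont_y cont_b')
  ultimately show ?thesis by blast
qed

text \<open>Since b v = 1, the added term (w - v) b sends v to w - v; smallness of b (w - v) makes
  the matrix invertible.\<close>

lemma rank1_moves:
  assumes "v \<in> vecs n" "w \<in> vecs n" "(\<Sum>i<n. b i * v i) = 1" "norm (\<Sum>i<n. b i * (w i - v i)) < 1"
  shows "rank1 n (\<lambda>i. w i - v i) b \<in> GL n" "mat_vec n (rank1 n (\<lambda>i. w i - v i) b) v = w"
proof -
  show "rank1 n (\<lambda>i. w i - v i) b \<in> GL n"
    using norm_less_one_invertible[OF assms(4)] by (auto intro: rank1_GL)
  show "mat_vec n (rank1 n (\<lambda>i. w i - v i) b) v = w"
    using assms by (auto simp: mat_vec_rank1 vecs_def)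
qed

text \<open>Vectors at sufficiently close times are joined by one rank one matrix that depends
  continuously on the parameters. A fine enough subdivision of the unit interval, uniform in z,
  turns the lift into a finite product.\<close>

lemma lift_Lg_homotopy:
  fixes Z :: "'z::topological_space set" and \<gamma> :: "'z \<times> real \<Rightarrow> nat \<Rightarrow> 'a::unital_cstar_algebra"
  assumes Z: "compact Z" and \<gamma>: "continuous_on (Z \<times> {0..1}) \<gamma>"
    "\<And>z t. z \<in> Z \<Longrightarrow> 0 \<le> t \<Longrightarrow> t \<le> 1 \<Longrightarrow> \<gamma> (z, t) \<in> Lg n"
  obtains G where "continuous_on (Z \<times> {0..1}) G"
    "\<And>z t. z \<in> Z \<Longrightarrow> 0 \<le> t \<Longrightarrow> t \<le> 1 \<Longrightarrow> G (z, t) \<in> GL n"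
    "\<And>z. z \<in> Z \<Longrightarrow> G (z, 0) = mat_id n"
    "\<And>z t. z \<in> Z \<Longrightarrow> 0 \<le> t \<Longrightarrow> t \<le> 1 \<Longrightarrow> mat_vec n (G (z, t)) (\<gamma> (z, 0)) = \<gamma> (z, t)"
proof -
  let ?I = "{0..1::real}"
  have \<gamma>_Lg: "\<gamma> p \<in> Lg n" if "p \<in> Z \<times> ?I" for p
    using that \<gamma>(2) by auto
  obtain b where b: "continuous_on (Z \<times> ?I) b" "\<And>p. p \<in> Z \<times> ?I \<Longrightarrow> (\<Sum>i<n. b p i * \<gamma> p i) = 1"
    using continuous_left_inverse[OF compact_Times[OF Z compact_Icc] \<gamma>(1) \<gamma>_Lg] by blast
  \<comment> \<open>The quantity that has to stay below 1 for \<open>rank1_moves\<close> to carry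
    the vector at time t to the vector at time t'.\<close>
  define \<phi> where "\<phi> q = (case q of (z, t, t') \<Rightarrow>
      norm (\<Sum>i<n. b (z, t) i * (\<gamma> (z, t') i - \<gamma> (z, t) i)))" for q
  let ?P = "Z \<times> ?I \<times> ?I"
  have cont_fst: "continuous_on ?P (\<lambda>q. f (fst q, fst (snd q)) i)"
    and cont_snd: "continuous_on ?P (\<lambda>q. f (fst q, snd (snd q)) i)"
    if "continuous_on (Z \<times> ?I) f" for f :: "'z \<times> real \<Rightarrow> nat \<Rightarrow> 'a" and i
    by (rule continuous_on_product_then_coordinatewise, rule continuous_on_compose2[OF that];
        auto intro!: continuous_intros)+
  have "continuous_on ?P \<phi>"
    unfolding \<phi>_def case_prod_unfold
    by (intro continuous_on_norm continuous_on_sum continuous_on_mult continuous_on_diff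
        cont_fst cont_snd b(1) \<gamma>(1))
  then have "closedin (top_of_set ?P) (?P \<inter> \<phi> -` {1..})"
    by (intro continuous_closedin_preimage) auto
  then have C: "compact (?P \<inter> \<phi> -` {1..})"
    by (rule closedin_compact[OF compact_Times[OF Z compact_Times[OF compact_Icc compact_Icc]]])
  \<comment> \<open>\<open>Z\<close> carries only a topology, so compactness replaces uniform
    continuity: the set \<phi> \<ge> 1 is compact and misses the diagonal t = t', where \<phi> is 0;
    hence \<bar>t - t'\<bar> has a positive minimum on it.\<close>
  have "\<exists>\<delta>>0. \<forall>z t t'. (z, t, t') \<in> ?P \<longrightarrow> \<bar>t - t'\<bar> < \<delta> \<longrightarrow> \<phi> (z, t, t') < 1"
  proof (cases "?P \<inter> \<phi> -` {1..} = {}")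
    case True
    then have "\<phi> q < 1" if "q \<in> ?P" for q
      using that by (cases "1 \<le> \<phi> q") auto
    then show ?thesis
      by (intro exI[of _ 1]) simp
  next
    case False
    have "continuous_on (?P \<inter> \<phi> -` {1..}) (\<lambda>q. \<bar>fst (snd q) - snd (snd q)\<bar>)"
      by (intro continuous_intros)
    from continuous_attains_inf[OF C False this]
    obtain q0 where q0: "q0 \<in> ?P \<inter> \<phi> -` {1..}" and min: "\<And>q. q \<in> ?P \<inter> \<phi> -` {1..} \<Longrightarrow>
        \<bar>fst (snd q0) - snd (snd q0)\<bar> \<le> \<bar>fst (snd q) - snd (snd q)\<bar>"
      by blast
    obtain z t t' where q0_eq: "q0 = (z, t, t')"
      by (cases q0)
    have "t \<noteq> t'"
      using q0 by (auto simp: q0_eq \<phi>_def)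
    moreover have "\<phi> (y, u, u') < 1" if "(y, u, u') \<in> ?P" "\<bar>u - u'\<bar> < \<bar>t - t'\<bar>" for y u u'
      using that min[of "(y, u, u')"] by (cases "1 \<le> \<phi> (y, u, u')") (simp_all add: q0_eq)
    ultimately show ?thesis
      by (intro exI[of _ "\<bar>t - t'\<bar>"]) auto
  qed
  then obtain \<delta> where \<delta>: "\<delta> > 0"
      "\<And>z t t'. (z, t, t') \<in> ?P \<Longrightarrow> \<bar>t - t'\<bar> < \<delta> \<Longrightarrow> \<phi> (z, t, t') < 1"
    by blast
  obtain N where N: "N > 0" "inverse (real N) < \<delta>"
    using ex_inverse_of_nat_less[OF \<delta>(1)] by auto
  define R where "R z t t' = rank1 n (\<lambda>i. \<gamma> (z, t') i - \<gamma> (z, t) i) (b (z, t))" for z t t'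
  have R: "R z t t' \<in> GL n" "mat_vec n (R z t t') (\<gamma> (z, t)) = \<gamma> (z, t')"
    if "z \<in> Z" "t \<in> ?I" "t' \<in> ?I" "\<bar>t - t'\<bar> < \<delta>" for z t t'
    unfolding R_def using that \<delta>(2)[of z t t']
    by (auto intro!: rank1_moves Lg_vecs \<gamma>_Lg b(2) simp: \<phi>_def)
  \<comment> \<open>Stage \<open>k\<close> lifts the homotopy frozen at time k/N. Freezing by
    \<open>min\<close> makes every factor continuous on the whole interval, so no pieces have to be
    pasted.\<close>
  have "\<exists>G. continuous_on (Z \<times> ?I) G \<and> (\<forall>z\<in>Z. \<forall>t\<in>?I. G (z, t) \<in> GL n \<and>
      mat_vec n (G (z, t)) (\<gamma> (z, 0)) = \<gamma> (z, min t (real k / N))) \<and> (\<forall>z\<in>Z. G (z, 0) = mat_id n)" for k :: nat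
  proof (induction k)
    case 0
    then show ?case
      by (intro exI[of _ "\<lambda>_. mat_id n"]) (auto simp: min_def mat_vec_id[OF Lg_vecs[OF \<gamma>_Lg]])
  next
    case (Suc k)
    then obtain G where G: "continuous_on (Z \<times> ?I) G" "\<And>z t. z \<in> Z \<Longrightarrow> t \<in> ?I \<Longrightarrow> G (z, t) \<in> GL n"
      "\<And>z t. z \<in> Z \<Longrightarrow> t \<in> ?I \<Longrightarrow> mat_vec n (G (z, t)) (\<gamma> (z, 0)) = \<gamma> (z, min t (k / N))"
      "\<And>z. z \<in> Z \<Longrightarrow> G (z, 0) = mat_id n"
      by blast
    let ?S = "\<lambda>p. R (fst p) (min (snd p) (k / N)) (min (snd p) (Suc k / N))"
    have step: "\<bar>min t (k / N) - min t (Suc k / N)\<bar> < \<delta>" for t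
    proof -
      have "real (Suc k) / N = k / N + inverse N"
        by (simp add: add_divide_distrib inverse_eq_divide)
      moreover have "inverse (real N) > 0"
        using N by simp
      ultimately show ?thesis
        using N(2) by (simp only: min_def abs_if split: if_splits) linarith
    qed
    have mins: "min t (real j / N) \<in> ?I" if "t \<in> ?I" for t j
      using that by auto
    have comp: "continuous_on (Z \<times> ?I) (\<lambda>p. f (fst p, min (snd p) (real j / N)) i)"
      if "continuous_on (Z \<times> ?I) f" for f :: "'z \<times> real \<Rightarrow> nat \<Rightarrow> 'a" and i j
      by (rule continuous_on_product_then_coordinatewise, rule continuous_on_compose2[OF that])
        (auto intro!: continuous_intros)
    have "continuous_on (Z \<times> ?I) (\<lambda>p. ?S p i j)" for i j
      unfolding R_def rank1_def
      by (cases "i < n \<and> j < n")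
        (auto intro!: continuous_on_add continuous_on_mult continuous_on_diff comp b(1) \<gamma>(1)
          simp del: of_nat_Suc)
    then have cont_S: "continuous_on (Z \<times> ?I) ?S"
      by (intro continuous_on_coordinatewise_then_product)
    let ?G = "\<lambda>p. mat_mult n (?S p) (G p)"
    have "continuous_on (Z \<times> ?I) ?G"
      by (intro continuous_on_mat_mult cont_S G)
    moreover have "?G (z, t) \<in> GL n \<and> mat_vec n (?G (z, t)) (\<gamma> (z, 0)) = \<gamma> (z, min t (Suc k / N))"
      if "z \<in> Z" "t \<in> ?I" for z t
      using R[OF that(1) mins[OF that(2)] mins[OF that(2)] step] G(2,3)[OF that]
      by (simp add: mat_vec_mult del: of_nat_Suc)
    moreover have "?G (z, 0) = mat_id n" if "z \<in> Z" for z
    proof -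
      have "?S (z, 0) = mat_id n"
        by (auto simp: R_def rank1_def mat_id_def min_def fun_eq_iff simp del: of_nat_Suc)
      then show ?thesis using G(4)[OF that] by simp
    qed
    ultimately show ?case by blast
  qed
  from this[of N] obtain G where G: "continuous_on (Z \<times> ?I) G"
      "\<And>z t. z \<in> Z \<Longrightarrow> t \<in> ?I \<Longrightarrow> G (z, t) \<in> GL n"
      "\<And>z t. z \<in> Z \<Longrightarrow> t \<in> ?I \<Longrightarrow> mat_vec n (G (z, t)) (\<gamma> (z, 0)) = \<gamma> (z, min t (N / N))"
      "\<And>z. z \<in> Z \<Longrightarrow> G (z, 0) = mat_id n"
    by blast
  show thesis
    by (rule that[of G]) (use G N in \<open>auto simp: min_def\<close>)
qed

section \<open>Cubes\<close>

text \<open>Coordinates outside \<sigma> are 0 rather than undefined, so that the face of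
  \<open>fcube \<sigma>\<close> where coordinate i vanishes is literally
  \<open>fcube (\<sigma> - {i})\<close>. Cubes indexed by different sets thus sit in one space and
  can be glued.\<close>

definition fcube :: "nat set \<Rightarrow> (nat \<Rightarrow> real) set" where
  "fcube \<sigma> = {q. (\<forall>i\<in>\<sigma>. 0 \<le> q i \<and> q i \<le> 1) \<and> (\<forall>i. i \<notin> \<sigma> \<longrightarrow> q i = 0)}"

definition fboundary :: "nat set \<Rightarrow> (nat \<Rightarrow> real) set" where
  "fboundary \<sigma> = {q \<in> fcube \<sigma>. \<exists>i\<in>\<sigma>. q i = 0 \<or> q i = 1}"

text \<open>The boundary of the (n+1)-cube without the interior of its top face
  \<open>q n = 1\<close>.\<close>

definition horn :: "nat \<Rightarrow> (nat \<Rightarrow> real) set" where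
  "horn n = {q \<in> fcube {..<Suc n}. q n = 0 \<or> (\<exists>i<n. q i = 0 \<or> q i = 1)}"

lemma compact_fcube: "compact (fcube \<sigma>)"
proof -
  have "fcube \<sigma> = PiE UNIV (\<lambda>i. if i \<in> \<sigma> then {0..1} else {0})"
    by (fastforce simp: fcube_def PiE_iff split: if_splits)
  moreover have "compactin (product_topology (\<lambda>i. euclidean) UNIV)
      (PiE UNIV (\<lambda>i. if i \<in> \<sigma> then {0..1::real} else {0}))"
    by (simp add: compactin_PiE)
  ultimately show ?thesis
    by (simp add: euclidean_product_topology)
qed

lemma closed_fcube: "closed (fcube \<sigma>)"
  by (intro compact_imp_closed compact_fcube)

lemma fboundary_subset: "fboundary \<sigma> \<subseteq> fcube \<sigma>"
  by (auto simp: fboundary_def)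

lemma horn_subset: "horn n \<subseteq> fboundary {..<Suc n}"
  by (auto simp: fboundary_def horn_def less_Suc_eq)

lemma fcube_upd: "q \<in> fcube {..<n} \<Longrightarrow> 0 \<le> t \<Longrightarrow> t \<le> 1 \<Longrightarrow> q(n := t) \<in> fcube {..<Suc n}"
  by (auto simp: fcube_def less_Suc_eq)

lemma fcube_upd_inv: "q \<in> fcube {..<Suc n} \<Longrightarrow> q(n := 0) \<in> fcube {..<n}"
  by (auto simp: fcube_def less_Suc_eq)

lemma fboundary_Suc_cases:
  assumes "q \<in> fboundary {..<Suc n}"
  shows "q \<in> horn n \<or> q = (q(n := 0))(n := 1)"
proof (cases "q n = 1")
  case True
  then have "q = q(n := 1)"
    by (simp add: fun_upd_idem)
  then show ?thesis by simp
next
  case False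
  then show ?thesis
    using assms by (auto simp: fboundary_def horn_def less_Suc_eq)
qed

lemma continuous_on_coordinate: "continuous_on S (\<lambda>q. q i :: 'b::topological_space)"
  by (rule continuous_on_subset[OF continuous_on_product_coordinates]) simp

lemma continuous_on_upd:
  fixes f :: "'z::topological_space \<Rightarrow> nat \<Rightarrow> 'b::topological_space"
  assumes "continuous_on S f" "continuous_on S t"
  shows "continuous_on S (\<lambda>z. (f z)(n := t z))"
proof (rule continuous_on_coordinatewise_then_product)
  show "continuous_on S (\<lambda>z. ((f z)(n := t z)) i)" for i
    using assms(2) continuous_on_product_then_coordinatewise[OF assms(1), of i]
    by (cases "i = n") simp_all
qed

text \<open>
  Radial projection of the cube onto its horn from the point \<open>(1/2, \<dots>, 1/2, 2)\<close>: the ray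
  through \<open>q\<close> leaves the cube at the parameter \<open>1 / D\<close>.
\<close>

primrec center_dist :: "nat \<Rightarrow> (nat \<Rightarrow> real) \<Rightarrow> real" where
  "center_dist 0 q = 0"
| "center_dist (Suc n) q = max (center_dist n q) \<bar>2 * q n - 1\<bar>"

lemma center_dist_ge: "i < n \<Longrightarrow> \<bar>2 * q i - 1\<bar> \<le> center_dist n q"
  by (induction n) (auto simp: less_Suc_eq)

lemma center_dist_attained: "center_dist n q = 0 \<or> (\<exists>i<n. center_dist n q = \<bar>2 * q i - 1\<bar>)"
  by (induction n) (auto simp: less_Suc_eq max_def)

lemma center_dist_le: "(\<And>i. i < n \<Longrightarrow> 0 \<le> q i \<and> q i \<le> 1) \<Longrightarrow> center_dist n q \<le> 1"
  by (induction n) (auto simp: less_Suc_eq abs_if)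

lemma continuous_on_center_dist: "continuous_on S (center_dist n)"
  by (induction n)
    (auto intro!: continuous_on_max continuous_on_rabs continuous_on_diff continuous_on_mult
      continuous_on_const continuous_on_coordinate)

lemma horn_retraction:
  obtains r where "continuous_on (fcube {..<Suc n}) r" "\<And>q. q \<in> fcube {..<Suc n} \<Longrightarrow> r q \<in> horn n"
    "\<And>q. q \<in> horn n \<Longrightarrow> r q = q"
proof
  \<comment> \<open>Each term of the maximum is the value of D at which the ray meets the hyperplane
    of a face: 2 + (q n - 2) / D = 0 for the bottom, (2 * q i - 1) / D = 1 or -1 for the sides. The
    largest D is the one met first. The centre at height 2 lies above the cube, so D is at least
    1/2.\<close>
  define D where "D q = max (1 - q n / 2) (center_dist n q)" for q
  define r where "r q i = (if i < n then ((2 * q i - 1) / D q + 1) / 2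
      else if i = n then 2 + (q n - 2) / D q else 0)" for q i
  let ?C = "fcube {..<Suc n}"
  have coord: "0 \<le> q i \<and> q i \<le> 1" if "q \<in> ?C" "i \<le> n" for q i
    using that by (auto simp: fcube_def)
  have D_pos: "D q > 0" if "q \<in> ?C" for q
    using coord[OF that, of n] by (auto simp: D_def less_max_iff_disj)
  have cont_D: "continuous_on ?C D"
    unfolding D_def
    by (intro continuous_on_max continuous_on_diff continuous_on_divide continuous_on_const
        continuous_on_coordinate continuous_on_center_dist) auto
  show "continuous_on ?C r"
  proof (rule continuous_on_coordinatewise_then_product)
    fix i
    have "D q \<noteq> 0" if "q \<in> ?C" for q
      using D_pos[OF that] by simp
    then show "continuous_on ?C (\<lambda>q. r q i)"
      unfolding r_def
      by (cases "i < n"; cases "i = n")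
        (auto intro!: continuous_on_add continuous_on_diff continuous_on_divide continuous_on_mult
          continuous_on_const continuous_on_coordinate cont_D)
  qed
  show "r q \<in> horn n" if q: "q \<in> ?C" for q
  proof -
    note D = D_pos[OF q]
    have le: "\<bar>(2 * q i - 1) / D q\<bar> \<le> 1" if "i < n" for i
    proof -
      have "\<bar>2 * q i - 1\<bar> \<le> D q"
        using center_dist_ge[OF that, of q] by (simp add: D_def)
      then show ?thesis using D by (simp add: abs_divide)
    qed
    have r_lt: "0 \<le> r q i \<and> r q i \<le> 1" if "i < n" for i
      using le[OF that] that unfolding abs_le_iff by (simp add: r_def)
    have "D q \<ge> 1 - q n / 2"
      by (simp add: D_def)
    then have "(2 - q n) / D q \<le> 2"
      using D by (simp add: divide_le_eq)
    then have r_n0: "0 \<le> r q n"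
      by (simp add: r_def diff_divide_distrib)
    have "D q \<le> 1"
      using center_dist_le[of n q] coord[OF q] by (auto simp: D_def)
    then have "1 \<le> (2 - q n) / D q"
      using D coord[OF q, of n] by (simp add: le_divide_eq)
    then have r_n1: "r q n \<le> 1"
      by (simp add: r_def diff_divide_distrib)
    have C: "r q \<in> ?C"
      using r_lt r_n0 r_n1 by (auto simp: fcube_def less_Suc_eq) (auto simp: r_def)
    show ?thesis
    proof (cases "D q = 1 - q n / 2")
      case True
      then have "(q n - 2) / D q = -2"
        using D by (simp add: divide_eq_eq)
      then have "r q n = 0"
        by (simp add: r_def)
      then show ?thesis using C by (simp add: horn_def)
    next
      case False
      then have "D q = center_dist n q"
        by (metis D_def max_def)
      then obtain i where i: "i < n" "D q = \<bar>2 * q i - 1\<bar>"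
        using center_dist_attained[of n q] D by auto
      then have "(2 * q i - 1) / D q = 1 \<or> (2 * q i - 1) / D q = - 1"
        using D by (auto simp: abs_if divide_eq_eq split: if_splits)
      then have "r q i = 0 \<or> r q i = 1"
        using i(1) by (auto simp: r_def)
      then show ?thesis using C i(1) by (auto simp: horn_def)
    qed
  qed
  show "r q = q" if q: "q \<in> horn n" for q
  proof -
    have C: "q \<in> ?C"
      using q by (simp add: horn_def)
    have le: "center_dist n q \<le> 1" "1 - q n / 2 \<le> 1"
      using center_dist_le[of n q] coord[OF C] coord[OF C, of n] by auto
    have "center_dist n q = 1 \<or> 1 - q n / 2 = 1"
    proof (cases "q n = 0")
      case False
      then obtain i where "i < n" "q i = 0 \<or> q i = 1"
        using q by (auto simp: horn_def)
      then show ?thesis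
        using center_dist_ge[of i n q] le(1) by auto
    qed simp
    then have "D q = 1"
      using le by (auto simp: D_def)
    then show ?thesis
      using C by (auto simp: r_def fcube_def fun_eq_iff)
  qed
qed

section \<open>Consequences of weak homotopy equivalence\<close>

text \<open>Points of \<open>cube n\<close> are undefined outside \<open>{..<n}\<close>, points of
  \<open>fcube\<close> are 0 there; \<open>pad n\<close> and \<open>restrict\<close> translate
  between the two conventions.\<close>

definition pad :: "nat \<Rightarrow> (nat \<Rightarrow> real) \<Rightarrow> nat \<Rightarrow> real" where
  "pad n s = (\<lambda>i. if i < n then s i else 0)"

lemma topspace_cube: "topspace (cube n) = PiE {..<n} (\<lambda>_. {0..1})"
  by (simp add: cube_def)

lemma pad_fcube: "s \<in> topspace (cube n) \<Longrightarrow> pad n s \<in> fcube {..<n}"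
  by (auto simp: topspace_cube pad_def fcube_def PiE_iff)

lemma continuous_map_pad: "continuous_map (cube n) (top_of_set (fcube {..<n})) (pad n)"
proof -
  have "continuous_map (cube n) euclideanreal (\<lambda>s. pad n s i)" for i
  proof (cases "i < n")
    case True
    then have "continuous_map (cube n) (top_of_set {0..1}) (\<lambda>s. s i)"
      unfolding cube_def by (intro continuous_map_product_projection) auto
    then show ?thesis
      using True by (simp add: pad_def continuous_map_in_subtopology)
  qed (simp add: pad_def)
  then have "continuous_map (cube n) (product_topology (\<lambda>_. euclideanreal) UNIV) (pad n)"
    by (subst continuous_map_componentwise) auto
  then show ?thesis
    by (auto simp: euclidean_product_topology continuous_map_in_subtopology pad_fcube)
qed

lemma restrict_cube:
  assumes "q \<in> fcube {..<m}" "n \<le> m"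
  shows "restrict q {..<n} \<in> topspace (cube n)"
  using assms by (auto simp: topspace_cube fcube_def)

lemma continuous_map_restrict_cube:
  assumes "n \<le> m"
  shows "continuous_map (top_of_set (fcube {..<m})) (cube n) (\<lambda>q. restrict q {..<n})"
proof -
  have "continuous_map (top_of_set (fcube {..<m})) (top_of_set {0..1}) (\<lambda>q. restrict q {..<n} i)"
    if "i < n" for i
  proof -
    have "continuous_on (fcube {..<m}) (\<lambda>q. q i)"
      by (rule continuous_on_coordinate)
    then show ?thesis
      using that assms by (auto simp: fcube_def)
  qed
  then show ?thesis
    unfolding cube_def by (subst continuous_map_componentwise) auto
qed

lemma pad_restrict: "q \<in> fcube {..<n} \<Longrightarrow> pad n (restrict q {..<n}) = q"
  by (auto simp: pad_def fcube_def)

lemma pad_boundary: "s \<in> cube_boundary n \<Longrightarrow> pad n s \<in> fboundary {..<n}"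
  using pad_fcube[of s n] by (auto simp: cube_boundary_def fboundary_def pad_def)

lemma restrict_boundary:
  assumes "q \<in> fcube {..<m}" "n \<le> m" "i < n" "q i = 0 \<or> q i = 1"
  shows "restrict q {..<n} \<in> cube_boundary n"
  using restrict_cube[OF assms(1,2)] assms(3,4) by (auto simp: cube_boundary_def)

lemma based_maps_pad:
  assumes "continuous_on (fcube {..<n}) u" "\<And>q. q \<in> fcube {..<n} \<Longrightarrow> u q \<in> Y"
    "\<And>q. q \<in> fboundary {..<n} \<Longrightarrow> u q = y"
  shows "u \<circ> pad n \<in> based_maps n (top_of_set Y) y"
proof -
  have "continuous_map (cube n) (top_of_set Y) (u \<circ> pad n)"
    by (rule continuous_map_compose[OF continuous_map_pad]) (use assms in auto)
  then show ?thesis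
    using assms(3)[OF pad_boundary] by (auto simp: based_maps_def)
qed

section \<open>Based homotopy classes and induced maps\<close>

lemma based_homotopy_refl: "u \<in> based_maps n Y y \<Longrightarrow> (u, u) \<in> based_homotopy n Y y"
  by (auto simp: based_maps_def based_homotopy_def)

lemma based_homotopy_sym: "(u, v) \<in> based_homotopy n Y y \<Longrightarrow> (v, u) \<in> based_homotopy n Y y"
  by (auto simp: based_homotopy_def intro: homotopic_with_symD)

lemma based_homotopy_trans:
  "(u, v) \<in> based_homotopy n Y y \<Longrightarrow> (v, w) \<in> based_homotopy n Y y \<Longrightarrow> (u, w) \<in> based_homotopy n Y y"
  by (auto simp: based_homotopy_def intro: homotopic_with_trans)

lemma based_homotopy_compose:
  assumes "(u, v) \<in> based_homotopy n X x" "continuous_map X Y f"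
  shows "(f \<circ> u, f \<circ> v) \<in> based_homotopy n Y (f x)"
  using assms unfolding based_homotopy_def
  by (auto intro!: homotopic_with_compose_continuous_map_left[of _ _ X])

lemma based_homotopy_class_eq_iff:
  assumes "v \<in> based_maps n Y y"
  shows "based_homotopy n Y y `` {u} = based_homotopy n Y y `` {v} \<longleftrightarrow> (u, v) \<in> based_homotopy n Y y"
  using based_homotopy_refl[OF assms] based_homotopy_sym[of _ _ n Y y]
    based_homotopy_trans[of _ _ n Y y]
  by blast

lemma induced_map_class:
  assumes "u \<in> based_maps n X x" "continuous_map X Y f"
  shows "induced_map n Y f x (based_homotopy n X x `` {u}) = based_homotopy n Y (f x) `` {f \<circ> u}"
proof (intro equalityI subsetI)
  fix w assume "w \<in> induced_map n Y f x (based_homotopy n X x `` {u})"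
  then obtain v where "(u, v) \<in> based_homotopy n X x" "(f \<circ> v, w) \<in> based_homotopy n Y (f x)"
    by (auto simp: induced_map_def)
  then show "w \<in> based_homotopy n Y (f x) `` {f \<circ> u}"
    using based_homotopy_trans[OF based_homotopy_compose[OF _ assms(2)]] by blast
next
  fix w assume "w \<in> based_homotopy n Y (f x) `` {f \<circ> u}"
  then show "w \<in> induced_map n Y f x (based_homotopy n X x `` {u})"
    using based_homotopy_refl[OF assms(1)] by (auto simp: induced_map_def)
qed

lemma weq_injective:
  assumes "weak_homotopy_equivalence X Y f" "n \<ge> 1" "x \<in> topspace X"
    and uv: "u \<in> based_maps n X x" "v \<in> based_maps n X x"
    and hom: "(f \<circ> u, f \<circ> v) \<in> based_homotopy n Y (f x)"
  shows "(u, v) \<in> based_homotopy n X x"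
proof -
  let ?cl = "\<lambda>u. based_homotopy n X x `` {u}"
  have f: "continuous_map X Y f"
    and "inj_on (induced_map n Y f x) (homotopy_classes n X x)"
    using assms by (auto simp: weak_homotopy_equivalence_def bij_betw_def)
  moreover have "f \<circ> v \<in> based_maps n Y (f x)"
    using uv(2) continuous_map_compose[OF _ f] by (auto simp: based_maps_def)
  then have "induced_map n Y f x (?cl u) = induced_map n Y f x (?cl v)"
    unfolding induced_map_class[OF uv(1) f] induced_map_class[OF uv(2) f]
    using hom by (simp add: based_homotopy_class_eq_iff)
  moreover have "?cl u \<in> homotopy_classes n X x" "?cl v \<in> homotopy_classes n X x"
    using uv by (auto simp: homotopy_classes_def intro: quotientI)
  ultimately have "?cl u = ?cl v"
    by (simp add: inj_on_eq_iff)
  then show ?thesis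
    using based_homotopy_class_eq_iff[OF uv(2)] by blast
qed

lemma weq_surjective:
  assumes "weak_homotopy_equivalence X Y f" "n \<ge> 1" "x \<in> topspace X"
    and w: "w \<in> based_maps n Y (f x)"
  obtains u where "u \<in> based_maps n X x" "(f \<circ> u, w) \<in> based_homotopy n Y (f x)"
proof -
  have f: "continuous_map X Y f"
    and surj: "induced_map n Y f x ` homotopy_classes n X x = homotopy_classes n Y (f x)"
    using assms by (auto simp: weak_homotopy_equivalence_def bij_betw_def)
  have "based_homotopy n Y (f x) `` {w} \<in> homotopy_classes n Y (f x)"
    using w by (auto simp: homotopy_classes_def intro: quotientI)
  then obtain c where "c \<in> homotopy_classes n X x"
    "based_homotopy n Y (f x) `` {w} = induced_map n Y f x c"
    using surj by blast
  then obtain u where u: "u \<in> based_maps n X x"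
    "based_homotopy n Y (f x) `` {w} = induced_map n Y f x (based_homotopy n X x `` {u})"
    by (auto simp: homotopy_classes_def elim: quotientE)
  then have "(f \<circ> u, w) \<in> based_homotopy n Y (f x)"
    using based_homotopy_class_eq_iff[OF w] induced_map_class[OF u(1) f] by metis
  then show ?thesis using that u by blast
qed

lemma fcube_0: "fcube {} = {\<lambda>_. 0}"
  by (auto simp: fcube_def)

text \<open>The homotopy parameter becomes the last coordinate \<open>n\<close>, so that homotopies
  of n-cubes are maps of (n+1)-cubes.\<close>

lemma continuous_on_homotopy:
  assumes "continuous_map (prod_topology (top_of_set {0..1::real}) (cube n)) (top_of_set Y) k"
  shows "continuous_on (fcube {..<Suc n}) (\<lambda>q. k (q n, restrict q {..<n}))"
    and "q \<in> fcube {..<Suc n} \<Longrightarrow> k (q n, restrict q {..<n}) \<in> Y"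
proof -
  have "continuous_map (top_of_set (fcube {..<Suc n})) (prod_topology (top_of_set {0..1::real}) (cube n))
      (\<lambda>q. (q n, restrict q {..<n}))"
    unfolding continuous_map_pairwise o_def
    using continuous_map_restrict_cube[of n "Suc n"]
      continuous_on_coordinate[of "fcube {..<Suc n}" n]
    by (auto simp: fcube_def)
  from continuous_map_compose[OF this assms]
  show "continuous_on (fcube {..<Suc n}) (\<lambda>q. k (q n, restrict q {..<n}))"
    "q \<in> fcube {..<Suc n} \<Longrightarrow> k (q n, restrict q {..<n}) \<in> Y"
    by (auto simp: o_def)
qed

lemma restrict_upd: "restrict (q(n := t)) {..<n} = restrict q {..<n}" for n :: nat
  by (simp add: restrict_def fun_eq_iff)

text \<open>Surjectivity on homotopy sets in cubical form: \<open>u\<close> is deformed, relative to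
  the boundary, into the image of \<open>f\<close>. For n = 0 the cube is a point without boundary
  and the clause on path components takes over.\<close>

lemma weq_compress:
  fixes X :: "'a::topological_space set" and Y :: "'b::topological_space set"
  assumes weq: "weak_homotopy_equivalence (top_of_set X) (top_of_set Y) f" and x: "x \<in> X"
    and u: "continuous_on (fcube {..<n}) u" "\<And>q. q \<in> fcube {..<n} \<Longrightarrow> u q \<in> Y"
      "\<And>q. q \<in> fboundary {..<n} \<Longrightarrow> u q = f x"
  obtains h where "continuous_on (fcube {..<Suc n}) h" "\<And>q. q \<in> fcube {..<Suc n} \<Longrightarrow> h q \<in> Y"
    "\<And>q i. q \<in> fcube {..<Suc n} \<Longrightarrow> i < n \<Longrightarrow> q i = 0 \<or> q i = 1 \<Longrightarrow> h q = f x"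
    "\<And>q. q \<in> fcube {..<n} \<Longrightarrow> h (q(n := 1)) = u q"
    "\<And>q. q \<in> fcube {..<n} \<Longrightarrow> h (q(n := 0)) \<in> f ` X"
proof (cases "n = 0")
  case True
  have "u (\<lambda>_. 0) \<in> Y"
    using u(2) True by (simp add: fcube_0)
  then obtain x' where x': "x' \<in> X" "path_component_of (top_of_set Y) (f x') (u (\<lambda>_. 0))"
    using weq by (auto simp: weak_homotopy_equivalence_def)
  then obtain g :: "real \<Rightarrow> 'b" where g: "continuous_on {0..1} g" "g \<in> {0..1} \<rightarrow> Y" "g 0 = f x'" "g 1 = u (\<lambda>_. 0)"
    by (auto simp: path_component_of_def pathin_def)
  have I: "q 0 \<in> {0..1}" if "q \<in> fcube {..<Suc 0}" for q
    using that by (auto simp: fcube_def)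
  show ?thesis
  proof (rule that[of "\<lambda>q. g (q 0)"])
    show "continuous_on (fcube {..<Suc n}) (\<lambda>q. g (q 0))"
      by (rule continuous_on_compose2[OF g(1) continuous_on_coordinate]) (use I True in auto)
  qed (use g I x' True fcube_0 in auto)
next
  case False
  have "u \<circ> pad n \<in> based_maps n (top_of_set Y) (f x)"
    by (rule based_maps_pad) (use u in auto)
  then obtain v where v: "v \<in> based_maps n (top_of_set X) x"
    "(f \<circ> v, u \<circ> pad n) \<in> based_homotopy n (top_of_set Y) (f x)"
    using weq_surjective[OF weq] x False by (metis One_nat_def Suc_leI neq0_conv topspace_euclidean_subtopology)
  then obtain k where k: "continuous_map (prod_topology (top_of_set {0..1::real}) (cube n)) (top_of_set Y) k"
    "\<And>s. k (0, s) = f (v s)" "\<And>s. k (1, s) = u (pad n s)"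
    "\<And>t s. t \<in> {0..1::real} \<Longrightarrow> s \<in> cube_boundary n \<Longrightarrow> k (t, s) = f x"
    by (auto simp: based_homotopy_def homotopic_with_def)
  show ?thesis
  proof (rule that[of "\<lambda>q. k (q n, restrict q {..<n})"])
    show "k (q n, restrict q {..<n}) = f x"
      if "q \<in> fcube {..<Suc n}" "i < n" "q i = 0 \<or> q i = 1" for q i
      using that restrict_boundary[of q "Suc n" n i] by (intro k(4)) (auto simp: fcube_def)
    show "k ((q(n := 1)) n, restrict (q(n := 1)) {..<n}) = u q" if "q \<in> fcube {..<n}" for q
      using that by (simp add: restrict_upd k pad_restrict)
    show "k ((q(n := 0)) n, restrict (q(n := 0)) {..<n}) \<in> f ` X" if "q \<in> fcube {..<n}" for q
    proof -
      have "v (restrict q {..<n}) \<in> X"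
        using v(1) restrict_cube[OF that order_refl]
        by (auto simp: based_maps_def continuous_map_in_subtopology)
      then show ?thesis
        by (simp add: restrict_upd k)
    qed
  qed (use continuous_on_homotopy[OF k(1)] in auto)
qed

text \<open>Injectivity on homotopy sets in cubical form. By its values on the boundary,
  \<open>h\<close> is a based homotopy in \<open>Y\<close> from the constant map to f composed with
  \<open>u\<close>; injectivity yields such a homotopy from the constant map to \<open>u\<close> in
  \<open>X\<close>. For n = 0 the homotopies are paths.\<close>

lemma weq_contract:
  fixes X :: "'a::topological_space set" and Y :: "'b::topological_space set"
  assumes weq: "weak_homotopy_equivalence (top_of_set X) (top_of_set Y) f" and x: "x \<in> X"
    and u: "continuous_on (fcube {..<n}) u" "\<And>q. q \<in> fcube {..<n} \<Longrightarrow> u q \<in> X"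
      "\<And>q. q \<in> fboundary {..<n} \<Longrightarrow> u q = x"
    and h: "continuous_on (fcube {..<Suc n}) h" "\<And>q. q \<in> fcube {..<Suc n} \<Longrightarrow> h q \<in> Y"
      "\<And>q. q \<in> horn n \<Longrightarrow> h q = f x" "\<And>q. q \<in> fcube {..<n} \<Longrightarrow> h (q(n := 1)) = f (u q)"
  obtains h' where "continuous_on (fcube {..<Suc n}) h'" "\<And>q. q \<in> fcube {..<Suc n} \<Longrightarrow> h' q \<in> X"
    "\<And>q. q \<in> horn n \<Longrightarrow> h' q = x" "\<And>q. q \<in> fcube {..<n} \<Longrightarrow> h' (q(n := 1)) = u q"
proof (cases "n = 0")
  case True
  let ?g = "\<lambda>t i. if i = (0::nat) then t else 0 :: real"
  have "continuous_on {0..1} ?g"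
  proof (rule continuous_on_coordinatewise_then_product)
    show "continuous_on {0..1} (\<lambda>t. ?g t i)" for i
      by (cases "i = 0") auto
  qed
  moreover have g: "?g t \<in> fcube {..<Suc 0}" if "t \<in> {0..1}" for t
    using that by (auto simp: fcube_def)
  ultimately have "continuous_on {0..1} (\<lambda>t. h (?g t))"
    using h(1) True by (intro continuous_on_compose2[OF h(1)]) auto
  moreover have "h (?g 0) = f x"
    using g[of 0] True by (intro h(3)) (auto simp: horn_def)
  moreover have "?g 1 = (\<lambda>_. 0)(0 := 1)"
    by auto
  then have "h (?g 1) = f (u (\<lambda>_. 0))"
    using h(4)[of "\<lambda>_. 0"] True by (simp add: fcube_0)
  moreover have "h (?g t) \<in> Y" if "t \<in> {0..1}" for t
    using h(2) g[OF that] True by auto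
  ultimately have "path_component_of (top_of_set Y) (f x) (f (u (\<lambda>_. 0)))"
    unfolding path_component_of_def pathin_def by (intro exI[of _ "\<lambda>t. h (?g t)"]) auto
  moreover have "u (\<lambda>_. 0) \<in> X"
    using u(2) True by (simp add: fcube_0)
  ultimately have "path_component_of (top_of_set X) x (u (\<lambda>_. 0))"
    using weq x by (simp add: weak_homotopy_equivalence_def)
  then obtain g :: "real \<Rightarrow> 'a" where g: "continuous_on {0..1} g" "g \<in> {0..1} \<rightarrow> X" "g 0 = x" "g 1 = u (\<lambda>_. 0)"
    by (auto simp: path_component_of_def pathin_def)
  have I: "q 0 \<in> {0..1}" if "q \<in> fcube {..<Suc 0}" for q
    using that by (auto simp: fcube_def)
  show ?thesis
  proof (rule that[of "\<lambda>q. g (q 0)"])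
    show "continuous_on (fcube {..<Suc n}) (\<lambda>q. g (q 0))"
      by (rule continuous_on_compose2[OF g(1) continuous_on_coordinate]) (use I True in auto)
  qed (use g I True fcube_0 in \<open>auto simp: horn_def\<close>)
next
  case False
  let ?v = "\<lambda>_. x"
  have bm: "?v \<in> based_maps n (top_of_set X) x" "u \<circ> pad n \<in> based_maps n (top_of_set X) x"
    using x based_maps_pad[of n u X x] u by (auto simp: based_maps_def)
  let ?k = "\<lambda>(t, s). h ((pad n s)(n := t))"
  have upd: "(pad n s)(n := t) \<in> fcube {..<Suc n}" if "s \<in> topspace (cube n)" "t \<in> {0..1}" for s t
    using that by (intro fcube_upd pad_fcube) auto
  have "continuous_map (prod_topology (top_of_set {0..1::real}) (cube n))
      (product_topology (\<lambda>_. euclideanreal) UNIV) (\<lambda>p. (pad n (snd p))(n := fst p))"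
  proof (subst continuous_map_componentwise, intro conjI ballI)
    fix i
    show "continuous_map (prod_topology (top_of_set {0..1::real}) (cube n)) euclideanreal
        (\<lambda>p. ((pad n (snd p))(n := fst p)) i)"
    proof (cases "i = n")
      case True
      have "continuous_map (prod_topology (top_of_set {0..1::real}) (cube n)) (top_of_set {0..1}) fst"
        by (rule continuous_map_fst)
      then show ?thesis
        using True by (simp add: continuous_map_in_subtopology)
    next
      case False
      have "continuous_map (cube n) euclidean (pad n)"
        using continuous_map_pad by (auto simp: continuous_map_in_subtopology)
      then have "continuous_map (cube n) (product_topology (\<lambda>_. euclideanreal) UNIV) (pad n)"
        by (simp add: euclidean_product_topology)
      then have "continuous_map (cube n) euclideanreal (\<lambda>s. pad n s i)"
        by (subst (asm) continuous_map_componentwise) auto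
      from continuous_map_compose[OF continuous_map_snd this, of "top_of_set {0..1::real}"]
      show ?thesis
        using False by (simp add: o_def)
    qed
  qed auto
  then have upd_map: "continuous_map (prod_topology (top_of_set {0..1::real}) (cube n))
      (top_of_set (fcube {..<Suc n}))
      (\<lambda>p. (pad n (snd p))(n := fst p))"
    using upd by (auto simp: continuous_map_in_subtopology euclidean_product_topology)
  have "continuous_map (top_of_set (fcube {..<Suc n})) (top_of_set Y) h"
    using h by auto
  from continuous_map_compose[OF upd_map this]
  have "continuous_map (prod_topology (top_of_set {0..1::real}) (cube n)) (top_of_set Y) ?k"
    by (simp add: o_def case_prod_unfold)
  moreover have "?k (0, s) = f x" if "s \<in> topspace (cube n)" for s
    using h(3)[of "(pad n s)(n := 0)"] upd[OF that, of 0] by (simp add: horn_def)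
  moreover have "?k (1, s) = f (u (pad n s))" if "s \<in> topspace (cube n)" for s
    using h(4) pad_fcube[OF that] by simp
  moreover have "?k (t, s) = f x" if "s \<in> cube_boundary n" "t \<in> {0..1}" for s t
  proof -
    have "s \<in> topspace (cube n)"
      using that by (simp add: cube_boundary_def)
    then have "(pad n s)(n := t) \<in> horn n"
      using upd[of s t] that by (auto simp: horn_def cube_boundary_def pad_def)
    then show ?thesis using h(3) by simp
  qed
  ultimately have "\<exists>k. continuous_map (prod_topology (top_of_set {0..1::real}) (cube n)) (top_of_set Y) k \<and>
      (\<forall>s\<in>topspace (cube n). k (0, s) = (f \<circ> ?v) s) \<and>
      (\<forall>s\<in>topspace (cube n). k (1, s) = (f \<circ> (u \<circ> pad n)) s) \<and>
      (\<forall>t\<in>{0..1}. \<forall>s\<in>cube_boundary n. k (t, s) = f x)"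
    by (intro exI[of _ ?k] conjI ballI) simp_all
  then have "homotopic_with (\<lambda>w. \<forall>s\<in>cube_boundary n. w s = f x) (cube n) (top_of_set Y)
      (f \<circ> ?v) (f \<circ> (u \<circ> pad n))"
    by (rule homotopic_with[THEN iffD2, rotated]) (auto simp: cube_boundary_def)
  then have "(f \<circ> ?v, f \<circ> (u \<circ> pad n)) \<in> based_homotopy n (top_of_set Y) (f x)"
    by (simp add: based_homotopy_def)
  then have "(?v, u \<circ> pad n) \<in> based_homotopy n (top_of_set X) x"
    using False x by (intro weq_injective[OF weq _ _ bm]) auto
  then obtain k where k: "continuous_map (prod_topology (top_of_set {0..1::real}) (cube n)) (top_of_set X) k"
    "\<And>s. k (0, s) = x" "\<And>s. k (1, s) = u (pad n s)"
    "\<And>t s. t \<in> {0..1::real} \<Longrightarrow> s \<in> cube_boundary n \<Longrightarrow> k (t, s) = x"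
    by (auto simp: based_homotopy_def homotopic_with_def)
  show ?thesis
  proof (rule that[of "\<lambda>q. k (q n, restrict q {..<n})"])
    show "k (q n, restrict q {..<n}) = x" if q: "q \<in> horn n" for q
    proof (cases "q n = 0")
      case True
      then show ?thesis by (simp add: k)
    next
      case False
      then obtain i where "i < n" "q i = 0 \<or> q i = 1" "q \<in> fcube {..<Suc n}"
        using q by (auto simp: horn_def)
      then show ?thesis
        using restrict_boundary[of q "Suc n" n i] by (intro k(4)) (auto simp: fcube_def)
    qed
    show "k ((q(n := 1)) n, restrict (q(n := 1)) {..<n}) = u q" if "q \<in> fcube {..<n}" for q
      using that by (simp add: restrict_upd k pad_restrict)
  qed (use continuous_on_homotopy[OF k(1)] in auto)
qed

section \<open>The stabiliser of the last basis vector\<close>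

text \<open>Indices start at 0, so this is the last basis vector of A^m for m = k + 1.\<close>

definition last_vec :: "nat \<Rightarrow> nat \<Rightarrow> 'a::unital_cstar_algebra" where
  "last_vec k i = (if i = k then 1 else 0)"

definition block :: "nat \<Rightarrow> (nat \<Rightarrow> nat \<Rightarrow> 'a) \<Rightarrow> nat \<Rightarrow> nat \<Rightarrow> 'a::unital_cstar_algebra" where
  "block k g i j = (if i < k \<and> j < k then g i j else 0)"

lemma last_vec_Lg: "last_vec k \<in> Lg (Suc k)"
proof -
  have "(\<Sum>i<Suc k. 1 * last_vec k i) = (1::'a)"
    by (simp add: last_vec_def)
  then show ?thesis
    unfolding Lg_iff by (intro conjI exI[of _ "\<lambda>_. 1"]) (auto simp: vecs_def last_vec_def)
qed

lemma mat_vec_last_vec: "mat_vec (Suc k) g (last_vec k) i = g i k"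
  using sum_delta_mult(2)[of "g i" k "Suc k"] by (simp add: mat_vec_def last_vec_def)

lemma diag_one_mats: "diag_one k a \<in> mats (Suc k)"
  by (auto simp: diag_one_def mats_def)

lemma diag_one_mult:
  "mat_mult (Suc k) (diag_one k a) (diag_one k b) = diag_one k (mat_mult k a b)"
proof (intro ext)
  fix i j
  show "mat_mult (Suc k) (diag_one k a) (diag_one k b) i j = diag_one k (mat_mult k a b) i j"
    by (cases "i < k"; cases "j < k") (auto simp: mat_mult_def diag_one_def)
qed

lemma diag_one_id: "diag_one k (mat_id k) = mat_id (Suc k)"
  by (auto simp: diag_one_def mat_id_def fun_eq_iff)

lemma diag_one_GL:
  assumes "a \<in> GL k"
  shows "diag_one k a \<in> GL (Suc k)"
proof -
  have "mat_mult (Suc k) (diag_one k a) (diag_one k (minv k a)) = mat_id (Suc k)"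
    "mat_mult (Suc k) (diag_one k (minv k a)) (diag_one k a) = mat_id (Suc k)"
    by (simp_all add: diag_one_mult minv[OF assms] diag_one_id)
  then show ?thesis
    unfolding GL_def using diag_one_mats by blast
qed

lemma minv_diag_one:
  assumes "a \<in> GL k"
  shows "minv (Suc k) (diag_one k a) = diag_one k (minv k a)"
  by (rule minv_unique) (simp_all add: diag_one_GL assms diag_one_mats diag_one_mult minv diag_one_id)

lemma block_diag_one: "a \<in> mats k \<Longrightarrow> block k (diag_one k a) = a"
  by (fastforce simp: block_def diag_one_def mats_def)

lemma diag_one_block:
  assumes "g \<in> mats (Suc k)" "\<And>i. g i k = last_vec k i" "\<And>j. g k j = last_vec k j"
  shows "diag_one k (block k g) = g"
proof (intro ext)
  fix i j
  show "diag_one k (block k g) i j = g i j"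
  proof (cases "i < Suc k \<and> j < Suc k")
    case True
    then show ?thesis
      using assms(2)[of i] assms(3)[of j] by (auto simp: diag_one_def block_def last_vec_def less_Suc_eq)
  next
    case False
    then show ?thesis
      using assms(1) unfolding mats_def by (auto simp: diag_one_def)
  qed
qed

text \<open>A corner of an invertible matrix need not be invertible, so the inverse is shown to have
  the same block form: its last column is fixed because it also stabilises the basis vector, and its
  last row is read off from g h = 1. The two corners are then inverse to each other.\<close>

lemma stabiliser_block:
  assumes g: "g \<in> GL (Suc k)" "mat_vec (Suc k) g (last_vec k) = last_vec k"
    and row: "\<And>j. j < k \<Longrightarrow> g k j = 0"
  shows "block k g \<in> GL k" "diag_one k (block k g) = g"
proof -
  define h where "h = minv (Suc k) g"
  have h: "h \<in> mats (Suc k)" "mat_mult (Suc k) g h = mat_id (Suc k)" "mat_mult (Suc k) h g = mat_id (Suc k)"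
    using minv[OF g(1)] by (simp_all add: h_def)
  have gcol: "g i k = last_vec k i" for i
    using mat_vec_last_vec[of k g i] g(2) by simp
  have grow: "g k j = last_vec k j" for j
    using row[of j] gcol[of k] GL_mats[OF g(1)]
    by (cases "j < k"; cases "j = k") (auto simp: last_vec_def mats_def)
  have "mat_vec (Suc k) h (last_vec k) = last_vec k"
    using mat_vec_minv(1)[OF g(1) Lg_vecs[OF last_vec_Lg]] g(2) by (simp add: h_def)
  then have hcol: "h i k = last_vec k i" for i
    using mat_vec_last_vec[of k h i] by simp
  have hrow: "h k j = last_vec k j" for j
  proof -
    have "mat_mult (Suc k) g h k j = (\<Sum>l<Suc k. (if k = l then 1 else 0) * h l j)"
      unfolding mat_mult_def grow last_vec_def by (intro sum.cong) auto
    then have "mat_id (Suc k) k j = h k j"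
      unfolding h(2) sum_delta_mult(1) by simp
    then show ?thesis
      by (auto simp: mat_id_def last_vec_def)
  qed
  have bg: "diag_one k (block k g) = g" and bh: "diag_one k (block k h) = h"
    by (intro diag_one_block GL_mats g(1) h(1) gcol grow hcol hrow)+
  have bm: "block k x \<in> mats k" for x :: "nat \<Rightarrow> nat \<Rightarrow> 'a"
    by (auto simp: block_def mats_def)
  have "mat_mult k (block k g) (block k h) = block k (mat_mult (Suc k) g h)"
    "mat_mult k (block k h) (block k g) = block k (mat_mult (Suc k) h g)"
    using block_diag_one[OF mat_mult_mats[OF bm bm]] diag_one_mult bg bh by metis+
  moreover have "block k (mat_id (Suc k)) = mat_id k"
    by (auto simp: block_def mat_id_def fun_eq_iff)
  ultimately show "block k g \<in> GL k"
    unfolding GL_def by (intro CollectI conjI bexI[of _ "block k h"] bm) (simp_all add: h)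
  show "diag_one k (block k g) = g"
    by (fact bg)
qed

text \<open>A matrix fixing the last basis vector has last column (0, ..., 0, 1) and last row (c,
  1); multiplying on the right by the elementary matrix with last row (-c, 1) clears c. The formula
  makes sense for every matrix and is continuous, so it can be applied off the stabiliser as
  well.\<close>

definition shear :: "nat \<Rightarrow> (nat \<Rightarrow> nat \<Rightarrow> 'a) \<Rightarrow> nat \<Rightarrow> nat \<Rightarrow> 'a::unital_cstar_algebra" where
  "shear k g = rank1 (Suc k) (last_vec k) (\<lambda>j. if j < k then - g k j else 0)"

lemma shear_GL: "shear k g \<in> GL (Suc k)"
  unfolding shear_def by (rule rank1_GL[where c = 1]) (auto simp: last_vec_def)

lemma shear_last_vec: "mat_vec (Suc k) (shear k g) (last_vec k) = last_vec k"
  unfolding shear_def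
  by (subst mat_vec_rank1) (auto simp: Lg_vecs[OF last_vec_Lg] last_vec_def fun_eq_iff)

lemma mult_shear_row:
  assumes "mat_vec (Suc k) g (last_vec k) = last_vec k" "j < k"
  shows "mat_mult (Suc k) g (shear k g) k j = 0"
proof -
  have "g k k = 1"
    using mat_vec_last_vec[of k g k] assms by (simp add: last_vec_def)
  moreover have "(\<Sum>l<k. g k l * (if l = j then 1 else 0)) = g k j"
    using assms(2) by (subst sum_delta_mult(2)) simp
  moreover have "(\<Sum>l<k. g k l * shear k g l j) = (\<Sum>l<k. g k l * (if l = j then 1 else 0))"
    using assms(2) by (intro sum.cong) (auto simp: shear_def rank1_def last_vec_def)
  ultimately show ?thesis
    using assms(2) by (simp add: mat_mult_def) (simp add: shear_def rank1_def last_vec_def)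
qed

lemma continuous_on_shear:
  assumes "continuous_on S F"
  shows "continuous_on S (\<lambda>x. shear k (F x))"
proof (intro continuous_on_coordinatewise_then_product)
  fix i j
  show "continuous_on S (\<lambda>x. shear k (F x) i j)"
    unfolding shear_def rank1_def
    by (cases "i < Suc k \<and> j < Suc k"; cases "j < k")
      (auto intro!: continuous_on_add continuous_on_diff continuous_on_mult continuous_on_minus
        continuous_on_const continuous_on_entry[OF assms])
qed

lemma continuous_on_block:
  assumes "continuous_on S F"
  shows "continuous_on S (\<lambda>x. block k (F x))"
proof (intro continuous_on_coordinatewise_then_product)
  fix i j
  show "continuous_on S (\<lambda>x. block k (F x) i j)"
    unfolding block_def
    by (cases "i < k \<and> j < k") (auto intro!: continuous_on_entry[OF assms])
qed

lemma continuous_on_diag_one: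
  assumes "continuous_on S F"
  shows "continuous_on S (\<lambda>x. diag_one k (F x))"
proof (intro continuous_on_coordinatewise_then_product)
  fix i j
  show "continuous_on S (\<lambda>x. diag_one k (F x) i j)"
    unfolding diag_one_def
    by (cases "i < k \<and> j < k") (auto intro!: continuous_on_entry[OF assms])
qed

section \<open>Weak contractibility of the space of left unimodular vectors\<close>

text \<open>Scaling contracts the cube to the origin and makes \<phi> homotopic to a constant. A
  lift of the single vector at the origin, moved along the lifted homotopy, lifts \<phi>.\<close>

lemma lift_fcube:
  fixes \<phi> :: "(nat \<Rightarrow> real) \<Rightarrow> nat \<Rightarrow> 'a::unital_cstar_algebra"
  assumes trans: "\<And>v :: nat \<Rightarrow> 'a. v \<in> Lg m \<Longrightarrow> \<exists>g\<in>GL m. mat_vec m g e = v"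
    and \<phi>: "continuous_on (fcube \<sigma>) \<phi>" "\<And>q. q \<in> fcube \<sigma> \<Longrightarrow> \<phi> q \<in> Lg m"
  obtains \<Theta> where "continuous_on (fcube \<sigma>) \<Theta>" "\<And>q. q \<in> fcube \<sigma> \<Longrightarrow> \<Theta> q \<in> GL m"
    "\<And>q. q \<in> fcube \<sigma> \<Longrightarrow> mat_vec m (\<Theta> q) e = \<phi> q"
proof -
  define \<gamma> where "\<gamma> = (\<lambda>(q, t). \<phi> (\<lambda>i. t * q i))"
  have sc: "(\<lambda>i. t * q i) \<in> fcube \<sigma>" if "q \<in> fcube \<sigma>" "0 \<le> t" "t \<le> 1" for q and t :: real
    using that by (auto simp: fcube_def mult_le_one)
  have "continuous_on (fcube \<sigma> \<times> {0..1}) (\<lambda>p. \<phi> (\<lambda>i. snd p * fst p i))"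
  proof (rule continuous_on_compose2[OF \<phi>(1)])
    have "continuous_on (fcube \<sigma> \<times> {0..1::real}) (\<lambda>p. fst p i)" for i
      by (rule continuous_on_product_then_coordinatewise) (intro continuous_intros)
    then show "continuous_on (fcube \<sigma> \<times> {0..1}) (\<lambda>p i. snd p * fst p i)"
      by (intro continuous_on_coordinatewise_then_product continuous_on_mult continuous_on_snd
          continuous_on_id)
  qed (use sc in auto)
  then have "continuous_on (fcube \<sigma> \<times> {0..1}) \<gamma>"
    by (simp add: \<gamma>_def case_prod_unfold)
  moreover have "\<gamma> (q, t) \<in> Lg m" if "q \<in> fcube \<sigma>" "0 \<le> t" "t \<le> 1" for q t
    using \<phi>(2)[OF sc[OF that]] by (simp add: \<gamma>_def)
  ultimately obtain G where G: "continuous_on (fcube \<sigma> \<times> {0..1::real}) G"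
    "\<And>q t. q \<in> fcube \<sigma> \<Longrightarrow> 0 \<le> t \<Longrightarrow> t \<le> 1 \<Longrightarrow> G (q, t) \<in> GL m"
    "\<And>q. q \<in> fcube \<sigma> \<Longrightarrow> G (q, 0) = mat_id m"
    "\<And>q t. q \<in> fcube \<sigma> \<Longrightarrow> 0 \<le> t \<Longrightarrow> t \<le> 1 \<Longrightarrow> mat_vec m (G (q, t)) (\<gamma> (q, 0)) = \<gamma> (q, t)"
    by (rule lift_Lg_homotopy[OF compact_fcube]) blast+
  have "(\<lambda>_. 0) \<in> fcube \<sigma>"
    by (simp add: fcube_def)
  then obtain g where g: "g \<in> GL m" "mat_vec m g e = \<phi> (\<lambda>_. 0)"
    using trans \<phi>(2) by blast
  show ?thesis
  proof (rule that[of "\<lambda>q. mat_mult m (G (q, 1)) g"])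
    have "continuous_on (fcube \<sigma>) (\<lambda>q. G (q, 1))"
      by (rule continuous_on_compose2[OF G(1)]) (auto intro!: continuous_intros)
    then show "continuous_on (fcube \<sigma>) (\<lambda>q. mat_mult m (G (q, 1)) g)"
      by (intro continuous_on_mat_mult continuous_on_const)
    show "mat_mult m (G (q, 1)) g \<in> GL m" if "q \<in> fcube \<sigma>" for q
      using G(2)[OF that, of 1] g by simp
    show "mat_vec m (mat_mult m (G (q, 1)) g) e = \<phi> q" if "q \<in> fcube \<sigma>" for q
      using G(4)[OF that, of 1] g by (simp add: mat_vec_mult \<gamma>_def)
  qed
qed

text \<open>
  This is the exactness argument for \<open>\<pi>\<^sub>n\<close> of the orbit map.  A lift \<open>\<Theta>\<close> of \<open>\<phi>\<close> to the general linear group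
  is corrected on the right by elements that fix the last basis vector: by a shear, so that on the boundary
  it takes values in the smaller group; by its composite with the retraction, so that it is trivial on the
  horn; and, using injectivity on \<open>\<pi>\<^sub>n\<^sub>-\<^sub>1\<close>, so that it is trivial on the whole boundary.  Then
  surjectivity on \<open>\<pi>\<^sub>n\<close> deforms it into the stabiliser.
\<close>

lemma Lg_sphere_nullhomotopic:
  fixes \<phi> :: "(nat \<Rightarrow> real) \<Rightarrow> nat \<Rightarrow> 'a::unital_cstar_algebra"
  assumes weq: "weak_homotopy_equivalence (top_of_set (GL k :: (nat \<Rightarrow> nat \<Rightarrow> 'a) set))
      (top_of_set (GL (Suc k))) (diag_one k)"
    and trans: "\<And>v :: nat \<Rightarrow> 'a. v \<in> Lg (Suc k) \<Longrightarrow> \<exists>g\<in>GL (Suc k). mat_vec (Suc k) g (last_vec k) = v"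
    and \<phi>: "continuous_on (fcube {..<n}) \<phi>" "\<And>q. q \<in> fcube {..<n} \<Longrightarrow> \<phi> q \<in> Lg (Suc k)"
      "\<And>q. q \<in> fboundary {..<n} \<Longrightarrow> \<phi> q = last_vec k"
  obtains h where "continuous_on (fcube {..<Suc n}) h" "\<And>q. q \<in> fcube {..<Suc n} \<Longrightarrow> h q \<in> Lg (Suc k)"
    "\<And>q. q \<in> horn n \<Longrightarrow> h q = last_vec k" "\<And>q. q \<in> fcube {..<n} \<Longrightarrow> h (q(n := 1)) = \<phi> q"
proof -
  let ?m = "Suc k" and ?e = "last_vec k :: nat \<Rightarrow> 'a"
  obtain \<Theta> where \<Theta>: "continuous_on (fcube {..<n}) \<Theta>" "\<And>q. q \<in> fcube {..<n} \<Longrightarrow> \<Theta> q \<in> GL ?m"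
    "\<And>q. q \<in> fcube {..<n} \<Longrightarrow> mat_vec ?m (\<Theta> q) ?e = \<phi> q"
    using lift_fcube[OF trans \<phi>(1,2)] by blast
  \<comment> \<open>The shear is applied on the whole cube, where it leaves the image of the basis
    vector unchanged; only on the boundary does it also clear the last row.\<close>
  define \<Theta>1 where "\<Theta>1 q = mat_mult ?m (\<Theta> q) (shear k (\<Theta> q))" for q
  have \<Theta>1: "continuous_on (fcube {..<n}) \<Theta>1" "\<And>q. q \<in> fcube {..<n} \<Longrightarrow> \<Theta>1 q \<in> GL ?m"
    "\<And>q. q \<in> fcube {..<n} \<Longrightarrow> mat_vec ?m (\<Theta>1 q) ?e = \<phi> q"
    unfolding \<Theta>1_def using \<Theta>
    by (auto intro!: continuous_on_mat_mult continuous_on_shear mat_mult_GL shear_GL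
        simp: mat_vec_mult shear_last_vec)
  have \<Theta>1_bd: "\<Theta>1 q \<in> diag_one k ` GL k" if "q \<in> fboundary {..<n}" for q
  proof -
    have q: "q \<in> fcube {..<n}"
      using that fboundary_subset by blast
    have "mat_vec ?m (\<Theta> q) ?e = ?e"
      using \<phi>(3)[OF that] \<Theta>(3)[OF q] by simp
    then have "block k (\<Theta>1 q) \<in> GL k" "diag_one k (block k (\<Theta>1 q)) = \<Theta>1 q"
      using \<phi>(3)[OF that] \<Theta>1(2,3)[OF q] mult_shear_row[of k "\<Theta> q"]
      by (auto intro!: stabiliser_block simp: \<Theta>1_def)
    then show ?thesis by (metis imageI)
  qed
  obtain \<Theta>3 where \<Theta>3: "continuous_on (fcube {..<n}) \<Theta>3" "\<And>q. q \<in> fcube {..<n} \<Longrightarrow> \<Theta>3 q \<in> GL ?m"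
    "\<And>q. q \<in> fcube {..<n} \<Longrightarrow> mat_vec ?m (\<Theta>3 q) ?e = \<phi> q"
    "\<And>q. q \<in> fboundary {..<n} \<Longrightarrow> \<Theta>3 q = mat_id ?m"
  proof (cases n)
    case 0
    then show ?thesis
      using that[OF \<Theta>1] by (auto simp: fboundary_def)
  next
    case (Suc l)
    obtain r where r: "continuous_on (fcube {..<Suc l}) r" "\<And>q. q \<in> fcube {..<Suc l} \<Longrightarrow> r q \<in> horn l"
      "\<And>q. q \<in> horn l \<Longrightarrow> r q = q"
      using horn_retraction[of l] by blast
    note \<Theta>1' = \<Theta>1[unfolded Suc] and \<Theta>1_bd' = \<Theta>1_bd[unfolded Suc]
    have horn: "q \<in> fboundary {..<Suc l}" "q \<in> fcube {..<Suc l}" if "q \<in> horn l" for q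
      using that horn_subset fboundary_subset by blast+
    have diag_fix: "mat_vec ?m g ?e = ?e" if "g \<in> diag_one k ` GL k" for g
    proof
      show "mat_vec ?m g ?e i = ?e i" for i
        unfolding mat_vec_last_vec using that by (auto simp: diag_one_def last_vec_def)
    qed
    have diag_mult: "mat_mult ?m g (minv ?m h) \<in> diag_one k ` GL k" "minv ?m h \<in> diag_one k ` GL k"
      if "g \<in> diag_one k ` GL k" "h \<in> diag_one k ` GL k" for g h :: "nat \<Rightarrow> nat \<Rightarrow> 'a"
      using that by (auto simp: minv_diag_one diag_one_mult)
    \<comment> \<open>Composition with \<open>r\<close> extends the values on the horn to the whole
      cube within the smaller group, whose elements fix the basis vector; dividing by them keeps the
      lift.\<close>
    define \<Theta>2 where "\<Theta>2 q = mat_mult ?m (\<Theta>1 q) (minv ?m (\<Theta>1 (r q)))" for q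
    have rD: "\<Theta>1 (r q) \<in> diag_one k ` GL k" if "q \<in> fcube {..<Suc l}" for q
      by (intro \<Theta>1_bd' horn r that)
    have "continuous_on (fcube {..<Suc l}) (\<lambda>q. \<Theta>1 (r q))"
      by (rule continuous_on_compose2[OF \<Theta>1'(1) r(1)]) (use r(2) horn in blast)
    then have \<Theta>2_cont: "continuous_on (fcube {..<Suc l}) \<Theta>2"
      unfolding \<Theta>2_def using \<Theta>1'(2) r(2) horn
      by (intro continuous_on_mat_mult continuous_on_minv \<Theta>1') auto
    have \<Theta>2: "\<Theta>2 q \<in> GL ?m" "mat_vec ?m (\<Theta>2 q) ?e = \<phi> q" if "q \<in> fcube {..<Suc l}" for q
      using \<Theta>1'(2,3)[OF that] \<Theta>1'(2)[OF horn(2)[OF r(2)[OF that]]]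
        diag_fix[OF diag_mult(2)[OF rD[OF that] rD[OF that]]]
      by (simp_all add: \<Theta>2_def mat_vec_mult)
    have \<Theta>2_bd: "\<Theta>2 q \<in> diag_one k ` GL k" if "q \<in> fboundary {..<Suc l}" for q
      unfolding \<Theta>2_def using that fboundary_subset by (intro diag_mult(1) \<Theta>1_bd' rD) blast+
    have \<Theta>2_horn: "\<Theta>2 q = mat_id ?m" if "q \<in> horn l" for q
      using minv(2)[OF \<Theta>1'(2)[OF horn(2)[OF that]]] by (simp add: \<Theta>2_def r(3)[OF that])
    define a where "a z = block k (\<Theta>2 (z(l := 1)))" for z
    have top: "z(l := 1) \<in> fboundary {..<Suc l}" if "z \<in> fcube {..<l}" for z
      using fcube_upd[OF that, of 1] by (auto simp: fboundary_def)
    have a: "a z \<in> GL k" "diag_one k (a z) = \<Theta>2 (z(l := 1))" if "z \<in> fcube {..<l}" for z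
      using \<Theta>2_bd[OF top[OF that]] by (auto simp: a_def block_diag_one GL_mats)
    have a_cont: "continuous_on (fcube {..<l}) a"
      unfolding a_def
    proof (intro continuous_on_block continuous_on_compose2[OF \<Theta>2_cont] continuous_on_upd
        continuous_on_const)
      show "(\<lambda>z. z(l := 1)) ` fcube {..<l} \<subseteq> fcube {..<Suc l}"
        using top fboundary_subset by blast
    qed (rule continuous_on_id)
    have a_bd: "a z = mat_id k" if "z \<in> fboundary {..<l}" for z
    proof -
      have z: "z \<in> fcube {..<l}"
        using that fboundary_subset by blast
      have "z(l := 1) \<in> horn l"
        using that fcube_upd[OF z, of 1] by (auto simp: horn_def fboundary_def)
      then show ?thesis
        using \<Theta>2_horn by (simp add: a_def flip: diag_one_id) (simp add: block_diag_one)
    qed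
    obtain h' where h': "continuous_on (fcube {..<Suc l}) h'" "\<And>q. q \<in> fcube {..<Suc l} \<Longrightarrow> h' q \<in> GL k"
      "\<And>q. q \<in> horn l \<Longrightarrow> h' q = mat_id k" "\<And>q. q \<in> fcube {..<l} \<Longrightarrow> h' (q(l := 1)) = a q"
    \<comment> \<open>The null-homotopy in the larger group is \<Theta>2 itself: trivial on the
      horn, and equal to \<open>diag_one k (a z)\<close> on the top face.\<close>
    proof (rule weq_contract[OF weq mat_id_GL a_cont a(1) a_bd \<Theta>2_cont \<Theta>2(1)])
      show "\<Theta>2 q = diag_one k (mat_id k)" if "q \<in> horn l" for q
        using \<Theta>2_horn[OF that] by (simp add: diag_one_id)
      show "\<Theta>2 (q(l := 1)) = diag_one k (a q)" if "q \<in> fcube {..<l}" for q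
        using a(2)[OF that] by simp
    qed auto
    \<comment> \<open>The divisor takes values in the smaller group and agrees with \<Theta>2 on the
      whole boundary, horn and top face alike.\<close>
    define \<Theta>3 where "\<Theta>3 q = mat_mult ?m (\<Theta>2 q) (minv ?m (diag_one k (h' q)))" for q
    have h'_GL: "diag_one k (h' q) \<in> GL ?m" "diag_one k (h' q) \<in> diag_one k ` GL k"
      if "q \<in> fcube {..<Suc l}" for q
      using h'(2)[OF that] by (auto simp: diag_one_GL)
    have \<Theta>3_bd: "\<Theta>3 q = mat_id ?m" if "q \<in> fboundary {..<Suc l}" for q
    proof -
      have q: "q \<in> fcube {..<Suc l}"
        using that fboundary_subset by blast
      have "diag_one k (h' q) = \<Theta>2 q"
        using fboundary_Suc_cases[OF that]
      proof
        assume "q \<in> horn l"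
        then show ?thesis
          by (simp add: \<Theta>2_horn h' diag_one_id)
      next
        assume "q = (q(l := 0))(l := 1)"
        then show ?thesis
          using h'(4)[OF fcube_upd_inv[OF q]] a(2)[OF fcube_upd_inv[OF q]] by metis
      qed
      then show ?thesis
        using minv(2)[OF \<Theta>2(1)[OF q]] by (simp add: \<Theta>3_def)
    qed
    show ?thesis
    proof (rule that[of \<Theta>3])
      show "continuous_on (fcube {..<n}) \<Theta>3"
        unfolding \<Theta>3_def Suc
        by (intro continuous_on_mat_mult continuous_on_minv continuous_on_diag_one \<Theta>2_cont h'(1) h'_GL)
      show "\<Theta>3 q \<in> GL ?m" "mat_vec ?m (\<Theta>3 q) ?e = \<phi> q" if "q \<in> fcube {..<n}" for q
        using \<Theta>2[OF that[unfolded Suc]] h'_GL[OF that[unfolded Suc]]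
          diag_fix[OF diag_mult(2)[OF h'_GL(2)[OF that[unfolded Suc]] h'_GL(2)[OF that[unfolded Suc]]]]
        by (simp_all add: \<Theta>3_def mat_vec_mult)
      show "\<Theta>3 q = mat_id ?m" if "q \<in> fboundary {..<n}" for q
        using \<Theta>3_bd that Suc by simp
    qed
  qed
  obtain h where h: "continuous_on (fcube {..<Suc n}) h" "\<And>q. q \<in> fcube {..<Suc n} \<Longrightarrow> h q \<in> GL ?m"
    "\<And>q i. q \<in> fcube {..<Suc n} \<Longrightarrow> i < n \<Longrightarrow> q i = 0 \<or> q i = 1 \<Longrightarrow> h q = diag_one k (mat_id k)"
    "\<And>q. q \<in> fcube {..<n} \<Longrightarrow> h (q(n := 1)) = \<Theta>3 q"
    "\<And>q. q \<in> fcube {..<n} \<Longrightarrow> h (q(n := 0)) \<in> diag_one k ` GL k"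
  proof (rule weq_compress[OF weq mat_id_GL \<Theta>3(1,2)])
    show "\<Theta>3 q = diag_one k (mat_id k)" if "q \<in> fboundary {..<n}" for q
      using \<Theta>3(4)[OF that] by (simp add: diag_one_id)
  qed auto
  show ?thesis
  \<comment> \<open>On the bottom face \<open>h\<close> takes values in the smaller group, which
    fixes the basis vector; so applying \<open>h\<close> to that vector contracts \<phi>.\<close>
  proof (rule that[of "\<lambda>q. mat_vec ?m (h q) ?e"])
    show "continuous_on (fcube {..<Suc n}) (\<lambda>q. mat_vec ?m (h q) ?e)"
      by (intro continuous_on_mat_vec h continuous_on_const)
    show "mat_vec ?m (h q) ?e \<in> Lg ?m" if "q \<in> fcube {..<Suc n}" for q
      by (intro mat_vec_Lg h that last_vec_Lg)
    show "mat_vec ?m (h (q(n := 1))) ?e = \<phi> q" if "q \<in> fcube {..<n}" for q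
      using that by (simp add: h \<Theta>3)
    show "mat_vec ?m (h q) ?e = ?e" if q: "q \<in> horn n" for q
    proof -
      have C: "q \<in> fcube {..<Suc n}"
        using q by (simp add: horn_def)
      have "h q \<in> diag_one k ` GL k"
      proof (cases "q n = 0")
        case True
        then have "q = (q(n := 0))(n := 0)"
          by (simp add: fun_upd_idem)
        then show ?thesis
          using h(5)[OF fcube_upd_inv[OF C]] by simp
      next
        case False
        then show ?thesis
          using q h(3)[OF C] by (auto simp: horn_def)
      qed
      then show ?thesis
        by (auto simp: fun_eq_iff mat_vec_last_vec diag_one_def last_vec_def)
    qed
  qed
qed

text \<open>On the horn \<phi> agrees with \<phi> composed with the retraction, which is defined on
  the cube and lifts to matrices \<Psi>. Translating by the inverse of \<Psi> makes \<phi> constant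
  on the horn, so that only a based sphere on the top face remains. Its null-homotopy has the right
  values on the whole boundary and is translated back by \<Psi>.\<close>

lemma Lg_extend_from_fboundary:
  fixes \<phi> :: "(nat \<Rightarrow> real) \<Rightarrow> nat \<Rightarrow> 'a::unital_cstar_algebra"
  assumes weq: "weak_homotopy_equivalence (top_of_set (GL k :: (nat \<Rightarrow> nat \<Rightarrow> 'a) set))
      (top_of_set (GL (Suc k))) (diag_one k)"
    and trans: "\<And>v :: nat \<Rightarrow> 'a. v \<in> Lg (Suc k) \<Longrightarrow> \<exists>g\<in>GL (Suc k). mat_vec (Suc k) g (last_vec k) = v"
    and \<phi>: "continuous_on (fboundary {..<Suc n}) \<phi>" "\<And>q. q \<in> fboundary {..<Suc n} \<Longrightarrow> \<phi> q \<in> Lg (Suc k)"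
  shows "\<exists>\<Phi>. continuous_on (fcube {..<Suc n}) \<Phi> \<and> (\<forall>q\<in>fcube {..<Suc n}. \<Phi> q \<in> Lg (Suc k)) \<and>
    (\<forall>q\<in>fboundary {..<Suc n}. \<Phi> q = \<phi> q)"
proof -
  let ?m = "Suc k" and ?e = "last_vec k :: nat \<Rightarrow> 'a"
  let ?C = "fcube {..<Suc n}"
  obtain r where r: "continuous_on ?C r" "\<And>q. q \<in> ?C \<Longrightarrow> r q \<in> horn n" "\<And>q. q \<in> horn n \<Longrightarrow> r q = q"
    using horn_retraction[of n] by blast
  have horn: "q \<in> fboundary {..<Suc n}" if "q \<in> horn n" for q
    using that horn_subset by blast
  have "continuous_on ?C (\<lambda>q. \<phi> (r q))"
    by (rule continuous_on_compose2[OF \<phi>(1) r(1)]) (use r(2) horn in blast)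
  moreover have "\<phi> (r q) \<in> Lg ?m" if "q \<in> ?C" for q
    by (intro \<phi> horn r that)
  ultimately obtain \<Psi> where \<Psi>: "continuous_on ?C \<Psi>" "\<And>q. q \<in> ?C \<Longrightarrow> \<Psi> q \<in> GL ?m"
    "\<And>q. q \<in> ?C \<Longrightarrow> mat_vec ?m (\<Psi> q) ?e = \<phi> (r q)"
    using lift_fcube[OF trans, of "{..<Suc n}" "\<lambda>q. \<phi> (r q)"] by blast
  have bC: "q \<in> ?C" if "q \<in> fboundary {..<Suc n}" for q
    using that fboundary_subset by blast
  define \<phi>1 where "\<phi>1 q = mat_vec ?m (minv ?m (\<Psi> q)) (\<phi> q)" for q
  have \<phi>1_cont: "continuous_on (fboundary {..<Suc n}) \<phi>1"
    unfolding \<phi>1_def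
    by (intro continuous_on_mat_vec continuous_on_minv \<phi>(1) continuous_on_subset[OF \<Psi>(1)]
        fboundary_subset \<Psi>(2) bC)
  have \<phi>1: "\<phi>1 q \<in> Lg ?m" if "q \<in> fboundary {..<Suc n}" for q
    unfolding \<phi>1_def by (intro mat_vec_Lg minv_GL \<Psi>(2) bC \<phi>(2) that)
  have \<phi>1_horn: "\<phi>1 q = ?e" if "q \<in> horn n" for q
  proof -
    have "mat_vec ?m (\<Psi> q) ?e = \<phi> q"
      using \<Psi>(3)[OF bC[OF horn[OF that]]] r(3)[OF that] by simp
    then show ?thesis
      unfolding \<phi>1_def
      using mat_vec_minv(1)[OF \<Psi>(2)[OF bC[OF horn[OF that]]] Lg_vecs[OF last_vec_Lg]] by simp
  qed
  have top: "q(n := 1) \<in> fboundary {..<Suc n}" if "q \<in> fcube {..<n}" for q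
    using fcube_upd[OF that, of 1] by (auto simp: fboundary_def)
  obtain h where h: "continuous_on ?C h" "\<And>q. q \<in> ?C \<Longrightarrow> h q \<in> Lg ?m"
    "\<And>q. q \<in> horn n \<Longrightarrow> h q = ?e" "\<And>q. q \<in> fcube {..<n} \<Longrightarrow> h (q(n := 1)) = \<phi>1 (q(n := 1))"
  proof (rule Lg_sphere_nullhomotopic[OF weq trans, of n "\<lambda>q. \<phi>1 (q(n := 1))"])
    show "continuous_on (fcube {..<n}) (\<lambda>q. \<phi>1 (q(n := 1)))"
    proof (intro continuous_on_compose2[OF \<phi>1_cont] continuous_on_upd continuous_on_const)
      show "(\<lambda>q. q(n := 1)) ` fcube {..<n} \<subseteq> fboundary {..<Suc n}"
        using top by blast
    qed (rule continuous_on_id)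
    show "\<phi>1 (q(n := 1)) \<in> Lg ?m" if "q \<in> fcube {..<n}" for q
      by (intro \<phi>1 top that)
    show "\<phi>1 (q(n := 1)) = ?e" if "q \<in> fboundary {..<n}" for q
    proof -
      have q: "q \<in> fcube {..<n}"
        using that fboundary_subset by blast
      have "q(n := 1) \<in> horn n"
        using that fcube_upd[OF q, of 1] by (auto simp: horn_def fboundary_def)
      then show ?thesis by (rule \<phi>1_horn)
    qed
  qed auto
  have h_bd: "h q = \<phi>1 q" if "q \<in> fboundary {..<Suc n}" for q
    using fboundary_Suc_cases[OF that]
  proof
    assume "q \<in> horn n"
    then show ?thesis by (simp add: h \<phi>1_horn)
  next
    assume "q = (q(n := 0))(n := 1)"
    then show ?thesis
      using h(4)[OF fcube_upd_inv[OF bC[OF that]]] by metis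
  qed
  show ?thesis
  proof (intro exI[of _ "\<lambda>q. mat_vec ?m (\<Psi> q) (h q)"] conjI ballI)
    show "continuous_on ?C (\<lambda>q. mat_vec ?m (\<Psi> q) (h q))"
      by (intro continuous_on_mat_vec \<Psi> h)
    show "mat_vec ?m (\<Psi> q) (h q) \<in> Lg ?m" if "q \<in> ?C" for q
      by (intro mat_vec_Lg \<Psi> h that)
    show "mat_vec ?m (\<Psi> q) (h q) = \<phi> q" if "q \<in> fboundary {..<Suc n}" for q
      unfolding h_bd[OF that] \<phi>1_def
      by (rule mat_vec_minv(2)[OF \<Psi>(2)[OF bC[OF that]] Lg_vecs[OF \<phi>(2)[OF that]]])
  qed
qed

section \<open>Extending maps over cubical cones\<close>

text \<open>Simplices of the nerve are arbitrary finite index sets; an enumeration of \<sigma>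
  permutes coordinates and reduces to an initial segment.\<close>

lemma extend_from_fboundary_reindex:
  fixes U :: "'u::topological_space set"
  assumes ext: "\<And>n \<phi>. continuous_on (fboundary {..<Suc n}) \<phi> \<Longrightarrow> \<forall>q\<in>fboundary {..<Suc n}. \<phi> q \<in> U \<Longrightarrow>
      \<exists>\<Phi>. continuous_on (fcube {..<Suc n}) \<Phi> \<and> (\<forall>q\<in>fcube {..<Suc n}. \<Phi> q \<in> U) \<and>
        (\<forall>q\<in>fboundary {..<Suc n}. \<Phi> q = \<phi> q)"
    and \<sigma>: "finite \<sigma>" "\<sigma> \<noteq> {}"
    and \<phi>: "continuous_on (fboundary \<sigma>) \<phi>" "\<forall>q\<in>fboundary \<sigma>. \<phi> q \<in> U"
  shows "\<exists>\<Phi>. continuous_on (fcube \<sigma>) \<Phi> \<and> (\<forall>q\<in>fcube \<sigma>. \<Phi> q \<in> U) \<and> (\<forall>q\<in>fboundary \<sigma>. \<Phi> q = \<phi> q)"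
proof -
  obtain n where n: "card \<sigma> = Suc n"
    using \<sigma> by (metis card_eq_0_iff not0_implies_Suc)
  then obtain f where f: "bij_betw f {..<Suc n} \<sigma>"
    using ex_bij_betw_nat_finite[OF \<sigma>(1)] by (metis atLeast0LessThan)
  define P where "P q = (\<lambda>i. if i \<in> \<sigma> then q (inv_into {..<Suc n} f i) else 0)" for q :: "nat \<Rightarrow> real"
  define P' where "P' p = (\<lambda>j. if j < Suc n then p (f j) else 0)" for p :: "nat \<Rightarrow> real"
  have inv: "inv_into {..<Suc n} f i < Suc n" "f (inv_into {..<Suc n} f i) = i" if "i \<in> \<sigma>" for i
    using bij_betw_inv_into_right[OF f that] bij_betwE[OF bij_betw_inv_into[OF f]] that by auto
  have f\<sigma>: "f j \<in> \<sigma>" "inv_into {..<Suc n} f (f j) = j" if "j < Suc n" for j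
    using bij_betwE[OF f] bij_betw_inv_into_left[OF f] that by auto
  have P: "P q \<in> fcube \<sigma>" if "q \<in> fcube {..<Suc n}" for q
    using that inv by (auto simp: fcube_def P_def)
  have P': "P' p \<in> fcube {..<Suc n}" if "p \<in> fcube \<sigma>" for p
    using that f\<sigma> by (auto simp: fcube_def P'_def)
  have Pb: "P q \<in> fboundary \<sigma>" if q: "q \<in> fboundary {..<Suc n}" for q
  proof -
    obtain j where j: "j < Suc n" "q j = 0 \<or> q j = 1"
      using q by (auto simp: fboundary_def)
    then have "P q (f j) = 0 \<or> P q (f j) = 1"
      using f\<sigma>[OF j(1)] by (simp add: P_def)
    then show ?thesis
      using P[of q] q f\<sigma>(1)[OF j(1)] unfolding fboundary_def by blast
  qed
  have Pb': "P' p \<in> fboundary {..<Suc n}" if p: "p \<in> fboundary \<sigma>" for p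
  proof -
    obtain i where i: "i \<in> \<sigma>" "p i = 0 \<or> p i = 1"
      using p by (auto simp: fboundary_def)
    then have "P' p (inv_into {..<Suc n} f i) = 0 \<or> P' p (inv_into {..<Suc n} f i) = 1"
      using inv[OF i(1)] by (simp add: P'_def)
    then show ?thesis
      using P'[of p] p inv(1)[OF i(1)] unfolding fboundary_def by blast
  qed
  have PP': "P (P' p) = p" if "p \<in> fcube \<sigma>" for p
    using that inv by (auto simp: P_def P'_def fcube_def)
  have cont_P: "continuous_on S P" for S
    unfolding P_def
  proof (rule continuous_on_coordinatewise_then_product)
    show "continuous_on S (\<lambda>q. if i \<in> \<sigma> then q (inv_into {..<Suc n} f i) else 0)" for i
      by (cases "i \<in> \<sigma>") (auto intro: continuous_on_coordinate)
  qed
  have cont_P': "continuous_on S P'" for S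
    unfolding P'_def
  proof (rule continuous_on_coordinatewise_then_product)
    show "continuous_on S (\<lambda>p. if j < Suc n then p (f j) else 0)" for j
      by (cases "j < Suc n") (auto intro: continuous_on_coordinate)
  qed
  have "continuous_on (fboundary {..<Suc n}) (\<lambda>q. \<phi> (P q))"
    by (rule continuous_on_compose2[OF \<phi>(1) cont_P]) (use Pb in blast)
  moreover have "\<forall>q\<in>fboundary {..<Suc n}. \<phi> (P q) \<in> U"
    using \<phi>(2) Pb by blast
  ultimately obtain \<Phi> where \<Phi>: "continuous_on (fcube {..<Suc n}) \<Phi>"
    "\<forall>q\<in>fcube {..<Suc n}. \<Phi> q \<in> U" "\<forall>q\<in>fboundary {..<Suc n}. \<Phi> q = \<phi> (P q)"
    using ext[of n "\<lambda>q. \<phi> (P q)"] by metis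
  have "continuous_on (fcube \<sigma>) (\<lambda>p. \<Phi> (P' p))"
    by (rule continuous_on_compose2[OF \<Phi>(1) cont_P']) (use P' in blast)
  moreover have "\<Phi> (P' p) = \<phi> p" if "p \<in> fboundary \<sigma>" for p
    using \<Phi>(3) Pb'[OF that] PP' that fboundary_subset by fastforce
  ultimately show ?thesis
    using \<Phi>(2) P' by (intro exI[of _ "\<lambda>p. \<Phi> (P' p)"]) blast
qed

text \<open>
  The union of the cubes \<open>fcube \<sigma>\<close> with \<open>\<sigma> \<in> K\<close> is the cone over the simplicial complex \<open>K\<close>,
  with apex \<open>0\<close> and with the base formed by the points that have some coordinate equal to \<open>1\<close>.
\<close>

definition cone_base :: "nat set set \<Rightarrow> (nat \<Rightarrow> real) set" where
  "cone_base K = {q \<in> (\<Union>\<sigma>\<in>K. fcube \<sigma>). \<exists>i\<in>\<Union>K. q i = 1}"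

lemma closed_cone_base:
  assumes "finite K" "\<And>\<sigma>. \<sigma> \<in> K \<Longrightarrow> finite \<sigma>"
  shows "closed (cone_base K)"
proof -
  have "closed {q :: nat \<Rightarrow> real. q i = 1}" for i
    using continuous_on_coordinate[of UNIV i]
    by (intro closed_Collect_eq continuous_on_const) auto
  then have "closed ((\<Union>\<sigma>\<in>K. fcube \<sigma>) \<inter> (\<Union>i\<in>\<Union>K. {q. q i = 1}))"
    using assms by (intro closed_Int closed_UN ballI closed_fcube) auto
  moreover have "(\<Union>\<sigma>\<in>K. fcube \<sigma>) \<inter> (\<Union>i\<in>\<Union>K. {q. q i = 1}) = cone_base K"
    by (auto simp: cone_base_def)
  ultimately show ?thesis by simp
qed

text \<open>Induction on the number of simplices, removing a maximal \<sigma>. A boundary point of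
  \<open>fcube \<sigma>\<close> has a coordinate 0, and then lies in the cone over the rest, or a
  coordinate 1, and then lies in the base. So the map is already prescribed on the boundary of the
  last cube, and \<open>ext\<close> fills it.\<close>

lemma extend_over_cone:
  fixes U :: "'u::topological_space set"
  assumes ext: "\<And>n \<phi>. continuous_on (fboundary {..<Suc n}) \<phi> \<Longrightarrow> \<forall>q\<in>fboundary {..<Suc n}. \<phi> q \<in> U \<Longrightarrow>
      \<exists>\<Phi>. continuous_on (fcube {..<Suc n}) \<Phi> \<and> (\<forall>q\<in>fcube {..<Suc n}. \<Phi> q \<in> U) \<and>
        (\<forall>q\<in>fboundary {..<Suc n}. \<Phi> q = \<phi> q)"
    and e: "e \<in> U"
    and K: "finite K" "\<And>\<sigma>. \<sigma> \<in> K \<Longrightarrow> finite \<sigma>" "\<And>\<sigma> \<tau>. \<sigma> \<in> K \<Longrightarrow> \<tau> \<subseteq> \<sigma> \<Longrightarrow> \<tau> \<in> K"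
    and g: "continuous_on (cone_base K) g" "\<And>q. q \<in> cone_base K \<Longrightarrow> g q \<in> U"
  shows "\<exists>H. continuous_on (\<Union>\<sigma>\<in>K. fcube \<sigma>) H \<and> (\<forall>q\<in>\<Union>\<sigma>\<in>K. fcube \<sigma>. H q \<in> U) \<and>
    (\<forall>q\<in>cone_base K. H q = g q) \<and> H (\<lambda>_. 0) = e"
  using K g
proof (induction "card K" arbitrary: K)
  case 0
  then show ?case
    by (intro exI[of _ "\<lambda>_. e"]) (auto simp: cone_base_def)
next
  case (Suc N)
  have "K \<noteq> {}"
    using Suc.hyps(2) by auto
  then obtain \<sigma> where \<sigma>: "\<sigma> \<in> K" and max: "\<And>\<tau>. \<tau> \<in> K \<Longrightarrow> \<sigma> \<subseteq> \<tau> \<Longrightarrow> \<sigma> = \<tau>"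
    using finite_has_maximal[OF Suc.prems(1)] by blast
  show ?case
  proof (cases "\<sigma> = {}")
    case True
    then have "K = {{}}"
      using \<sigma> max by auto
    then show ?thesis
      using e by (intro exI[of _ "\<lambda>_. e"]) (auto simp: cone_base_def)
  next
    case False
    define L where "L = K - {\<sigma>}"
    let ?L = "\<Union>\<tau>\<in>L. fcube \<tau>"
    have K_eq: "K = insert \<sigma> L"
      using \<sigma> by (auto simp: L_def)
    have L: "finite L" "\<And>\<tau>. \<tau> \<in> L \<Longrightarrow> finite \<tau>" "\<And>\<tau> \<rho>. \<tau> \<in> L \<Longrightarrow> \<rho> \<subseteq> \<tau> \<Longrightarrow> \<rho> \<in> L"
      unfolding L_def using Suc.prems(1) Suc.prems(2) Suc.prems(3) max by blast+
    have base_sub: "cone_base L \<subseteq> cone_base K"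
      by (auto simp: cone_base_def K_eq)
    have "N = card L"
      using Suc.hyps(2) Suc.prems(1) \<sigma> by (simp add: L_def)
    moreover have "continuous_on (cone_base L) g" "\<And>q. q \<in> cone_base L \<Longrightarrow> g q \<in> U"
      using continuous_on_subset[OF Suc.prems(4) base_sub] Suc.prems(5) base_sub by blast+
    ultimately have "\<exists>H. continuous_on ?L H \<and> (\<forall>q\<in>?L. H q \<in> U) \<and>
        (\<forall>q\<in>cone_base L. H q = g q) \<and> H (\<lambda>_. 0) = e"
      using L by (intro Suc.hyps(1)) assumption+
    then obtain H where H: "continuous_on ?L H" "\<forall>q\<in>?L. H q \<in> U" "\<forall>q\<in>cone_base L. H q = g q"
      "H (\<lambda>_. 0) = e"
      by blast
    have closed_L: "closed ?L"
      using L(1) by (intro closed_UN ballI closed_fcube) auto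
    have closed_base: "closed (cone_base K)"
      using Suc.prems by (intro closed_cone_base)
    \<comment> \<open>A coordinate equal to 1 cannot lie outside \<tau>, so a base point in the
      smaller cone belongs to the smaller base.\<close>
    have agree: "H q = g q" if q: "q \<in> ?L" "q \<in> cone_base K" for q
    proof -
      obtain \<tau> i where \<tau>: "\<tau> \<in> L" "q \<in> fcube \<tau>" "q i = 1"
        using q by (auto simp: cone_base_def)
      then have "i \<in> \<tau>"
        by (auto simp: fcube_def)
      then have "q \<in> cone_base L"
        using \<tau> by (auto simp: cone_base_def)
      then show ?thesis using H(3) by blast
    qed
    define \<phi> where "\<phi> q = (if q \<in> ?L then H q else g q)" for q
    have "continuous_on (?L \<union> cone_base K) \<phi>"
      unfolding \<phi>_def
      by (rule continuous_on_cases[OF closed_L closed_base H(1) Suc.prems(4)]) (use agree in auto)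
    moreover have bd: "fboundary \<sigma> \<subseteq> ?L \<union> cone_base K"
    proof
      fix q assume "q \<in> fboundary \<sigma>"
      then obtain i where i: "i \<in> \<sigma>" "q i = 0 \<or> q i = 1" "q \<in> fcube \<sigma>"
        by (auto simp: fboundary_def)
      show "q \<in> ?L \<union> cone_base K"
      proof (cases "q i = 0")
        case True
        have "\<sigma> - {i} \<in> L"
          using Suc.prems(3)[OF \<sigma>, of "\<sigma> - {i}"] i by (auto simp: L_def)
        moreover have "q \<in> fcube (\<sigma> - {i})"
          using i True by (auto simp: fcube_def)
        ultimately show ?thesis by blast
      next
        case False
        then show ?thesis
          using i \<sigma> by (auto simp: cone_base_def)
      qed
    qed
    ultimately have "continuous_on (fboundary \<sigma>) \<phi>"
      by (rule continuous_on_subset)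
    moreover have "\<forall>q\<in>fboundary \<sigma>. \<phi> q \<in> U"
      using bd H(2) Suc.prems(5) by (fastforce simp: \<phi>_def)
    ultimately obtain \<Phi> where \<Phi>: "continuous_on (fcube \<sigma>) \<Phi>" "\<forall>q\<in>fcube \<sigma>. \<Phi> q \<in> U"
      "\<forall>q\<in>fboundary \<sigma>. \<Phi> q = \<phi> q"
      using extend_from_fboundary_reindex[OF ext Suc.prems(2)[OF \<sigma>] False] by blast
    \<comment> \<open>By maximality \<sigma> is not contained in \<tau>; a coordinate in the
      difference vanishes on \<open>fcube \<tau>\<close>.\<close>
    have overlap: "q \<in> fboundary \<sigma>" if q: "q \<in> ?L" "q \<in> fcube \<sigma>" for q
    proof -
      obtain \<tau> where \<tau>: "\<tau> \<in> L" "q \<in> fcube \<tau>"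
        using q by blast
      then have "\<not> \<sigma> \<subseteq> \<tau>"
        using max by (auto simp: L_def)
      then obtain i where "i \<in> \<sigma>" "i \<notin> \<tau>" by blast
      then show ?thesis
        using \<tau> q by (auto simp: fboundary_def fcube_def)
    qed
    define H' where "H' q = (if q \<in> ?L then H q else \<Phi> q)" for q
    have "continuous_on (?L \<union> fcube \<sigma>) H'"
      unfolding H'_def
      by (rule continuous_on_cases[OF closed_L closed_fcube H(1) \<Phi>(1)])
        (use overlap \<Phi>(3) in \<open>auto simp: \<phi>_def\<close>)
    moreover have "?L \<union> fcube \<sigma> = (\<Union>\<tau>\<in>K. fcube \<tau>)"
      by (auto simp: K_eq)
    moreover have "\<forall>q\<in>\<Union>\<tau>\<in>K. fcube \<tau>. H' q \<in> U"
      using H(2) \<Phi>(2) by (auto simp: H'_def K_eq)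
    moreover have "H' q = g q" if q: "q \<in> cone_base K" for q
    proof (cases "q \<in> ?L")
      case True
      then show ?thesis using agree q by (simp add: H'_def)
    next
      case F: False
      then obtain i where i: "q \<in> fcube \<sigma>" "q i = 1"
        using q by (auto simp: cone_base_def K_eq)
      then have "q \<in> fboundary \<sigma>"
        by (auto simp: fboundary_def fcube_def)
      then show ?thesis
        using F \<Phi>(3) by (simp add: H'_def \<phi>_def)
    qed
    moreover have "{} \<in> L"
      using Suc.prems(3)[OF \<sigma>, of "{}"] False by (auto simp: L_def)
    then have "(\<lambda>_. 0) \<in> ?L"
      by (force simp: fcube_def)
    then have "H' (\<lambda>_. 0) = e"
      using H(4) by (simp add: H'_def)
    ultimately show ?thesis
      by (intro exI[of _ H']) auto
  qed
qed

section \<open>Null-homotopies on compact spaces\<close>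

definition vdist :: "nat \<Rightarrow> (nat \<Rightarrow> 'a::unital_cstar_algebra) \<Rightarrow> (nat \<Rightarrow> 'a) \<Rightarrow> real" where
  "vdist n u v = (\<Sum>i<n. norm (u i - v i))"

lemma vdist_nonneg: "0 \<le> vdist n u v"
  by (simp add: vdist_def sum_nonneg)

text \<open>Convexity of balls, with distances controlled only for the points of positive weight.
  Strictness survives because the weights sum to 1, so some weight is positive.\<close>

lemma vdist_convex_combination:
  fixes N :: nat
  assumes w: "\<And>j. j < N \<Longrightarrow> 0 \<le> w j" "(\<Sum>j<N. w j) = 1"
    and a: "\<And>j. j < N \<Longrightarrow> 0 < w j \<Longrightarrow> vdist n u (a j) < r"
  shows "vdist n u (\<lambda>i. \<Sum>j<N. w j *\<^sub>R a j i) < r"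
proof -
  have "u i - (\<Sum>j<N. w j *\<^sub>R a j i) = (\<Sum>j<N. w j *\<^sub>R (u i - a j i))" for i
    by (simp add: scaleR_diff_right sum_subtractf w(2) flip: scaleR_sum_left)
  then have "norm (u i - (\<Sum>j<N. w j *\<^sub>R a j i)) \<le> (\<Sum>j<N. w j * norm (u i - a j i))" for i
    using w(1) by (auto intro!: sum_norm_le)
  then have "vdist n u (\<lambda>i. \<Sum>j<N. w j *\<^sub>R a j i) \<le> (\<Sum>i<n. \<Sum>j<N. w j * norm (u i - a j i))"
    unfolding vdist_def by (intro sum_mono)
  also have "\<dots> = (\<Sum>j<N. w j * vdist n u (a j))"
    by (subst sum.swap) (simp add: vdist_def sum_distrib_left)
  also have "\<dots> < (\<Sum>j<N. w j * r)"
  proof (rule sum_strict_mono_ex1)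
    have "w j * vdist n u (a j) \<le> w j * r" if "j < N" for j
      using w(1)[OF that] a[OF that] by (cases "w j = 0") auto
    then show "\<forall>j\<in>{..<N}. w j * vdist n u (a j) \<le> w j * r" by blast
    have "\<exists>j<N. w j > 0"
    proof (rule ccontr)
      assume "\<not> (\<exists>j<N. w j > 0)"
      then have "w j \<le> 0" if "j < N" for j
        using that not_less by blast
      then have "(\<Sum>j<N. w j) \<le> (\<Sum>j<N. 0)"
        by (intro sum_mono) simp
      then show False using w(2) by simp
    qed
    then obtain j where j: "j < N" "0 < w j"
      by blast
    then have "w j * vdist n u (a j) < w j * r"
      by (intro mult_strict_left_mono a)
    then show "\<exists>j\<in>{..<N}. w j * vdist n u (a j) < w j * r"
      using j by blast
  qed simp
  also have "\<dots> = r"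
    by (simp add: w(2) flip: sum_distrib_right)
  finally show ?thesis .
qed

text \<open>A continuous left inverse \<open>b\<close> is bounded on the compact space. If v is
  within the reciprocal of a positive bound of f x, then b v differs from 1 by less than 1 and is
  invertible.\<close>

lemma Lg_uniform_neighbourhood:
  fixes f :: "'x::topological_space \<Rightarrow> nat \<Rightarrow> 'a::unital_cstar_algebra"
  assumes compact: "compact (UNIV :: 'x set)" and f: "continuous_on UNIV f" "\<And>x. f x \<in> Lg n"
  obtains r where "r > 0" "\<And>x v. v \<in> vecs n \<Longrightarrow> vdist n (f x) v < r \<Longrightarrow> v \<in> Lg n"
proof -
  obtain b where b: "continuous_on UNIV b" "\<And>x. (\<Sum>i<n. b x i * f x i) = 1"
    using continuous_left_inverse[OF compact f(1)] f(2) by blast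
  have "continuous_on UNIV (\<lambda>x. \<Sum>i<n. norm (b x i))"
    by (intro continuous_on_sum continuous_on_norm continuous_on_product_then_coordinatewise[OF b(1)])
  from continuous_attains_sup[OF compact _ this]
  obtain C where C: "\<And>x. (\<Sum>i<n. norm (b x i)) \<le> C"
    by auto
  have C': "norm (b x i) \<le> \<bar>C\<bar> + 1" if "i < n" for x i
    using member_le_sum[of i "{..<n}" "\<lambda>i. norm (b x i)"] C[of x] that by auto
  show ?thesis
  proof (rule that[of "1 / (\<bar>C\<bar> + 1)"])
    fix x v assume v: "v \<in> vecs n" "vdist n (f x) v < 1 / (\<bar>C\<bar> + 1)"
    let ?s = "\<Sum>i<n. b x i * (v i - f x i)"
    have "norm ?s \<le> (\<Sum>i<n. (\<bar>C\<bar> + 1) * norm (f x i - v i))"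
    proof (rule sum_norm_le)
      fix i assume "i \<in> {..<n}"
      then have "norm (b x i) * norm (v i - f x i) \<le> (\<bar>C\<bar> + 1) * norm (v i - f x i)"
        by (intro mult_right_mono C') auto
      then show "norm (b x i * (v i - f x i)) \<le> (\<bar>C\<bar> + 1) * norm (f x i - v i)"
        using norm_mult_ineq[of "b x i" "v i - f x i"] by (simp add: norm_minus_commute)
    qed
    also have "\<dots> = (\<bar>C\<bar> + 1) * vdist n (f x) v"
      by (simp add: vdist_def sum_distrib_left)
    also have "\<dots> < 1"
      using v(2) by (simp add: field_simps)
    finally obtain c where "c * (1 + ?s) = 1"
      using norm_less_one_invertible by blast
    moreover have "1 + ?s = (\<Sum>i<n. b x i * v i)"
      by (simp add: right_diff_distrib sum_subtractf b(2))
    ultimately have "(\<Sum>i<n. (c * b x i) * v i) = 1"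
      by (simp add: sum_distrib_left mult.assoc)
    then show "v \<in> Lg n"
      unfolding Lg_iff using v(1) by (intro conjI exI[of _ "\<lambda>i. c * b x i"])
  qed simp
qed

lemma continuous_on_scaled:
  fixes p :: "'x::topological_space \<Rightarrow> nat \<Rightarrow> real"
  assumes "continuous_on UNIV p"
  shows "continuous_on (UNIV \<times> {0..1}) (\<lambda>z j. snd z * p (fst z) j)"
proof (rule continuous_on_coordinatewise_then_product)
  fix j
  have "continuous_on (UNIV \<times> {0..1::real}) (\<lambda>z :: 'x \<times> real. p (fst z) j)"
    by (rule continuous_on_compose2[OF continuous_on_product_then_coordinatewise[OF assms, of j]])
      (auto intro: continuous_intros)
  then show "continuous_on (UNIV \<times> {0..1}) (\<lambda>z. snd z * p (fst z) j)"
    by (intro continuous_on_mult continuous_on_snd continuous_on_id)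
qed

text \<open>
  Two homotopies are given, since \<open>f\<close> is first moved along segments to the map \<open>f'\<close> that factors
  through the nerve.  The bump functions \<open>p x j\<close> are normalised by \<open>max\<^sub>j p x j = 1\<close> rather than by
  their sum, so that \<open>p x\<close> lies in the base of the cubical cone.
\<close>

lemma Lg_map_nullhomotopic:
  fixes f :: "'x::topological_space \<Rightarrow> nat \<Rightarrow> 'a::unital_cstar_algebra"
  assumes weq: "weak_homotopy_equivalence (top_of_set (GL k :: (nat \<Rightarrow> nat \<Rightarrow> 'a) set))
      (top_of_set (GL (Suc k))) (diag_one k)"
    and trans: "\<And>v :: nat \<Rightarrow> 'a. v \<in> Lg (Suc k) \<Longrightarrow> \<exists>g\<in>GL (Suc k). mat_vec (Suc k) g (last_vec k) = v"
    and compact: "compact (UNIV :: 'x set)" and f: "continuous_on UNIV f" "\<And>x. f x \<in> Lg (Suc k)"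
  obtains f' \<gamma>1 \<gamma>2 where
    "continuous_on (UNIV \<times> {0..1::real}) \<gamma>1" "\<And>x t. 0 \<le> t \<Longrightarrow> t \<le> 1 \<Longrightarrow> \<gamma>1 (x, t) \<in> Lg (Suc k)"
    "\<And>x. \<gamma>1 (x, 0) = f x" "\<And>x. \<gamma>1 (x, 1) = f' x"
    "continuous_on (UNIV \<times> {0..1::real}) \<gamma>2" "\<And>x t. 0 \<le> t \<Longrightarrow> t \<le> 1 \<Longrightarrow> \<gamma>2 (x, t) \<in> Lg (Suc k)"
    "\<And>x. \<gamma>2 (x, 0) = last_vec k" "\<And>x. \<gamma>2 (x, 1) = f' x"
proof -
  let ?m = "Suc k"
  note f_coord = continuous_on_product_then_coordinatewise[OF f(1)]
  obtain r where r: "r > 0" "\<And>x v. v \<in> vecs ?m \<Longrightarrow> vdist ?m (f x) v < r \<Longrightarrow> v \<in> Lg ?m"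
    using Lg_uniform_neighbourhood[OF compact f] by blast
  have cont_d: "continuous_on UNIV (\<lambda>x. vdist ?m (f x) v)" for v
    unfolding vdist_def
    by (intro continuous_on_sum continuous_on_norm continuous_on_diff continuous_on_const f_coord)
  define T where "T y = {x. vdist ?m (f x) (f y) < r / 2}" for y
  have open_T: "open (T y)" if "y \<in> UNIV" for y
    unfolding T_def by (intro open_Collect_less cont_d continuous_on_const)
  have "y \<in> T y" for y
    using r(1) by (simp add: T_def vdist_def)
  then have "UNIV \<subseteq> (\<Union>y\<in>UNIV. T y)"
    by blast
  with compact open_T obtain Y where Y: "Y \<subseteq> UNIV" "finite Y" "UNIV \<subseteq> (\<Union>y\<in>Y. T y)"
    by (rule compactE_image)
  obtain N :: nat and y where Y_eq: "Y = y ` {i. i < N}"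
    using finite_imp_nat_seg_image_inj_on[OF Y(2)] by blast
  define a where "a j = f (y j)" for j
  \<comment> \<open>Linear in the distance and cut off at 0 and 1: it is 1 up to distance r / 2, the
    radius of the cover \<open>T\<close>, and 0 from distance r on.\<close>
  define p where "p x j = (if j < N then min 1 (max 0 (2 - 2 * vdist ?m (f x) (a j) / r)) else 0)"
    for x j
  have p01: "0 \<le> p x j \<and> p x j \<le> 1" for x j
    by (simp add: p_def)
  have p_pos: "j < N \<and> vdist ?m (f x) (a j) < r" if "0 < p x j" for x j
    using that r(1) by (auto simp: p_def less_max_iff_disj divide_less_eq split: if_splits)
  have p_one: "\<exists>j<N. p x j = 1" for x
  proof -
    obtain j where "j < N" "vdist ?m (f x) (a j) < r / 2"
      using Y(3) by (auto simp: Y_eq T_def a_def)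
    then have "p x j = 1"
      using r(1) by (simp add: p_def min_def max_def field_simps)
    then show ?thesis using \<open>j < N\<close> by blast
  qed
  have cont_p: "continuous_on UNIV p"
  proof (rule continuous_on_coordinatewise_then_product)
    have "continuous_on UNIV (\<lambda>x. min 1 (max 0 (2 - 2 * vdist ?m (f x) (a j) / r)))" for j
      using r(1)
      by (intro continuous_on_min continuous_on_max continuous_on_diff continuous_on_divide
          continuous_on_mult continuous_on_const cont_d) auto
    then show "continuous_on UNIV (\<lambda>x. p x j)" for j
      by (cases "j < N") (simp_all add: p_def)
  qed
  \<comment> \<open>The nerve of the cover by the sets where f x is within r of
    \<open>a j\<close>.\<close>
  define K where "K = {\<sigma>. \<sigma> \<subseteq> {..<N} \<and> (\<exists>x. \<forall>j\<in>\<sigma>. vdist ?m (f x) (a j) < r)}"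
  have K_fin: "finite K"
    by (rule finite_subset[of _ "Pow {..<N}"]) (auto simp: K_def)
  have K_elem_fin: "finite \<sigma>" if "\<sigma> \<in> K" for \<sigma>
    using that by (auto simp: K_def intro: finite_subset)
  have K_down: "\<tau> \<in> K" if "\<sigma> \<in> K" "\<tau> \<subseteq> \<sigma>" for \<sigma> \<tau>
    using that by (fastforce simp: K_def)
  define s where "s q = (\<Sum>j<N. q j)" for q :: "nat \<Rightarrow> real"
  \<comment> \<open>Dividing by the coordinate sum turns a point of the cone base into barycentric
    coordinates, so \<open>g\<close> is the affine map sending vertex j of the nerve to
    \<open>a j\<close>.\<close>
  define g where "g q i = (\<Sum>j<N. (q j / s q) *\<^sub>R a j i)" for q i
  have base: "\<exists>\<sigma>\<in>K. q \<in> fcube \<sigma>" "s q > 0" "\<And>j. 0 \<le> q j" if q: "q \<in> cone_base K" for q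
  proof -
    show *: "\<exists>\<sigma>\<in>K. q \<in> fcube \<sigma>"
      using q by (auto simp: cone_base_def)
    show nn: "0 \<le> q j" for j
      using * by (cases "q j = 0") (auto simp: fcube_def)
    obtain i where "i < N" "q i = 1"
      using q by (auto simp: cone_base_def K_def)
    then show "s q > 0"
      unfolding s_def by (intro sum_pos2[of _ i]) (auto simp: nn)
  qed
  have g_near: "vdist ?m (f x) (g q) < r"
    if "q \<in> cone_base K" "\<And>j. j < N \<Longrightarrow> 0 < q j \<Longrightarrow> vdist ?m (f x) (a j) < r" for q x
    unfolding g_def
  proof (rule vdist_convex_combination)
    show "(\<Sum>j<N. q j / s q) = 1"
      using base(2)[OF that(1)] by (simp add: s_def flip: sum_divide_distrib)
    show "0 \<le> q j / s q" for j
      using base(2,3)[OF that(1)] by (simp add: less_imp_le)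
    show "vdist ?m (f x) (a j) < r" if "j < N" "0 < q j / s q" for j
    proof -
      have "0 < q j"
        using that(2) base(2)[OF \<open>q \<in> cone_base K\<close>] by (simp add: zero_less_divide_iff)
      then show ?thesis
        using \<open>\<And>j. j < N \<Longrightarrow> 0 < q j \<Longrightarrow> vdist ?m (f x) (a j) < r\<close> that(1) by blast
    qed
  qed
  have g_vecs: "g q \<in> vecs ?m" for q
    using Lg_vecs[OF f(2)] by (auto simp: vecs_def g_def a_def)
  \<comment> \<open>The vertices of a simplex of the nerve are all within r of one common value f x;
    hence so is their convex combination.\<close>
  have g_Lg: "g q \<in> Lg ?m" if q: "q \<in> cone_base K" for q
  proof -
    obtain \<sigma> x where \<sigma>: "q \<in> fcube \<sigma>" "\<And>j. j \<in> \<sigma> \<Longrightarrow> vdist ?m (f x) (a j) < r"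
      using base(1)[OF q] by (auto simp: K_def)
    have "vdist ?m (f x) (a j) < r" if "0 < q j" for j
    proof -
      have "j \<in> \<sigma>"
        using \<sigma>(1) that by (cases "j \<in> \<sigma>") (auto simp: fcube_def)
      then show ?thesis by (rule \<sigma>(2))
    qed
    then show ?thesis
      by (intro r(2)[OF g_vecs g_near[OF q]])
  qed
  have cont_g: "continuous_on (cone_base K) g"
  proof (rule continuous_on_coordinatewise_then_product)
    show "continuous_on (cone_base K) (\<lambda>q. g q i)" for i
      unfolding g_def s_def using base(2)
      by (intro continuous_on_sum continuous_on_scaleR continuous_on_divide continuous_on_coordinate
          continuous_on_const) (force simp: s_def)
  qed
  note ext = Lg_extend_from_fboundary[OF weq trans]
  have "\<exists>H. continuous_on (\<Union>\<sigma>\<in>K. fcube \<sigma>) H \<and> (\<forall>q\<in>\<Union>\<sigma>\<in>K. fcube \<sigma>. H q \<in> Lg ?m) \<and>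
      (\<forall>q\<in>cone_base K. H q = g q) \<and> H (\<lambda>_. 0) = last_vec k"
    by (rule extend_over_cone[OF ext last_vec_Lg K_fin K_elem_fin K_down cont_g g_Lg]) auto
  then obtain H where H: "continuous_on (\<Union>\<sigma>\<in>K. fcube \<sigma>) H" "\<forall>q\<in>\<Union>\<sigma>\<in>K. fcube \<sigma>. H q \<in> Lg ?m"
    "\<forall>q\<in>cone_base K. H q = g q" "H (\<lambda>_. 0) = last_vec k"
    by blast
  have cone: "(\<lambda>j. t * p x j) \<in> (\<Union>\<sigma>\<in>K. fcube \<sigma>)" if "0 \<le> t" "t \<le> 1" for x t
  proof -
    let ?\<sigma> = "{j. j < N \<and> vdist ?m (f x) (a j) < r}"
    have "?\<sigma> \<in> K"
      by (auto simp: K_def)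
    moreover have "p x j = 0" if "j \<notin> ?\<sigma>" for j
      using p_pos[of x j] p01[of x j] that by force
    then have "(\<lambda>j. t * p x j) \<in> fcube ?\<sigma>"
      using that p01 by (auto simp: fcube_def mult_le_one)
    ultimately show ?thesis by blast
  qed
  have p_base: "p x \<in> cone_base K" for x
  proof -
    obtain j where j: "j < N" "p x j = 1"
      using p_one by blast
    have "{j} \<in> K"
      using j p_pos[of x j] by (auto simp: K_def)
    then show ?thesis
      using cone[of 1 x] j unfolding cone_base_def by auto
  qed
  define \<gamma>1 where "\<gamma>1 = (\<lambda>(x, t) i. (1 - t) *\<^sub>R f x i + t *\<^sub>R g (p x) i)"
  \<comment> \<open>Scaling moves p x from the apex, where \<open>H\<close> is the basis vector, to
    the base, where \<open>H\<close> is \<open>g\<close>.\<close>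
  define \<gamma>2 where "\<gamma>2 = (\<lambda>(x, t). H (\<lambda>j. t * p x j))"
  show ?thesis
  proof (rule that[of \<gamma>1 "\<lambda>x. g (p x)" \<gamma>2])
    have gp: "continuous_on UNIV (\<lambda>x. g (p x) i)" for i
      by (rule continuous_on_compose2[OF continuous_on_product_then_coordinatewise[OF cont_g, of i] cont_p])
        (use p_base in blast)
    have comp: "continuous_on (UNIV \<times> {0..1::real}) (\<lambda>z. h (fst z))" if "continuous_on UNIV h"
      for h :: "'x \<Rightarrow> 'a"
      by (rule continuous_on_compose2[OF that]) (auto intro: continuous_intros)
    show "continuous_on (UNIV \<times> {0..1}) \<gamma>1"
      unfolding \<gamma>1_def case_prod_unfold
      by (intro continuous_on_coordinatewise_then_product continuous_on_add continuous_on_scaleR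
          continuous_on_diff continuous_on_const continuous_on_snd continuous_on_id comp gp f_coord)
    show "\<gamma>1 (x, t) \<in> Lg ?m" if t: "0 \<le> t" "t \<le> 1" for x t
    proof (rule r(2)[of _ x])
      show "\<gamma>1 (x, t) \<in> vecs ?m"
        using Lg_vecs[OF f(2)[of x]] g_vecs[of "p x"] by (auto simp: \<gamma>1_def vecs_def)
      have "f x i - \<gamma>1 (x, t) i = t *\<^sub>R (f x i - g (p x) i)" for i
        by (simp add: \<gamma>1_def algebra_simps)
      then have "vdist ?m (f x) (\<gamma>1 (x, t)) = t * vdist ?m (f x) (g (p x))"
        unfolding vdist_def using t(1) by (simp only: norm_scaleR sum_distrib_left abs_of_nonneg)
      also have "\<dots> \<le> 1 * vdist ?m (f x) (g (p x))"
        using t by (intro mult_right_mono vdist_nonneg)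
      also have "\<dots> < r"
        using g_near[OF p_base, of x x] p_pos by simp
      finally show "vdist ?m (f x) (\<gamma>1 (x, t)) < r" .
    qed
    have "continuous_on (UNIV \<times> {0..1}) (\<lambda>z. H (\<lambda>j. snd z * p (fst z) j))"
      by (rule continuous_on_compose2[OF H(1) continuous_on_scaled[OF cont_p]]) (use cone in auto)
    then show "continuous_on (UNIV \<times> {0..1}) \<gamma>2"
      by (simp add: \<gamma>2_def case_prod_unfold)
    show "\<gamma>2 (x, t) \<in> Lg ?m" if "0 \<le> t" "t \<le> 1" for x t
      unfolding \<gamma>2_def prod.case by (rule bspec[OF H(2) cone[OF that]])
    show "\<gamma>2 (x, 1) = g (p x)" for x
      using H(3) p_base by (simp add: \<gamma>2_def)
  qed (simp_all add: \<gamma>1_def \<gamma>2_def H(4))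
qed

section \<open>Matrices over \<open>C(X, A)\<close>\<close>

lemma apply_sum_bcontfun:
  "apply_bcontfun (\<Sum>i\<in>I. h i) x = (\<Sum>i\<in>I. apply_bcontfun (h i) x)"
  for h :: "'i \<Rightarrow> 'x::topological_space \<Rightarrow>\<^sub>C 'a::unital_cstar_algebra"
  by (induction I rule: infinite_finite_induct) auto

lemmas apply_bcontfun_simps = apply_sum_bcontfun apply_times_bcontfun apply_one_bcontfun

definition eval_mat ::
    "'x::topological_space \<Rightarrow> (nat \<Rightarrow> nat \<Rightarrow> 'x \<Rightarrow>\<^sub>C 'a) \<Rightarrow> nat \<Rightarrow> nat \<Rightarrow> 'a::unital_cstar_algebra" where
  "eval_mat x g i j = apply_bcontfun (g i j) x"

definition eval_vec ::
    "'x::topological_space \<Rightarrow> (nat \<Rightarrow> 'x \<Rightarrow>\<^sub>C 'a) \<Rightarrow> nat \<Rightarrow> 'a::unital_cstar_algebra" where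
  "eval_vec x v i = apply_bcontfun (v i) x"

lemma eval_mat_eqI: "(\<And>x. eval_mat x g = eval_mat x h) \<Longrightarrow> g = h"
  by (auto simp: eval_mat_def fun_eq_iff intro: bcontfun_eqI)

lemma eval_vec_eqI: "(\<And>x. eval_vec x v = eval_vec x w) \<Longrightarrow> v = w"
  by (auto simp: eval_vec_def fun_eq_iff intro: bcontfun_eqI)

lemma eval_mat_mult: "eval_mat x (mat_mult n g h) = mat_mult n (eval_mat x g) (eval_mat x h)"
  by (simp add: eval_mat_def mat_mult_def apply_bcontfun_simps fun_eq_iff)

lemma eval_mat_vec: "eval_vec x (mat_vec n g v) = mat_vec n (eval_mat x g) (eval_vec x v)"
  by (simp add: eval_mat_def eval_vec_def mat_vec_def apply_bcontfun_simps fun_eq_iff)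

lemma eval_mat_id: "eval_mat x (mat_id n) = mat_id n"
  by (simp add: eval_mat_def mat_id_def apply_bcontfun_simps fun_eq_iff)

lemma eval_mat_mats: "g \<in> mats n \<Longrightarrow> eval_mat x g \<in> mats n"
  by (simp add: eval_mat_def mats_def)

lemma eval_mat_GL:
  assumes "g \<in> GL n"
  shows "eval_mat x g \<in> GL n"
proof -
  obtain h where h: "h \<in> mats n" "mat_mult n g h = mat_id n" "mat_mult n h g = mat_id n"
    using assms by (auto simp: GL_def)
  then have "mat_mult n (eval_mat x g) (eval_mat x h) = mat_id n"
    "mat_mult n (eval_mat x h) (eval_mat x g) = mat_id n"
    by (simp_all add: eval_mat_id flip: eval_mat_mult)
  then show ?thesis
    unfolding GL_def using eval_mat_mats[OF GL_mats[OF assms]] eval_mat_mats[OF h(1)] by blast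
qed

lemma eval_vec_Lg:
  assumes "v \<in> Lg n"
  shows "eval_vec x v \<in> Lg n"
proof -
  obtain b where b: "(\<Sum>i<n. b i * v i) = 1"
    using assms by (auto simp: Lg_iff)
  have "(\<Sum>i<n. apply_bcontfun (b i) x * eval_vec x v i) = 1"
    using arg_cong[OF b, of "\<lambda>h. apply_bcontfun h x"]
    by (simp add: eval_vec_def apply_bcontfun_simps)
  moreover have "eval_vec x v \<in> vecs n"
    using Lg_vecs[OF assms] by (simp add: vecs_def eval_vec_def)
  ultimately show ?thesis
    unfolding Lg_iff by (intro conjI exI[of _ "\<lambda>i. apply_bcontfun (b i) x"])
qed

lemma continuous_on_eval_mat: "continuous_on UNIV (\<lambda>x. eval_mat x g)"
proof (intro continuous_on_coordinatewise_then_product)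
  show "continuous_on UNIV (\<lambda>x. eval_mat x g i j)" for i j
    unfolding eval_mat_def by simp
qed

lemma continuous_on_eval_vec: "continuous_on UNIV (\<lambda>x. eval_vec x v)"
proof (intro continuous_on_coordinatewise_then_product)
  show "continuous_on UNIV (\<lambda>x. eval_vec x v i)" for i
    unfolding eval_vec_def by simp
qed

lemma continuous_on_eval_at: "continuous_on S (\<lambda>g. eval_mat x g)"
proof (intro continuous_on_coordinatewise_then_product)
  fix i j
  have "continuous_on UNIV (\<lambda>f :: 'a \<Rightarrow>\<^sub>C 'b. apply_bcontfun f x)"
  proof (rule continuous_onI)
    show "\<exists>d>0. \<forall>f'\<in>UNIV. dist f' f < d \<longrightarrow> dist (apply_bcontfun f' x) (apply_bcontfun f x) \<le> e"
      if "e > 0" for f :: "'a \<Rightarrow>\<^sub>C 'b" and e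
      by (intro exI[of _ e] conjI ballI impI that less_imp_le[OF dist_fun_lt_imp_dist_val_lt])
  qed
  then show "continuous_on S (\<lambda>g. eval_mat x g i j)"
    unfolding eval_mat_def
    by (rule continuous_on_compose2[OF _ continuous_on_entry[OF continuous_on_id]]) simp
qed

lemma eval_mat_Bcontfun:
  assumes "compact (UNIV :: 'x::topological_space set)" "continuous_on UNIV F"
  shows "eval_mat (x :: 'x) (\<lambda>i j. Bcontfun (\<lambda>x. F x i j)) = F x"
  using compact_bcontfun[OF assms(1) continuous_on_entry[OF assms(2)]]
  by (simp add: eval_mat_def fun_eq_iff Bcontfun_inverse)

text \<open>The pointwise inverses depend continuously on x, so they form a matrix over C(X,
  A).\<close>

lemma GL_eval_mat:
  fixes g :: "nat \<Rightarrow> nat \<Rightarrow> 'x::topological_space \<Rightarrow>\<^sub>C 'a::unital_cstar_algebra"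
  assumes compact: "compact (UNIV :: 'x set)" and GL: "\<And>x. eval_mat x g \<in> GL n"
  shows "g \<in> GL n"
proof -
  define h where "h = (\<lambda>i j. Bcontfun (\<lambda>x. minv n (eval_mat x g) i j))"
  have h: "eval_mat x h = minv n (eval_mat x g)" for x
    unfolding h_def
    by (intro eval_mat_Bcontfun[OF compact] continuous_on_minv continuous_on_eval_mat GL)
  have mats: "g' \<in> mats n" if "\<And>x. eval_mat x g' \<in> mats n" for g' :: "nat \<Rightarrow> nat \<Rightarrow> 'x \<Rightarrow>\<^sub>C 'a"
    using that unfolding mats_def eval_mat_def by (auto intro!: bcontfun_eqI)
  have "mat_mult n g h = mat_id n" "mat_mult n h g = mat_id n"
    by (rule eval_mat_eqI, simp add: eval_mat_mult eval_mat_id h minv[OF GL])+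
  moreover have "g \<in> mats n" "h \<in> mats n"
    using GL_mats[OF GL] minv(1)[OF GL] by (auto intro!: mats simp: h)
  ultimately show ?thesis
    unfolding GL_def by blast
qed

section \<open>From homotopies over X to paths over C(X, A)\<close>

lemma continuous_on_curry_bcontfun:
  fixes G :: "'x::topological_space \<times> real \<Rightarrow> 'a::real_normed_vector"
  assumes compact: "compact (UNIV :: 'x set)" and G: "continuous_on (UNIV \<times> {0..1}) G"
  shows "continuous_on {0..1} (\<lambda>t. Bcontfun (\<lambda>x. G (x, t)))"
proof (rule continuous_onI)
  fix t e assume t: "t \<in> {0..1::real}" and e: "(e::real) > 0"
  have cont: "continuous_on ({0..1} \<times> UNIV) (\<lambda>p. G (snd p, fst p))"
    by (rule continuous_on_compose2[OF G]) (auto intro!: continuous_intros)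
  \<comment> \<open>Compactness of X makes joint continuity uniform in x, which is continuity in t
    for the supremum norm.\<close>
  obtain V where "t \<in> V" "open V"
    "\<forall>u\<in>V \<inter> {0..1}. \<forall>x\<in>UNIV. dist (G (snd (u, x), fst (u, x))) (G (snd (t, x), fst (t, x))) \<le> e"
    by (rule continuous_on_prod_compactE[OF cont compact t e]) blast
  then have V: "t \<in> V" "open V" "\<And>u x. u \<in> V \<inter> {0..1} \<Longrightarrow> dist (G (x, u)) (G (x, t)) \<le> e"
    by simp_all
  then obtain d where d: "d > 0" "ball t d \<subseteq> V"
    using open_contains_ball by blast
  have app: "apply_bcontfun (Bcontfun (\<lambda>x. G (x, u))) x = G (x, u)" if "u \<in> {0..1}" for u x
  proof -
    have "continuous_on UNIV (\<lambda>x. G (x, u))"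
      by (rule continuous_on_compose2[OF G]) (use that in \<open>auto intro!: continuous_intros\<close>)
    then show ?thesis
      by (simp add: Bcontfun_inverse compact_bcontfun[OF compact])
  qed
  have "dist (Bcontfun (\<lambda>x. G (x, u))) (Bcontfun (\<lambda>x. G (x, t))) \<le> e"
    if "u \<in> {0..1}" "dist u t < d" for u
  proof (rule dist_bound)
    show "dist (apply_bcontfun (Bcontfun (\<lambda>x. G (x, u))) x)
        (apply_bcontfun (Bcontfun (\<lambda>x. G (x, t))) x) \<le> e" for x
      unfolding app[OF that(1)] app[OF t] using that d(2)
      by (intro V(3)) (auto simp: dist_commute)
  qed
  then show "\<exists>d>0. \<forall>u\<in>{0..1}. dist u t < d \<longrightarrow>
      dist (Bcontfun (\<lambda>x. G (x, u))) (Bcontfun (\<lambda>x. G (x, t))) \<le> e"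
    using d(1) by blast
qed

text \<open>Lifting produces paths; they multiply and invert pointwise, so this path component is a
  group, and it is contained in \<open>GL0 n\<close>.\<close>

abbreviation GLp :: "nat \<Rightarrow> (nat \<Rightarrow> nat \<Rightarrow> 'a::unital_cstar_algebra) set" where
  "GLp n \<equiv> path_component_set (GL n) (mat_id n)"

lemma GLp_GL: "g \<in> GLp n \<Longrightarrow> g \<in> GL n"
  using path_component_subset by blast

lemma GLp_GL0: "g \<in> GLp n \<Longrightarrow> g \<in> GL0 n"
  unfolding GL0_def using path_component_subset_connected_component by blast

lemma GLp_mult:
  assumes "g \<in> GLp n" "h \<in> GLp n"
  shows "mat_mult n g h \<in> GLp n"
proof -
  obtain p q where p: "path p" "path_image p \<subseteq> GL n" "pathstart p = mat_id n" "pathfinish p = g"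
    and q: "path q" "path_image q \<subseteq> GL n" "pathstart q = mat_id n" "pathfinish q = h"
    using assms by (auto simp: path_component_def)
  have "path (\<lambda>t. mat_mult n (p t) (q t))"
    using p(1) q(1) unfolding path_def by (rule continuous_on_mat_mult)
  moreover have "path_image (\<lambda>t. mat_mult n (p t) (q t)) \<subseteq> GL n"
    using p(2) q(2) by (auto simp: path_image_def intro!: mat_mult_GL)
  ultimately have "path_component (GL n) (mat_id n) (mat_mult n g h)"
    unfolding path_component_def using p(3,4) q(3,4)
    by (intro exI[of _ "\<lambda>t. mat_mult n (p t) (q t)"]) (auto simp: pathstart_def pathfinish_def)
  then show ?thesis by simp
qed

lemma GLp_minv:
  assumes "g \<in> GLp n"
  shows "minv n g \<in> GLp n"
proof -
  obtain p where p: "path p" "path_image p \<subseteq> GL n" "pathstart p = mat_id n" "pathfinish p = g"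
    using assms by (auto simp: path_component_def)
  have "path (\<lambda>t. minv n (p t))"
    using p(1,2) unfolding path_def path_image_def by (intro continuous_on_minv) auto
  moreover have "path_image (\<lambda>t. minv n (p t)) \<subseteq> GL n"
    using p(2) by (auto simp: path_image_def intro!: minv_GL)
  ultimately have "path_component (GL n) (mat_id n) (minv n g)"
    unfolding path_component_def using p(3,4)
    by (intro exI[of _ "\<lambda>t. minv n (p t)"]) (auto simp: pathstart_def pathfinish_def)
  then show ?thesis by simp
qed

text \<open>The lift G of \<gamma> is read as the path t \<mapsto> G(-, t) of matrices over C(X, A).
  It starts at the identity, and its end carries v to w.\<close>

lemma GLp_homotopy:
  fixes \<gamma> :: "'x::topological_space \<times> real \<Rightarrow> nat \<Rightarrow> 'a::unital_cstar_algebra"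
  assumes compact: "compact (UNIV :: 'x set)"
    and \<gamma>: "continuous_on (UNIV \<times> {0..1}) \<gamma>" "\<And>x t. 0 \<le> t \<Longrightarrow> t \<le> 1 \<Longrightarrow> \<gamma> (x, t) \<in> Lg n"
    and v: "\<And>x. eval_vec x v = \<gamma> (x, 0)" and w: "\<And>x. eval_vec x w = \<gamma> (x, 1)"
  shows "\<exists>g\<in>GLp n. mat_vec n g v = w"
proof -
  obtain G where G: "continuous_on (UNIV \<times> {0..1}) G"
    "\<And>x t. 0 \<le> t \<Longrightarrow> t \<le> 1 \<Longrightarrow> G (x, t) \<in> GL n" "\<And>x. G (x, 0) = mat_id n"
    "\<And>x t. 0 \<le> t \<Longrightarrow> t \<le> 1 \<Longrightarrow> mat_vec n (G (x, t)) (\<gamma> (x, 0)) = \<gamma> (x, t)"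
    using lift_Lg_homotopy[OF compact \<gamma>] by auto
  define g where "g t = (\<lambda>i j. Bcontfun (\<lambda>x. G (x, t) i j))" for t
  have g: "eval_mat x (g t) = G (x, t)" if "0 \<le> t" "t \<le> 1" for x t
    unfolding g_def
  proof (rule eval_mat_Bcontfun[OF compact])
    show "continuous_on UNIV (\<lambda>x. G (x, t))"
      by (rule continuous_on_compose2[OF G(1)]) (use that in \<open>auto intro!: continuous_intros\<close>)
  qed
  have "path g"
    unfolding path_def g_def
    by (intro continuous_on_coordinatewise_then_product continuous_on_curry_bcontfun[OF compact]
        continuous_on_entry[OF G(1)])
  moreover have "path_image g \<subseteq> GL n"
    using g G(2) by (auto simp: path_image_def intro!: GL_eval_mat[OF compact])
  moreover have "g 0 = mat_id n"
    by (rule eval_mat_eqI) (simp add: g G(3) eval_mat_id)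
  ultimately have "path_component (GL n) (mat_id n) (g 1)"
    unfolding path_component_def by (intro exI[of _ g]) (auto simp: pathstart_def pathfinish_def)
  moreover have "mat_vec n (g 1) v = w"
    by (rule eval_vec_eqI) (simp add: eval_mat_vec g v w G(4))
  ultimately show ?thesis by auto
qed

section \<open>Transitivity over \<open>A\<close> and over \<open>C(X, A)\<close>\<close>

lemma acts_transitively_C:
  assumes weq: "weak_homotopy_equivalence (top_of_set (GL k :: (nat \<Rightarrow> nat \<Rightarrow> 'a) set))
      (top_of_set (GL (Suc k))) (diag_one k)"
    and compact: "compact (UNIV :: 'x::topological_space set)"
    and trans: "acts_transitively (Suc k) (GL (Suc k)) (Lg (Suc k) :: (nat \<Rightarrow> 'a::unital_cstar_algebra) set)"
  shows "acts_transitively (Suc k) (GL0 (Suc k)) (Lg (Suc k) :: (nat \<Rightarrow> 'x \<Rightarrow>\<^sub>C 'a) set)"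
proof -
  let ?m = "Suc k"
  have trans': "\<exists>g\<in>GL ?m. mat_vec ?m g (last_vec k) = v" if "v \<in> Lg ?m" for v :: "nat \<Rightarrow> 'a"
    using trans that last_vec_Lg by (auto simp: acts_transitively_def)
  let ?e = "last_vec k :: nat \<Rightarrow> 'x \<Rightarrow>\<^sub>C 'a"
  have e: "eval_vec x ?e = last_vec k" for x
    by (simp add: eval_vec_def last_vec_def fun_eq_iff apply_one_bcontfun)
  have orbit: "\<exists>g\<in>GLp ?m. mat_vec ?m g ?e = v" if v: "v \<in> Lg ?m" for v :: "nat \<Rightarrow> 'x \<Rightarrow>\<^sub>C 'a"
  proof -
    obtain f' \<gamma>1 \<gamma>2 where
      \<gamma>1: "continuous_on (UNIV \<times> {0..1::real}) \<gamma>1" "\<And>x t. 0 \<le> t \<Longrightarrow> t \<le> 1 \<Longrightarrow> \<gamma>1 (x, t) \<in> Lg ?m"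
        "\<And>x. \<gamma>1 (x, 0) = eval_vec x v" "\<And>x. \<gamma>1 (x, 1) = f' x"
      and \<gamma>2: "continuous_on (UNIV \<times> {0..1::real}) \<gamma>2" "\<And>x t. 0 \<le> t \<Longrightarrow> t \<le> 1 \<Longrightarrow> \<gamma>2 (x, t) \<in> Lg ?m"
        "\<And>x. \<gamma>2 (x, 0) = last_vec k" "\<And>x. \<gamma>2 (x, 1) = f' x"
      by (rule Lg_map_nullhomotopic[OF weq trans' compact continuous_on_eval_vec eval_vec_Lg[OF v]]) blast+
    define w where "w = (\<lambda>i. Bcontfun (\<lambda>x. f' x i))"
    have "continuous_on UNIV (\<lambda>x. \<gamma>1 (x, 1))"
      by (rule continuous_on_compose2[OF \<gamma>1(1)]) (auto intro!: continuous_intros)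
    then have "continuous_on UNIV (\<lambda>x. f' x i)" for i
      unfolding \<gamma>1(4) by (rule continuous_on_product_then_coordinatewise)
    then have w: "eval_vec x w = f' x" for x
      by (simp add: eval_vec_def w_def fun_eq_iff Bcontfun_inverse compact_bcontfun[OF compact])
    obtain g where g: "g \<in> GLp ?m" "mat_vec ?m g v = w"
      using GLp_homotopy[OF compact \<gamma>1(1,2), of v w] \<gamma>1(3,4) w by auto
    obtain h where h: "h \<in> GLp ?m" "mat_vec ?m h ?e = w"
      using GLp_homotopy[OF compact \<gamma>2(1,2), of ?e w] \<gamma>2(3,4) w e by auto
    \<comment> \<open>The vector v and the basis vector are both moved to the same w, so one motion
      followed by the inverse of the other joins them.\<close>
    have "mat_vec ?m (mat_mult ?m (minv ?m g) h) ?e = v"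
      using mat_vec_minv(1)[OF GLp_GL[OF g(1)] Lg_vecs[OF v]] by (simp add: mat_vec_mult h g)
    then show ?thesis
      using GLp_mult[OF GLp_minv[OF g(1)] h(1)] by blast
  qed
  show ?thesis
    unfolding acts_transitively_def
  proof (intro ballI)
    fix v w :: "nat \<Rightarrow> 'x \<Rightarrow>\<^sub>C 'a" assume "v \<in> Lg ?m" "w \<in> Lg ?m"
    then obtain g h where g: "g \<in> GLp ?m" "mat_vec ?m g ?e = v" and h: "h \<in> GLp ?m" "mat_vec ?m h ?e = w"
      using orbit by metis
    have "mat_vec ?m (mat_mult ?m h (minv ?m g)) v = w"
      using mat_vec_minv(1)[OF GLp_GL[OF g(1)] Lg_vecs[OF last_vec_Lg]]
      by (simp add: mat_vec_mult h(2) flip: g(2))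
    then show "\<exists>g\<in>GL0 ?m. mat_vec ?m g v = w"
      using GLp_GL0[OF GLp_mult[OF h(1) GLp_minv[OF g(1)]]] by blast
  qed
qed

lemma GL0_subset_GL: "GL0 n \<subseteq> GL n"
  unfolding GL0_def by (rule connected_component_subset)

lemma acts_transitively_GL0_GL:
  "acts_transitively n (GL0 n) V \<Longrightarrow> acts_transitively n (GL n) V"
  unfolding acts_transitively_def using GL0_subset_GL by blast

lemma eval_mat_GL0:
  assumes "g \<in> GL0 n"
  shows "eval_mat x g \<in> GL0 n"
proof -
  obtain S where S: "connected S" "S \<subseteq> GL n" "mat_id n \<in> S" "g \<in> S"
    using assms by (auto simp: GL0_def connected_component_def)
  have "connected (eval_mat x ` S)"
    by (intro connected_continuous_image continuous_on_eval_at S)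
  moreover have "eval_mat x ` S \<subseteq> GL n"
    using S(2) eval_mat_GL by blast
  moreover have "mat_id n \<in> eval_mat x ` S"
    using S(3) eval_mat_id by (metis imageI)
  ultimately show ?thesis
    using S(4) unfolding GL0_def connected_component_def by blast
qed

text \<open>Vectors over A are lifted to constant functions; a matrix relating the lifts relates the
  originals after evaluation at any point.\<close>

lemma acts_transitively_eval:
  fixes G :: "(nat \<Rightarrow> nat \<Rightarrow> 'x::topological_space \<Rightarrow>\<^sub>C 'a::unital_cstar_algebra) set"
  assumes trans: "acts_transitively n G (Lg n)" and G': "\<And>g (x::'x). g \<in> G \<Longrightarrow> eval_mat x g \<in> G'"
  shows "acts_transitively n G' (Lg n)"
  unfolding acts_transitively_def
proof (intro ballI)
  fix v w :: "nat \<Rightarrow> 'a" assume vw: "v \<in> Lg n" "w \<in> Lg n"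
  define c where "c u i = (const_bcontfun (u i) :: 'x \<Rightarrow>\<^sub>C 'a)" for u :: "nat \<Rightarrow> 'a" and i :: nat
  have c: "eval_vec x (c u) = u" for x u
    by (simp add: eval_vec_def c_def fun_eq_iff)
  have c_Lg: "c u \<in> Lg n" if u: "u \<in> Lg n" for u
  proof -
    obtain b where "(\<Sum>i<n. b i * u i) = 1"
      using u by (auto simp: Lg_iff)
    then have "(\<Sum>i<n. c b i * c u i) = 1"
      by (intro bcontfun_eqI) (simp add: apply_bcontfun_simps c_def)
    moreover have "c u \<in> vecs n"
      using Lg_vecs[OF u] by (auto simp: vecs_def c_def intro: bcontfun_eqI)
    ultimately show ?thesis
      unfolding Lg_iff by blast
  qed
  obtain g where g: "g \<in> G" "mat_vec n g (c v) = c w"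
    using trans c_Lg[OF vw(1)] c_Lg[OF vw(2)] unfolding acts_transitively_def by blast
  have "mat_vec n (eval_mat x g) v = w" for x
    using eval_mat_vec[of x n g "c v"] by (simp add: g(2) c)
  then show "\<exists>g\<in>G'. mat_vec n g v = w"
    using G'[OF g(1)] by blast
qed

lemma acts_transitively_one_C:
  assumes compact: "compact (UNIV :: 'x::topological_space set)"
    and trans: "acts_transitively 1 (GL 1) (Lg 1 :: (nat \<Rightarrow> 'a::unital_cstar_algebra) set)"
  shows "acts_transitively 1 (GL 1) (Lg 1 :: (nat \<Rightarrow> 'x \<Rightarrow>\<^sub>C 'a) set)"
proof -
  let ?e = "last_vec 0 :: nat \<Rightarrow> 'x \<Rightarrow>\<^sub>C 'a"
  have orbit: "\<exists>g\<in>GL 1. mat_vec 1 g ?e = v" if v: "v \<in> Lg 1" for v :: "nat \<Rightarrow> 'x \<Rightarrow>\<^sub>C 'a"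
  proof -
    define V where "V i j = (if i = 0 \<and> j = 0 then v 0 else 0)" for i j :: nat
    have "eval_mat x V \<in> GL 1" for x
    \<comment> \<open>A 1 by 1 matrix carrying 1 to the value of v at x has that value as its only
      entry, so the value is invertible.\<close>
    proof -
      have "(last_vec 0 :: nat \<Rightarrow> 'a) \<in> Lg 1"
        using last_vec_Lg[of 0] by simp
      then obtain g where g: "g \<in> GL 1" "mat_vec 1 g (last_vec 0) = eval_vec x v"
        using trans eval_vec_Lg[OF v, of x] by (auto simp: acts_transitively_def)
      have "g 0 0 = eval_vec x v 0"
        using mat_vec_last_vec[of 0 g 0] g(2) by simp
      then have "eval_mat x V = g"
        using GL_mats[OF g(1)] by (auto simp: eval_mat_def eval_vec_def V_def mats_def fun_eq_iff)
      then show ?thesis using g(1) by simp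
    qed
    then have "V \<in> GL 1"
      by (rule GL_eval_mat[OF compact])
    moreover have "mat_vec 1 V ?e = v"
    proof
      show "mat_vec 1 V ?e i = v i" for i
        using mat_vec_last_vec[of 0 V i] Lg_vecs[OF v] by (auto simp: V_def vecs_def)
    qed
    ultimately show ?thesis by blast
  qed
  show ?thesis
    unfolding acts_transitively_def
  proof (intro ballI)
    fix v w :: "nat \<Rightarrow> 'x \<Rightarrow>\<^sub>C 'a" assume "v \<in> Lg 1" "w \<in> Lg 1"
    then obtain g h where g: "g \<in> GL 1" "mat_vec 1 g ?e = v" and h: "h \<in> GL 1" "mat_vec 1 h ?e = w"
      using orbit by metis
    have "?e \<in> vecs 1"
      using Lg_vecs[OF last_vec_Lg, of 0] by simp
    then have "mat_vec 1 (mat_mult 1 h (minv 1 g)) v = w"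
      using mat_vec_minv(1)[OF g(1)] by (simp add: mat_vec_mult h(2) del: One_nat_def flip: g(2))
    then show "\<exists>g\<in>GL 1. mat_vec 1 g v = w"
      using mat_mult_GL[OF h(1) minv_GL[OF g(1)]] by blast
  qed
qed

theorem theorem3p11:
  assumes "\<And>m. m \<ge> 2 \<Longrightarrow>
      weak_homotopy_equivalence
        (top_of_set (GL (m - 1) :: (nat \<Rightarrow> nat \<Rightarrow> 'a::unital_cstar_algebra) set))
        (top_of_set (GL m)) (diag_one (m - 1))"
    and "compact (UNIV :: 'x::t2_space set)"
  shows "gsr TYPE('x \<Rightarrow>\<^sub>C 'a) = gsr TYPE('a) \<and>
    (csr TYPE('a) \<ge> 2 \<longrightarrow> csr TYPE('x \<Rightarrow>\<^sub>C 'a) = csr TYPE('a)) \<and>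
    (csr TYPE('a) = 1 \<longrightarrow> csr TYPE('x \<Rightarrow>\<^sub>C 'a) \<in> {1, 2})"
proof -
  let ?TA = "\<lambda>m. acts_transitively m (GL m) (Lg m :: (nat \<Rightarrow> 'a) set)"
  let ?TC = "\<lambda>m. acts_transitively m (GL m) (Lg m :: (nat \<Rightarrow> 'x \<Rightarrow>\<^sub>C 'a) set)"
  let ?PA = "\<lambda>m. acts_transitively m (GL0 m) (Lg m :: (nat \<Rightarrow> 'a) set)"
  let ?PC = "\<lambda>m. acts_transitively m (GL0 m) (Lg m :: (nat \<Rightarrow> 'x \<Rightarrow>\<^sub>C 'a) set)"
  have core: "?PC m" if m2: "m \<ge> 2" and TA: "?TA m" for m
  proof -
    obtain k where m: "m = Suc k"
      using m2 by (cases m) auto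
    show ?thesis
      using acts_transitively_C[of k, where 'a = 'a and 'x = 'x] assms(1)[OF m2] assms(2) TA by (simp add: m)
  qed
  have CA: "?TC m \<Longrightarrow> ?TA m" "?PC m \<Longrightarrow> ?PA m" for m
    by (erule acts_transitively_eval; intro eval_mat_GL eval_mat_GL0; assumption)+
  have "?TC m \<longleftrightarrow> ?TA m" if "m \<ge> 1" for m
  proof (cases "m = 1")
    case True
    then show ?thesis
      using CA(1)[of 1] acts_transitively_one_C[OF assms(2), where 'a = 'a] by blast
  next
    case False
    then have "m \<ge> 2"
      using that by simp
    then show ?thesis
      using CA(1) core acts_transitively_GL0_GL by blast
  qed
  then have "{n. 1 \<le> n \<and> (\<forall>m\<ge>n. ?TC m)} = {n. 1 \<le> n \<and> (\<forall>m\<ge>n. ?TA m)}"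
    by auto
  then have gsr: "gsr TYPE('x \<Rightarrow>\<^sub>C 'a) = gsr TYPE('a)"
    unfolding gsr_def by simp
  let ?SA = "{n. 1 \<le> n \<and> (\<forall>m\<ge>n. ?PA m)}" and ?SC = "{n. 1 \<le> n \<and> (\<forall>m\<ge>n. ?PC m)}"
  \<comment> \<open>The detour through \<open>GL m\<close> over A loses nothing, since
    \<open>core\<close> regains the identity component.\<close>
  have AC0: "?PC m" if "m \<ge> 2" "?PA m" for m
    using core[OF that(1)] acts_transitively_GL0_GL[OF that(2)] by blast
  have "csr TYPE('x \<Rightarrow>\<^sub>C 'a) = csr TYPE('a)" if "csr TYPE('a) \<ge> 2"
  proof -
    \<comment> \<open>Every admissible n is at least 2, so \<open>AC0\<close> covers every m that
      has to be compared.\<close>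
    have SA: "2 \<le> n" if "n \<in> ?SA" for n
    proof -
      have "2 \<le> enat n"
        using \<open>csr TYPE('a) \<ge> 2\<close> INF_lower[OF that, of enat] unfolding csr_def by (rule order.trans)
      then show ?thesis
        by (simp add: numeral_eq_enat)
    qed
    have "?SC = ?SA"
    proof (intro equalityI subsetI)
      show "n \<in> ?SA" if "n \<in> ?SC" for n
        using that CA(2) by blast
      show "n \<in> ?SC" if "n \<in> ?SA" for n
        using that SA[OF that] AC0 by (blast intro: order.trans)
    qed
    then show ?thesis
      unfolding csr_def by simp
  qed
  moreover have "csr TYPE('x \<Rightarrow>\<^sub>C 'a) \<in> {1, 2}" if "csr TYPE('a) = 1"
  proof -
    \<comment> \<open>An infimum equal to 1 must be attained, for otherwise every admissible n would
      be at least 2. This gives transitivity over A in every size and hence, by \<open>AC0\<close>,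
      over C(X, A) in every size from 2 on; size 1 stays undecided, which leaves the two
      values.\<close>
    have "1 \<in> ?SA"
    proof (rule ccontr)
      assume "1 \<notin> ?SA"
      then have "2 \<le> n" if "n \<in> ?SA" for n
        using that by (cases "n = 1") auto
      then have "2 \<le> csr TYPE('a)"
        unfolding csr_def by (intro INF_greatest) (simp add: numeral_eq_enat)
      then show False
        using that by simp
    qed
    then have "2 \<in> ?SC"
      using AC0 by auto
    then have "csr TYPE('x \<Rightarrow>\<^sub>C 'a) \<le> enat 2"
      unfolding csr_def by (rule INF_lower)
    moreover have "enat 1 \<le> csr TYPE('x \<Rightarrow>\<^sub>C 'a)"
      unfolding csr_def by (intro INF_greatest) auto
    ultimately show ?thesis
      by (cases "csr TYPE('x \<Rightarrow>\<^sub>C 'a)") (auto simp: one_enat_def numeral_eq_enat)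
  qed
  ultimately show ?thesis
    using gsr by blast
qed

end
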